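(* Let $\Omega\subset\mathbb{R}^n$ be a bounded open set, $n\ge 2$, and let $1<p<\infty$. Consider conductivities $\sigma\in L^\infty_+(\Omega)$ such that either $\sigma\ge 1$ almost everywhere in $\Omega$ or $\sigma\le 1$ almost everywhere in $\Omega$. Then the essential convex hull $\mathrm{conv}(\mathrm{supp}(\sigma-1))$ can be recovered from the Dirichlet-Neumann map $\Lambda_\sigma$, and one can also determine from $\Lambda_\sigma$ whether $\sigma$ is less than or greater than $1$ almost everywhere. That is: if $\sigma_1,\sigma_2$ are two such conductivities (each is $\ge 1$ a.e. or $\le 1$ a.e., not assumed to be on the same side of $1$) and $\Lambda_{\sigma_1}=\Lambda_{\sigma_2}$, then $\mathrm{conv}(\mathrm{supp}(\sigma_1-1))=\mathrm{conv}(\mathrm{supp}(\sigma_2-1))$; moreover $\sigma_1\ge 1$ a.e. if and only if $\sigma_2\ge 1$ a.e., and $\sigma_1\le 1$ a.e. if and only if $\sigma_2\le 1$ a.e.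
   Context: $m$ denotes $n$-dimensional Lebesgue measure. $L^\infty_+(\Omega)=\{f\in L^\infty(\Omega;\mathbb{R}) : \operatorname{ess\,inf} f>0\}$. Dirichlet-Neumann map: let $X=W^{1,p}(\Omega)/W^{1,p}_0(\Omega)$ with dual $X'$. For $\sigma\in L^\infty_+(\Omega)$ and $f\in X$ let $u_\sigma^f$ be the unique minimizer of $E_\sigma(u)=\int_\Omega \sigma|\nabla u|^p\,dx$ over $f+W^{1,p}_0(\Omega)$ (equivalently the weak solution of $\mathrm{div}(\sigma|\nabla u|^{p-2}\nabla u)=0$ in $\Omega$ with boundary value $f$). Then $\Lambda_\sigma:X\to X'$ is the (nonlinear) map $$(\Lambda_\sigma(f),g)=\int_\Omega \sigma|\nabla u_\sigma^f|^{p-2}\nabla u_\sigma^f\cdot\nabla v^g\,dx,\qquad f,g\in X,$$ where $v^g\in W^{1,p}(\Omega)$ is any representative of $g$. Essential support: for measurable $f:\Omega\to\mathbb{R}$, $\mathrm{supp} f$ is the complement in $\Omega$ of the union of all open sets $O\subseteq\Omega$ with $f|_O=0$ almost everywhere. Closed half-spaces: $H_{\rho,t}=\{x\in\mathbb{R}^n : x\cdot\rho\le t\}$ for $\rho\in\mathbb{R}^n$, $t\in\mathbb{R}$. (Closed) essential convex hull: for measurable $A\subset\mathbb{R}^n$, $\mathrm{conv}\,A$ is the intersection of all $H_{\rho,t}$ ($\rho\in\mathbb{R}^n$, $t\in\mathbb{R}$) such that $m(A\setminus H_{\rho,t})=0$. *)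

theory Defs
  imports "HOL-Analysis.Analysis" "HOL-Probability.Essential_Supremum"
begin

(* Functions on an open set Omega are represented by total functions on real^'n of which only
   the values on Omega matter. *)

section \<open>Test functions\<close>

definition partial :: "'n::finite \<Rightarrow> (real^'n \<Rightarrow> real) \<Rightarrow> real^'n \<Rightarrow> real" where
  "partial i f x = frechet_derivative f (at x) (axis i 1)"

primrec C_k :: "nat \<Rightarrow> (real^'n::finite \<Rightarrow> real) \<Rightarrow> bool" where
  "C_k 0 f \<longleftrightarrow> continuous_on UNIV f"
| "C_k (Suc k) f \<longleftrightarrow> (\<forall>x. f differentiable (at x)) \<and> (\<forall>i. C_k k (partial i f))"

(* Elements of C_c^infinity(Omega), extended by zero to the whole space. *)
definition test_function :: "(real^'n::finite) set \<Rightarrow> (real^'n \<Rightarrow> real) \<Rightarrow> bool" where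
  "test_function \<Omega> \<phi> \<longleftrightarrow>
     (\<forall>k. C_k k \<phi>) \<and> compact (closure {x. \<phi> x \<noteq> 0}) \<and> closure {x. \<phi> x \<noteq> 0} \<subseteq> \<Omega>"

section \<open>Sobolev spaces\<close>

definition Lp :: "(real^'n::finite) set \<Rightarrow> real
    \<Rightarrow> (real^'n \<Rightarrow> 'b::{banach, second_countable_topology}) set" where
  "Lp \<Omega> p = {f \<in> borel_measurable (lebesgue_on \<Omega>).
     integrable (lebesgue_on \<Omega>) (\<lambda>x. norm (f x) powr p)}"

definition locally_integrable :: "(real^'n::finite) set
    \<Rightarrow> (real^'n \<Rightarrow> 'b::{banach, second_countable_topology}) \<Rightarrow> bool" where
  "locally_integrable \<Omega> f \<longleftrightarrow> (\<forall>K. compact K \<and> K \<subseteq> \<Omega> \<longrightarrow> set_integrable lebesgue K f)"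

definition has_weak_gradient :: "(real^'n::finite) set
    \<Rightarrow> (real^'n \<Rightarrow> real) \<Rightarrow> (real^'n \<Rightarrow> real^'n) \<Rightarrow> bool" where
  "has_weak_gradient \<Omega> u G \<longleftrightarrow>
     locally_integrable \<Omega> u \<and> locally_integrable \<Omega> G \<and>
     (\<forall>\<phi> i. test_function \<Omega> \<phi> \<longrightarrow>
        (LINT x|lebesgue_on \<Omega>. u x * partial i \<phi> x) =
        - (LINT x|lebesgue_on \<Omega>. G x $ i * \<phi> x))"

(* The weak gradient is only determined almost everywhere on Omega; this picks a representative. *)
definition wgrad :: "(real^'n::finite) set \<Rightarrow> (real^'n \<Rightarrow> real) \<Rightarrow> real^'n \<Rightarrow> real^'n" where
  "wgrad \<Omega> u = (SOME G. has_weak_gradient \<Omega> u G)"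

definition sobolev :: "(real^'n::finite) set \<Rightarrow> real \<Rightarrow> (real^'n \<Rightarrow> real) set" where
  "sobolev \<Omega> p = {u \<in> Lp \<Omega> p. \<exists>G \<in> Lp \<Omega> p. has_weak_gradient \<Omega> u G}"

definition sobolev_norm :: "(real^'n::finite) set \<Rightarrow> real \<Rightarrow> (real^'n \<Rightarrow> real) \<Rightarrow> real" where
  "sobolev_norm \<Omega> p u =
     ((LINT x|lebesgue_on \<Omega>. \<bar>u x\<bar> powr p) +
      (LINT x|lebesgue_on \<Omega>. norm (wgrad \<Omega> u x) powr p)) powr (1 / p)"

definition sobolev_zero :: "(real^'n::finite) set \<Rightarrow> real \<Rightarrow> (real^'n \<Rightarrow> real) set" where
  "sobolev_zero \<Omega> p = {u \<in> sobolev \<Omega> p. \<exists>\<phi> :: nat \<Rightarrow> real^'n \<Rightarrow> real.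
     (\<forall>k. test_function \<Omega> (\<phi> k)) \<and>
     (\<lambda>k. sobolev_norm \<Omega> p (\<lambda>x. u x - \<phi> k x)) \<longlonglongrightarrow> 0}"

section \<open>The Dirichlet-Neumann map\<close>

(* W^{1,p} / W_0^{1,p}.  Functions that agree almost everywhere on Omega lie in the same class,
   and a class f is itself the affine set f + W_0^{1,p}. *)
definition boundary_space :: "(real^'n::finite) set \<Rightarrow> real \<Rightarrow> (real^'n \<Rightarrow> real) set set" where
  "boundary_space \<Omega> p =
     sobolev \<Omega> p // {(u, v). u \<in> sobolev \<Omega> p \<and> v \<in> sobolev \<Omega> p \<and>
                            (\<lambda>x. u x - v x) \<in> sobolev_zero \<Omega> p}"

definition Linf_plus :: "(real^'n::finite) set \<Rightarrow> (real^'n \<Rightarrow> real) set" where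
  "Linf_plus \<Omega> = {\<sigma> \<in> borel_measurable (lebesgue_on \<Omega>).
     esssup (lebesgue_on \<Omega>) (\<lambda>x. ereal \<bar>\<sigma> x\<bar>) < \<infinity> \<and>
     - esssup (lebesgue_on \<Omega>) (\<lambda>x. - ereal (\<sigma> x)) > 0}"

definition p_energy :: "(real^'n::finite) set \<Rightarrow> real
    \<Rightarrow> (real^'n \<Rightarrow> real) \<Rightarrow> (real^'n \<Rightarrow> real) \<Rightarrow> real" where
  "p_energy \<Omega> p \<sigma> u = (LINT x|lebesgue_on \<Omega>. \<sigma> x * norm (wgrad \<Omega> u x) powr p)"

(* The minimizer over f + W_0^{1,p}; it is unique only up to null sets. *)
definition dirichlet_solution :: "(real^'n::finite) set \<Rightarrow> real
    \<Rightarrow> (real^'n \<Rightarrow> real) \<Rightarrow> (real^'n \<Rightarrow> real) set \<Rightarrow> real^'n \<Rightarrow> real" where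
  "dirichlet_solution \<Omega> p \<sigma> f =
     (SOME u. u \<in> f \<and> (\<forall>v\<in>f. p_energy \<Omega> p \<sigma> u \<le> p_energy \<Omega> p \<sigma> v))"

(* Both arguments are restricted to the boundary space, so that equality of two such maps is
   equality as maps from X to the dual of X.  Where the gradient vanishes the integrand is 0,
   also for p < 2, by 0 powr a = 0. *)
definition DN_map :: "(real^'n::finite) set \<Rightarrow> real \<Rightarrow> (real^'n \<Rightarrow> real)
    \<Rightarrow> (real^'n \<Rightarrow> real) set \<Rightarrow> (real^'n \<Rightarrow> real) set \<Rightarrow> real" where
  "DN_map \<Omega> p \<sigma> =
     (\<lambda>f\<in>boundary_space \<Omega> p. \<lambda>g\<in>boundary_space \<Omega> p.
        let Du = wgrad \<Omega> (dirichlet_solution \<Omega> p \<sigma> f);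
            Dv = wgrad \<Omega> (SOME v. v \<in> g)
        in LINT x|lebesgue_on \<Omega>. \<sigma> x * norm (Du x) powr (p - 2) * (Du x \<bullet> Dv x))"

section \<open>Essential support and essential convex hull\<close>

definition ess_supp :: "(real^'n::finite) set \<Rightarrow> (real^'n \<Rightarrow> real) \<Rightarrow> (real^'n) set" where
  "ess_supp \<Omega> f = \<Omega> - \<Union>{U. open U \<and> U \<subseteq> \<Omega> \<and> (AE x in lebesgue_on U. f x = 0)}"

definition half_space :: "real^'n::finite \<Rightarrow> real \<Rightarrow> (real^'n) set" where
  "half_space \<rho> t = {x. x \<bullet> \<rho> \<le> t}"

definition ess_conv :: "(real^'n::finite) set \<Rightarrow> (real^'n) set" where
  "ess_conv A = \<Inter>{half_space \<rho> t | \<rho> t. A - half_space \<rho> t \<in> null_sets lebesgue}"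

end

theory Submission
  imports Defs
begin

text \<open>
The proof is the enclosure method: the Dirichlet-Neumann map is tested with p-harmonic functions whose
gradients grow exponentially in a prescribed direction.

The value of the Dirichlet-Neumann map of \<open>\<sigma>\<close> on the diagonal, at a boundary value \<open>f\<close>, is the minimal energy
\<open>Q\<^sub>\<sigma>(f) = min \<integral> \<sigma> |\<nabla>v|\<^sup>p\<close> over the class \<open>f\<close> (\<open>DN_map_diagonal\<close>). If \<open>u\<close> is a p-harmonic representative of
\<open>f\<close>, then \<open>u\<close> itself is a competitor, which bounds \<open>Q\<^sub>\<sigma>(f)\<close> from above. From below, convexity of \<open>|\<xi>|\<^sup>p\<close> gives the
pointwise inequality \<open>\<sigma> |\<xi>|\<^sup>p \<ge> |\<eta>|\<^sup>p + p * p_flux p \<eta> \<bullet> (\<xi> - \<eta>) + (p - 1) (1 - \<sigma> powr (-1 / (p - 1))) |\<eta>|\<^sup>p\<close>, whose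
middle term integrates to zero for \<open>\<eta> = \<nabla>u\<close> and \<open>\<xi> = \<nabla>v\<close>. Hence (\<open>DN_map_gap\<close>)

\<open>\<integral> (p - 1) (1 - \<sigma> powr (-1 / (p - 1))) |\<nabla>u|\<^sup>p \<le> Q\<^sub>\<sigma>(f) - \<integral> |\<nabla>u|\<^sup>p \<le> \<integral> (\<sigma> - 1) |\<nabla>u|\<^sup>p\<close>.

Both contrasts in these bounds have the sign of \<open>\<sigma> - 1\<close> and vanish exactly where \<open>\<sigma> = 1\<close>. If two conductivities have
the same Dirichlet-Neumann map, the lower bound of one is at most the upper bound of the other. If they
lie on opposite sides of 1, both bounds are therefore zero, and both conductivities equal 1. If they lie on the
same side, then one nonnegative contrast, integrated against \<open>|\<nabla>u|\<^sup>p\<close>, is controlled by the other.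

For \<open>u\<close> one takes Wolff's solutions \<open>u(x) = exp (x \<bullet> \<rho>) a(x \<bullet> \<eta>)\<close> with \<open>\<eta> \<bottom> \<rho>\<close> and \<open>|\<eta>| = |\<rho>|\<close>, for which \<open>|\<nabla>u|\<close>
is comparable to \<open>|\<rho>| exp (x \<bullet> \<rho>)\<close> with constants that depend on \<open>p\<close> only (\<open>wolff_solutions\<close>). Replacing \<open>\<rho>\<close> by
\<open>\<tau> \<rho>\<close> and letting \<open>\<tau>\<close> tend to infinity shows that if one contrast vanishes almost everywhere outside a half-space,
so does the other (\<open>exp_dominated_half_space\<close>). The half-spaces outside of which the contrast vanishes are the ones
that define the essential convex hull (\<open>ess_supp_outside_half_space_null_iff\<close>).

What remains is the theory of the Dirichlet problem for Sobolev functions: the weak gradient is unique, a Poincare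
inequality holds on \<open>sobolev_zero\<close>, minimizing sequences of the energy are Cauchy by a uniform convexity estimate for
\<open>|\<xi>|\<^sup>p\<close>, and the minimizer satisfies the Euler-Lagrange equation. The convexity inequality
\<open>norm_powr_above_tangent\<close> and its strict form lie behind the last three of these facts as well.
\<close>

section \<open>Convexity of the p-th power of the norm\<close>

text \<open>The mean value theorem compares \<open>x\<^sup>p - y\<^sup>p\<close> with the derivative at an intermediate point, and the derivative is
  strictly increasing on the positive half-line.\<close>

lemma powr_above_tangent:
  fixes x y p :: real
  assumes "1 < p" "0 \<le> x" "0 \<le> y" "x \<noteq> y"
  shows "y powr p + p * y powr (p - 1) * (x - y) < x powr p"
proof -
  have cont: "continuous_on {a..b} (\<lambda>z. z powr p)" if "0 \<le> a" for a b :: real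
    using assms(1) that by (intro continuous_on_powr' continuous_intros) auto
  have deriv: "((\<lambda>z. z powr p) has_real_derivative p * z powr (p - 1)) (at z)" if "0 < z" for z :: real
    using that by (auto intro!: derivative_eq_intros)
  have mvt: "\<exists>z. a < z \<and> z < b \<and> b powr p - a powr p = (b - a) * (p * z powr (p - 1))"
    if "0 \<le> a" "a < b" for a b :: real
  proof -
    have "\<exists>l z. a < z \<and> z < b \<and> DERIV (\<lambda>z. z powr p) z :> l \<and> b powr p - a powr p = (b - a) * l"
      using that by (intro MVT cont) (auto simp: real_differentiable_def intro!: deriv exI)
    then obtain l z where z: "a < z" "z < b" "DERIV (\<lambda>z. z powr p) z :> l"
      "b powr p - a powr p = (b - a) * l" by blast
    moreover have "l = p * z powr (p - 1)"
      using z(1,3) deriv[of z] that by (intro DERIV_unique[of "\<lambda>z. z powr p"]) auto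
    ultimately show ?thesis by blast
  qed
  show ?thesis
  proof (cases "y < x")
    case True
    then obtain z where z: "y < z" "z < x" "x powr p - y powr p = (x - y) * (p * z powr (p - 1))"
      using mvt assms by blast
    have "y powr (p - 1) < z powr (p - 1)"
      using z assms by (intro powr_less_mono2) auto
    then have "(x - y) * (p * y powr (p - 1)) < (x - y) * (p * z powr (p - 1))"
      using True assms by simp
    with z show ?thesis by (simp add: algebra_simps)
  next
    case False
    then obtain z where z: "x < z" "z < y" "y powr p - x powr p = (y - x) * (p * z powr (p - 1))"
      using mvt[of x y] assms by auto
    have "z powr (p - 1) < y powr (p - 1)"
      using z assms by (intro powr_less_mono2) auto
    then have "(y - x) * (p * z powr (p - 1)) < (y - x) * (p * y powr (p - 1))"
      using False assms by simp
    with z show ?thesis by (simp add: algebra_simps)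
  qed
qed

text \<open>The gradient of \<open>|\<xi>|\<^sup>p / p\<close>; a function \<open>u\<close> solves the p-Laplace equation if \<open>p_flux p (\<nabla>u)\<close> is divergence free.\<close>

definition p_flux :: "real \<Rightarrow> 'a::real_inner \<Rightarrow> 'a" where
  "p_flux p \<xi> = norm \<xi> powr (p - 2) *\<^sub>R \<xi>"

lemma norm_p_flux: "norm (p_flux p \<xi>) = norm \<xi> powr (p - 1)"
proof (cases "\<xi> = 0")
  case False
  have "norm \<xi> powr (p - 1) = norm \<xi> powr (p - 2) * norm \<xi> powr 1"
    by (subst powr_add[symmetric]) simp
  with False show ?thesis by (simp add: p_flux_def)
qed (simp add: p_flux_def)

lemma p_flux_inner_self: "p_flux p \<xi> \<bullet> \<xi> = norm \<xi> powr p"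
proof (cases "\<xi> = 0")
  case False
  have "norm \<xi> powr p = norm \<xi> powr (p - 2) * norm \<xi> powr 2"
    by (subst powr_add[symmetric]) simp
  with False show ?thesis by (simp add: p_flux_def dot_square_norm)
qed (simp add: p_flux_def)

lemma p_flux_scaleR: "0 \<le> s \<Longrightarrow> p_flux p (s *\<^sub>R \<xi>) = s powr (p - 1) *\<^sub>R p_flux p \<xi>"
proof -
  assume "0 \<le> s"
  moreover have "s powr (p - 2) * s = s powr (p - 1)" if "0 < s"
  proof -
    have "s powr (p - 1) = s powr (p - 2) * s powr 1" by (subst powr_add[symmetric]) simp
    with that show ?thesis by simp
  qed
  ultimately show ?thesis
    by (cases "s = 0") (auto simp: p_flux_def powr_mult mult_ac)
qed

lemma p_flux_inner_le: "p_flux p \<xi> \<bullet> \<zeta> \<le> norm \<xi> powr (p - 1) * norm \<zeta>"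
  using norm_cauchy_schwarz[of "p_flux p \<xi>" \<zeta>] by (simp add: norm_p_flux)

text \<open>At the origin, where the factor \<open>|\<xi>| powr (p - 2)\<close> may be singular, the flux tends to 0 because its norm is
  \<open>|\<xi>| powr (p - 1)\<close>.\<close>

lemma continuous_p_flux:
  fixes \<xi> :: "'a::real_inner"
  assumes "1 < p" shows "isCont (p_flux p) \<xi>"
proof (cases "\<xi> = 0")
  case True
  have "(p_flux p \<longlongrightarrow> 0) (at (0::'a))"
  proof (rule tendsto_norm_zero_cancel)
    have "((\<lambda>\<xi>::'a. norm \<xi> powr (p - 1)) \<longlongrightarrow> norm (0::'a) powr (p - 1)) (at 0)"
      using assms by (intro tendsto_powr' tendsto_intros) auto
    then show "((\<lambda>\<xi>::'a. norm (p_flux p \<xi>)) \<longlongrightarrow> 0) (at 0)" by (simp add: norm_p_flux)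
  qed
  with True show ?thesis by (simp add: isCont_def p_flux_def)
next
  case False
  then show ?thesis unfolding p_flux_def
    by (intro continuous_intros) auto
qed

lemma continuous_on_p_flux: "1 < p \<Longrightarrow> continuous_on A (p_flux p)"
  by (simp add: continuous_at_imp_continuous_on continuous_p_flux)

text \<open>If the norms differ, Cauchy-Schwarz reduces the claim to the scalar inequality; if they agree,
  strictness comes from \<open>\<eta> \<bullet> \<xi> < |\<eta>|\<^sup>2\<close>.\<close>

lemma norm_powr_above_tangent_strict:
  fixes \<xi> \<eta> :: "'a::real_inner"
  assumes "1 < p" "\<xi> \<noteq> \<eta>"
  shows "norm \<eta> powr p + p * (p_flux p \<eta> \<bullet> (\<xi> - \<eta>)) < norm \<xi> powr p"
proof -
  have split: "p_flux p \<eta> \<bullet> (\<xi> - \<eta>) = p_flux p \<eta> \<bullet> \<xi> - norm \<eta> powr (p - 1) * norm \<eta>"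
  proof -
    have "norm \<eta> powr p = norm \<eta> powr (p - 1) * norm \<eta>"
    proof -
      have "norm \<eta> powr p = norm \<eta> powr (p - 1) * norm \<eta> powr 1" by (subst powr_add[symmetric]) simp
      then show ?thesis by simp
    qed
    then show ?thesis by (simp add: inner_diff_right p_flux_inner_self)
  qed
  show ?thesis
  proof (cases "norm \<xi> = norm \<eta>")
    case True
    then have "\<eta> \<noteq> 0" using assms by auto
    have "0 < (norm (\<xi> - \<eta>))\<^sup>2" using assms by simp
    also have "\<dots> = 2 * ((norm \<eta>)\<^sup>2 - \<eta> \<bullet> \<xi>)"
      unfolding power2_norm_eq_inner using True
      by (simp add: inner_diff inner_commute norm_eq algebra_simps)
    finally have "\<eta> \<bullet> (\<xi> - \<eta>) < 0" by (simp add: inner_diff_right power2_norm_eq_inner)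
    then have "p_flux p \<eta> \<bullet> (\<xi> - \<eta>) < 0"
      using \<open>\<eta> \<noteq> 0\<close> by (simp add: p_flux_def mult_pos_neg)
    then have "p * (p_flux p \<eta> \<bullet> (\<xi> - \<eta>)) < 0" using assms(1) by (intro mult_pos_neg) auto
    with True show ?thesis by simp
  next
    case False
    have "p * (p_flux p \<eta> \<bullet> (\<xi> - \<eta>)) \<le> p * norm \<eta> powr (p - 1) * (norm \<xi> - norm \<eta>)"
      unfolding split using p_flux_inner_le[of p \<eta> \<xi>] assms(1)
      by (simp add: algebra_simps)
    with powr_above_tangent[OF assms(1) norm_ge_zero norm_ge_zero False] show ?thesis
      by linarith
  qed
qed

lemma norm_powr_above_tangent:
  fixes \<xi> \<eta> :: "'a::real_inner"
  assumes "1 < p"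
  shows "norm \<eta> powr p + p * (p_flux p \<eta> \<bullet> (\<xi> - \<eta>)) \<le> norm \<xi> powr p"
  using norm_powr_above_tangent_strict[OF assms, of \<xi> \<eta>] by (cases "\<xi> = \<eta>") auto

text \<open>The left-hand side is affine in \<open>\<xi>\<close>. It is \<open>s\<close> times the tangent of \<open>|\<xi>|\<^sup>p\<close> at the multiple \<open>r \<eta>\<close> at which
  the gradient of \<open>s |\<xi>|\<^sup>p\<close> equals the gradient of \<open>|\<xi>|\<^sup>p\<close> at \<open>\<eta>\<close>, that is, for \<open>s * r powr (p - 1) = 1\<close>. This inequality yields
  the lower bound in \<open>DN_map_gap\<close>.\<close>

lemma weighted_norm_powr_lower_bound:
  fixes \<xi> \<eta> :: "'a::real_inner"
  assumes "1 < p" "0 < s"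
  shows "norm \<eta> powr p + p * (p_flux p \<eta> \<bullet> (\<xi> - \<eta>))
      + (p - 1) * (1 - s powr (- 1 / (p - 1))) * norm \<eta> powr p \<le> s * norm \<xi> powr p"
proof -
  define r where "r = s powr (- 1 / (p - 1))"
  have "0 < r" using assms by (simp add: r_def)
  have rp1: "s * r powr (p - 1) = 1"
  proof -
    have "r powr (p - 1) = s powr (- 1)"
      using assms unfolding r_def powr_powr by (intro arg_cong2[where f="(powr)"]) auto
    then show ?thesis using assms by (simp add: powr_minus_divide)
  qed
  have rp: "s * r powr p = r"
  proof -
    have "r powr p = r powr (p - 1) * r powr 1" by (subst powr_add[symmetric]) simp
    then show ?thesis using rp1 \<open>0 < r\<close> by simp
  qed
  have "s * (norm (r *\<^sub>R \<eta>) powr p + p * (p_flux p (r *\<^sub>R \<eta>) \<bullet> (\<xi> - r *\<^sub>R \<eta>))) \<le> s * norm \<xi> powr p"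
    using assms by (intro mult_left_mono norm_powr_above_tangent) auto
  moreover have "s * (norm (r *\<^sub>R \<eta>) powr p + p * (p_flux p (r *\<^sub>R \<eta>) \<bullet> (\<xi> - r *\<^sub>R \<eta>)))
      = (s * r powr p) * norm \<eta> powr p
        + p * (s * r powr (p - 1)) * (p_flux p \<eta> \<bullet> \<xi> - r * norm \<eta> powr p)"
    using \<open>0 < r\<close>
    by (simp add: p_flux_scaleR powr_mult inner_diff_right p_flux_inner_self algebra_simps)
  ultimately show ?thesis
    unfolding rp rp1 r_def[symmetric]
    by (simp add: inner_diff_right p_flux_inner_self algebra_simps)
qed

lemma powr_add_le:
  fixes a b p :: real
  assumes "0 \<le> a" "0 \<le> b" "0 \<le> p"
  shows "(a + b) powr p \<le> 2 powr p * (a powr p + b powr p)"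
proof -
  have "(a + b) powr p \<le> (2 * max a b) powr p"
    using assms by (intro powr_mono2) auto
  also have "\<dots> = 2 powr p * max a b powr p" using assms by (simp add: powr_mult)
  also have "max a b powr p \<le> a powr p + b powr p"
    by (auto simp: max_def)
  finally show ?thesis by simp
qed

lemma norm_add_powr_le:
  fixes a b :: "'a::real_normed_vector"
  assumes "0 \<le> p"
  shows "norm (a + b) powr p \<le> 2 powr p * (norm a powr p + norm b powr p)"
proof -
  have "norm (a + b) powr p \<le> (norm a + norm b) powr p"
    using assms by (intro powr_mono2 norm_triangle_ineq) auto
  also have "\<dots> \<le> 2 powr p * (norm a powr p + norm b powr p)"
    using assms by (intro powr_add_le) auto
  finally show ?thesis .
qed

lemma norm_diff_powr_le:
  fixes a b :: "'a::real_normed_vector"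
  assumes "0 \<le> p"
  shows "norm (a - b) powr p \<le> 2 powr p * (norm a powr p + norm b powr p)"
  using norm_add_powr_le[OF assms, of a "- b"] by simp

text \<open>Young's inequality with constant 1, by comparison of \<open>a\<close> and \<open>b\<close> with the larger of the two.\<close>

lemma powr_minus_one_mult_le:
  fixes a b p :: real
  assumes "1 < p" "0 \<le> a" "0 \<le> b"
  shows "a powr (p - 1) * b \<le> a powr p + b powr p"
proof (cases "a \<le> b")
  case True
  have "a powr (p - 1) * b \<le> b powr (p - 1) * b"
    using True assms by (intro mult_right_mono powr_mono2) auto
  also have "\<dots> = b powr p" using assms powr_mult_base[of b "p-1"] by (simp add: mult.commute)
  finally show ?thesis by (simp add: add_increasing)
next
  case False
  have "a powr (p - 1) * b \<le> a powr (p - 1) * a"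
    using False assms by (intro mult_left_mono) auto
  also have "\<dots> = a powr p" using assms powr_mult_base[of a "p-1"] by (simp add: mult.commute)
  finally show ?thesis by (simp add: add_increasing2)
qed

text \<open>Apply \<open>powr_minus_one_mult_le\<close> to \<open>l a\<close> and \<open>b\<close>. The weight of the first term can be made small at the cost of the
  second one, which serves for absorption.\<close>

lemma powr_minus_one_mult_le_scaled:
  fixes a b p l :: real
  assumes "1 < p" "0 \<le> a" "0 \<le> b" "0 < l"
  shows "a powr (p - 1) * b \<le> l * a powr p + l powr (1 - p) * b powr p"
proof -
  have "l powr (p - 1) * (a powr (p - 1) * b) \<le> l powr p * a powr p + b powr p"
    using powr_minus_one_mult_le[of p "l * a" b] assms by (simp add: powr_mult mult_ac)
  then have "l powr (1 - p) * (l powr (p - 1) * (a powr (p - 1) * b)) \<le> l powr (1 - p) * (l powr p * a powr p + b powr p)"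
    by (intro mult_left_mono) auto
  moreover have "l powr (1 - p) * l powr (p - 1) = 1" "l powr (1 - p) * l powr p = l"
    using assms by (simp_all flip: powr_add)
  ultimately show ?thesis
    by (simp add: distrib_left mult.assoc[symmetric])
qed

text \<open>The gap in the midpoint convexity of \<open>|\<xi>|\<^sup>p\<close>. Along a minimizing sequence its integral tends to 0.\<close>

definition convexity_defect :: "real \<Rightarrow> 'a::real_normed_vector \<Rightarrow> 'a \<Rightarrow> real" where
  "convexity_defect p a b =
     (norm a powr p + norm b powr p) / 2 - norm ((1/2) *\<^sub>R (a + b)) powr p"

lemma convexity_defect_pos:
  fixes a b :: "'a::real_inner"
  assumes "1 < p" "a \<noteq> b"
  shows "0 < convexity_defect p a b"
proof -
  define m where "m = (1/2) *\<^sub>R (a + b)"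
  have eq: "a - m = (1/2) *\<^sub>R (a - b)" "b - m = - ((1/2) *\<^sub>R (a - b))"
    by (auto simp: m_def algebra_simps simp flip: scaleR_add_left)
  have "a \<noteq> m" "b \<noteq> m" using assms(2) eq by auto
  then have "norm m powr p + p * (p_flux p m \<bullet> (a - m)) < norm a powr p"
    "norm m powr p + p * (p_flux p m \<bullet> (b - m)) < norm b powr p"
    using assms(1) norm_powr_above_tangent_strict by blast+
  then show ?thesis unfolding eq convexity_defect_def m_def[symmetric]
    by simp
qed

lemma convexity_defect_nonneg:
  fixes a b :: "'a::real_inner"
  assumes "1 < p"
  shows "0 \<le> convexity_defect p a b"
  using convexity_defect_pos[OF assms, of a b]
  by (cases "a = b") (auto simp: convexity_defect_def simp flip: scaleR_2)

lemma convexity_defect_scaleR: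
  "0 \<le> t \<Longrightarrow> convexity_defect p (t *\<^sub>R a) (t *\<^sub>R b) = t powr p * convexity_defect p a b"
proof -
  assume t: "0 \<le> t"
  have "norm ((1/2) *\<^sub>R (t *\<^sub>R a + t *\<^sub>R b)) = t * norm ((1/2) *\<^sub>R (a + b))"
    using t by (simp flip: scaleR_add_right)
  then show ?thesis using t
    unfolding convexity_defect_def by (simp add: powr_mult algebra_simps add_divide_distrib)
qed

text \<open>A uniform convexity estimate for all \<open>p > 1\<close>, in place of Clarkson's inequalities. All terms are homogeneous of
  degree \<open>p\<close>, so it suffices to consider the compact set where \<open>|a|\<^sup>p + |b|\<^sup>p = 1\<close>. There, on the part where
  \<open>|a - b|\<^sup>p \<ge> \<epsilon>\<close>, the defect is continuous and positive, hence bounded away from 0.\<close>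

lemma difference_le_convexity_defect:
  fixes p \<epsilon> :: real
  assumes p: "1 < p" and eps: "0 < \<epsilon>"
  obtains C where "0 \<le> C"
    "\<And>a b :: 'a::euclidean_space.
       norm (a - b) powr p \<le> C * convexity_defect p a b + \<epsilon> * (norm a powr p + norm b powr p)"
proof -
  define N where "N = (\<lambda>z::'a\<times>'a. norm (fst z) powr p + norm (snd z) powr p)"
  define D where "D = (\<lambda>z::'a\<times>'a. convexity_defect p (fst z) (snd z))"
  define K where "K = {z. N z = 1} \<inter> {z. \<epsilon> \<le> norm (fst z - snd z) powr p}"
  have contN: "continuous_on UNIV N"
    unfolding N_def using p by (intro continuous_intros continuous_on_powr') auto
  have contD: "continuous_on UNIV D"
    unfolding D_def convexity_defect_def using p by (intro continuous_intros continuous_on_powr') auto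
  have contd: "continuous_on UNIV (\<lambda>z::'a\<times>'a. norm (fst z - snd z) powr p)"
    using p by (intro continuous_intros continuous_on_powr') auto
  have "closed K" unfolding K_def
    by (intro closed_Int closed_Collect_eq closed_Collect_le contN contd continuous_intros)
  moreover have "bounded K"
  proof -
    have "norm z \<le> 2" if "z \<in> K" for z
    proof -
      have le1: "x \<le> 1" if "0 \<le> x" "x powr p \<le> 1" for x :: real
      proof (rule ccontr)
        assume "\<not> x \<le> 1"
        then have "1 powr p < x powr p" using p by (intro powr_less_mono2) auto
        with that show False by simp
      qed
      from that have *: "norm (fst z) powr p + norm (snd z) powr p = 1" by (auto simp: K_def N_def)
      have "norm (fst z) \<le> 1" "norm (snd z) \<le> 1"
        using * le1[of "norm (fst z)"] le1[of "norm (snd z)"]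
          powr_ge_zero[of "norm (fst z)" p] powr_ge_zero[of "norm (snd z)" p]
        by (simp_all del: powr_ge_zero)
      then show ?thesis using norm_Pair_le[of "fst z" "snd z"] by simp
    qed
    then show ?thesis unfolding bounded_iff by blast
  qed
  ultimately have "compact K" by (simp add: compact_eq_bounded_closed)
  have Dpos: "0 < D z" if "z \<in> K" for z
  proof -
    have "fst z \<noteq> snd z" using that eps by (auto simp: K_def)
    then show ?thesis unfolding D_def using p by (intro convexity_defect_pos)
  qed
  obtain \<delta> where \<delta>: "0 < \<delta>" "\<And>z. z \<in> K \<Longrightarrow> \<delta> \<le> D z"
  proof (cases "K = {}")
    case False
    obtain z where "z \<in> K" "\<And>y. y \<in> K \<Longrightarrow> D z \<le> D y"
      using continuous_attains_inf[OF \<open>compact K\<close> False continuous_on_subset[OF contD]] by auto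
    then show ?thesis using that[of "D z"] Dpos by auto
  qed (use that[of 1] in auto)
  define C where "C = 2 powr p / \<delta>"
  have unit: "norm (fst z - snd z) powr p \<le> C * D z + \<epsilon> * N z" if "N z = 1" for z
  proof (cases "z \<in> K")
    case True
    have "norm (fst z - snd z) powr p \<le> 2 powr p * N z"
      unfolding N_def using p by (intro norm_diff_powr_le) auto
    also have "\<dots> = C * \<delta>" using that \<delta> by (simp add: C_def)
    also have "\<dots> \<le> C * D z" using \<delta> True by (intro mult_left_mono) (auto simp: C_def)
    finally show ?thesis using that eps by simp
  next
    case False
    then have "norm (fst z - snd z) powr p \<le> \<epsilon> * N z" using that by (auto simp: K_def)
    moreover have "0 \<le> C * D z"
      using \<delta> convexity_defect_nonneg[OF p, of "fst z" "snd z"] by (simp add: C_def D_def)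
    ultimately show ?thesis by simp
  qed
  show ?thesis
  proof
    show "0 \<le> C" using \<delta> by (simp add: C_def)
    fix a b :: 'a
    show "norm (a - b) powr p \<le> C * convexity_defect p a b + \<epsilon> * (norm a powr p + norm b powr p)"
    proof (cases "N (a, b) = 0")
      case True
      then have "a = 0" "b = 0"
        by (auto simp: N_def add_nonneg_eq_0_iff)
      then show ?thesis by (simp add: convexity_defect_def)
    next
      case False
      define t where "t = N (a, b) powr (- 1 / p)"
      have "0 < N (a, b)" using False by (simp add: N_def order_less_le add_nonneg_nonneg)
      moreover have "t powr p = N (a, b) powr (- 1)"
        using p unfolding t_def powr_powr by (intro arg_cong2[where f="(powr)"]) auto
      ultimately have t: "0 < t" "t powr p * N (a, b) = 1"
        by (auto simp: t_def powr_minus_divide)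
      have "N (t *\<^sub>R a, t *\<^sub>R b) = t powr p * N (a, b)"
        using t by (simp add: N_def powr_mult distrib_left)
      moreover have "norm (t *\<^sub>R a - t *\<^sub>R b) powr p = t powr p * norm (a - b) powr p"
        using t by (simp add: powr_mult flip: scaleR_diff_right)
      ultimately have "t powr p * norm (a - b) powr p
          \<le> C * (t powr p * convexity_defect p a b) + \<epsilon> * (t powr p * N (a, b))"
        using unit[of "(t *\<^sub>R a, t *\<^sub>R b)"] t
        by (simp add: D_def convexity_defect_scaleR)
      then have "t powr p * norm (a - b) powr p
          \<le> t powr p * (C * convexity_defect p a b + \<epsilon> * N (a, b))"
        by (simp only: distrib_left mult.left_commute)
      then show ?thesis using t by (simp add: N_def)
    qed
  qed
qed

section \<open>Smooth bump functions\<close>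

lemma partial_eqI: "(f has_derivative D) (at x) \<Longrightarrow> partial i f x = D (axis i 1)"
  unfolding partial_def using frechet_derivative_at by metis

lemma has_derivative_frechet: "f differentiable (at x) \<Longrightarrow> (f has_derivative frechet_derivative f (at x)) (at x)"
  by (simp add: frechet_derivative_works)

lemma partial_add:
  assumes "f differentiable (at x)" "g differentiable (at x)"
  shows "partial i (\<lambda>x. f x + g x) x = partial i f x + partial i g x"
  using partial_eqI[OF has_derivative_add[OF assms[THEN has_derivative_frechet]]]
  by (simp add: partial_def)

lemma partial_mult:
  assumes "f differentiable (at x)" "g differentiable (at x)"
  shows "partial i (\<lambda>x. f x * g x) x = f x * partial i g x + partial i f x * g x"
  using partial_eqI[OF has_derivative_mult[OF assms[THEN has_derivative_frechet]]]
  by (simp add: partial_def)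

lemma partial_const [simp]: "partial i (\<lambda>x. c) x = 0"
  by (rule partial_eqI[OF has_derivative_const])

lemma C_k_Suc_D: "C_k (Suc k) f \<Longrightarrow> C_k k f"
proof (induction k arbitrary: f)
  case 0
  then show ?case
    by (auto intro!: continuous_at_imp_continuous_on differentiable_imp_continuous_within)
qed auto

lemma C_k_const: "C_k k (\<lambda>x::real^'n::finite. c)"
proof (induction k arbitrary: c)
  case (Suc k)
  have "partial i (\<lambda>x::real^'n. c) = (\<lambda>x. 0)" for i by auto
  with Suc show ?case by simp
qed simp

lemma C_k_add: "C_k k f \<Longrightarrow> C_k k g \<Longrightarrow> C_k k (\<lambda>x. f x + g x)"
proof (induction k arbitrary: f g)
  case (Suc k)
  have "partial i (\<lambda>x. f x + g x) = (\<lambda>x. partial i f x + partial i g x)" for i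
    using Suc.prems by (auto simp: partial_add)
  with Suc show ?case by simp
qed (auto intro: continuous_on_add)

lemma C_k_mult: "C_k k f \<Longrightarrow> C_k k g \<Longrightarrow> C_k k (\<lambda>x. f x * g x)"
proof (induction k arbitrary: f g)
  case (Suc k)
  have "partial i (\<lambda>x. f x * g x) = (\<lambda>x. f x * partial i g x + partial i f x * g x)" for i
    using Suc.prems by (auto simp: partial_mult)
  moreover have "C_k k (\<lambda>x. f x * partial i g x + partial i f x * g x)" for i
    using Suc.prems C_k_Suc_D[OF Suc.prems(1)] C_k_Suc_D[OF Suc.prems(2)]
    by (intro C_k_add Suc.IH) auto
  ultimately show ?case using Suc.prems by simp
qed (auto intro: continuous_on_mult)

lemma C_k_prod:
  "finite I \<Longrightarrow> (\<And>i. i \<in> I \<Longrightarrow> C_k k (f i)) \<Longrightarrow> C_k k (\<lambda>x. \<Prod>i\<in>I. f i x)"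
  by (induction I rule: finite_induct) (auto intro: C_k_mult C_k_const)

text \<open>A set of real functions that is closed under differentiation consists of smooth functions; composition with an
  affine function of one coordinate preserves smoothness in the iterated sense of \<open>C_k\<close>.\<close>

lemma C_k_coordinate:
  assumes S: "\<And>g. g \<in> S \<Longrightarrow> \<exists>g'\<in>S. \<forall>t. (g has_real_derivative g' t) (at t)"
    and "g \<in> S"
  shows "C_k k (\<lambda>x::real^'n::finite. g (a * x $ i + b))"
  using \<open>g \<in> S\<close>
proof (induction k arbitrary: g)
  case 0
  from S[OF 0] obtain g' where "\<And>t. (g has_real_derivative g' t) (at t)" by blast
  then have "continuous_on UNIV g"
    by (meson DERIV_isCont continuous_at_imp_continuous_on)
  then have "continuous_on UNIV (\<lambda>x::real^'n. g (a * x $ i + b))"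
    by (rule continuous_on_compose2) (auto intro!: continuous_intros)
  then show ?case by simp
next
  case (Suc k)
  from S[OF Suc.prems] obtain g' where g': "g' \<in> S" "\<And>t. (g has_real_derivative g' t) (at t)" by blast
  have D: "((\<lambda>x::real^'n. g (a * x $ i + b)) has_derivative (\<lambda>h. g' (a * x $ i + b) * (a * h $ i))) (at x)"
    for x
  proof -
    have "((\<lambda>x::real^'n. a * x $ i + b) has_derivative (\<lambda>h. a * h $ i)) (at x)"
      by (auto intro!: derivative_eq_intros bounded_linear.has_derivative[OF bounded_linear_vec_nth])
    from has_derivative_compose[OF this, of g "\<lambda>h. g' (a * x $ i + b) * h"] g'(2) show ?thesis
      by (simp add: has_field_derivative_def)
  qed
  have "partial j (\<lambda>x::real^'n. g (a * x $ i + b))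
      = (\<lambda>x. (if i = j then a else 0) * g' (a * x $ i + b))" for j
    using partial_eqI[OF D] by (auto simp: axis_def)
  moreover have "C_k k (\<lambda>x::real^'n. (if i = j then a else 0) * g' (a * x $ i + b))" for j
    by (intro C_k_mult C_k_const Suc.IH g'(1))
  ultimately show ?case using D by (auto simp: differentiable_def)
qed

text \<open>With \<open>P = 1\<close> this is the smooth function \<open>exp (- 1 / t)\<close> that vanishes for \<open>t \<le> 0\<close>. The polynomial factors in \<open>1 / t\<close> make
  the family closed under differentiation.\<close>

definition flat_exp :: "real poly \<Rightarrow> real \<Rightarrow> real" where
  "flat_exp P t = (if 0 < t then poly P (1 / t) * exp (- (1 / t)) else 0)"

lemma tendsto_poly_exp_neg: "((\<lambda>s. poly Q s * exp (- s)) \<longlongrightarrow> (0::real)) at_top"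
proof -
  have "((\<lambda>s. \<Sum>i\<le>degree Q. coeff Q i * (s ^ i / exp s)) \<longlongrightarrow> (\<Sum>i\<le>degree Q. coeff Q i * (0::real))) at_top"
    by (intro tendsto_sum tendsto_mult tendsto_const tendsto_power_div_exp_0)
  then show ?thesis
    by (simp add: poly_altdef sum_distrib_right exp_minus divide_inverse mult.assoc)
qed

lemma flat_exp_has_derivative:
  "(flat_exp P has_real_derivative flat_exp ((P - pderiv P) * [:0, 0, 1:]) t) (at t)"
proof -
  consider "0 < t" | "t = 0" | "t < 0" by linarith
  then show ?thesis
  proof cases
    case 1
    have "((\<lambda>t. poly P (1 / t) * exp (- (1 / t))) has_real_derivative
        flat_exp ((P - pderiv P) * [:0, 0, 1:]) t) (at t)"
      using 1
      by (auto intro!: derivative_eq_intros DERIV_chain'[OF _ poly_DERIV]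
          simp: flat_exp_def divide_simps power2_eq_square) (simp add: algebra_simps)
    then show ?thesis
      by (rule has_field_derivative_transform_within_open[where S = "{0<..}"])
        (use 1 in \<open>auto simp: flat_exp_def\<close>)
  next
    case 2
    have "((\<lambda>s. poly (P * [:0, 1:]) s * exp (- s)) \<longlongrightarrow> 0) at_top"
      by (rule tendsto_poly_exp_neg)
    then have "((\<lambda>h. poly (P * [:0, 1:]) (inverse h) * exp (- inverse h)) \<longlongrightarrow> 0) (at_right 0)"
      by (rule filterlim_compose[OF _ filterlim_inverse_at_top_right])
    then have r: "((\<lambda>h. (flat_exp P h - flat_exp P 0) / h) \<longlongrightarrow> 0) (at_right 0)"
      by (rule Lim_transform_eventually)
        (auto simp: eventually_at_right_less flat_exp_def field_simps
          intro!: eventually_mono[OF eventually_at_right_less])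
    have l: "((\<lambda>h. (flat_exp P h - flat_exp P 0) / h) \<longlongrightarrow> 0) (at_left 0)"
      by (rule tendsto_eventually)
        (auto simp: flat_exp_def eventually_at_left_field intro!: exI[of _ "-1"])
    show ?thesis using 2 filterlim_split_at_real[OF l r]
      by (simp add: DERIV_def flat_exp_def)
  next
    case 3
    have "((\<lambda>t. 0) has_real_derivative flat_exp ((P - pderiv P) * [:0, 0, 1:]) t) (at t)"
      using 3 by (simp add: flat_exp_def)
    then show ?thesis
      by (rule has_field_derivative_transform_within_open[where S = "{..<0}"])
        (use 3 in \<open>auto simp: flat_exp_def\<close>)
  qed
qed

text \<open>The linear functions are written as \<open>k * x $ i + b\<close> to match \<open>C_k_coordinate\<close>. As \<open>k\<close> grows, the bumps converge to the
  indicator of the box, without any normalization.\<close>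

definition box_bump :: "real \<Rightarrow> real^'n::finite \<Rightarrow> real^'n \<Rightarrow> real^'n \<Rightarrow> real" where
  "box_bump k a b x =
     (\<Prod>i\<in>UNIV. flat_exp 1 (k * x $ i + - k * a $ i) * flat_exp 1 (- k * x $ i + k * b $ i))"

lemma C_k_box_bump: "C_k m (box_bump k a b)"
proof -
  have S: "\<exists>g'\<in>range flat_exp. \<forall>t. (g has_real_derivative g' t) (at t)" if "g \<in> range flat_exp" for g
    using that flat_exp_has_derivative by blast
  show ?thesis unfolding box_bump_def
    by (intro C_k_prod C_k_mult C_k_coordinate[where S = "range flat_exp"] S) auto
qed

lemma flat_exp_1_bounds: "0 \<le> flat_exp 1 t" "flat_exp 1 t \<le> 1"
  by (auto simp: flat_exp_def)

lemma box_bump_bounds: "0 \<le> box_bump k a b x" "box_bump k a b x \<le> 1"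
  unfolding box_bump_def
  by (auto intro!: prod_nonneg prod_le_1 mult_nonneg_nonneg mult_le_one flat_exp_1_bounds)

lemma box_bump_eq_0:
  assumes "0 < k" "x \<notin> box a b"
  shows "box_bump k a b x = 0"
proof -
  from assms(2) obtain i where "x $ i \<le> a $ i \<or> b $ i \<le> x $ i"
    by (auto simp: mem_box_cart not_less)
  then have "flat_exp 1 (k * x $ i + - k * a $ i) = 0 \<or> flat_exp 1 (- k * x $ i + k * b $ i) = 0"
    using assms(1) by (auto simp: flat_exp_def not_less)
  then show ?thesis unfolding box_bump_def by (intro prod_zero) auto
qed

lemma test_function_box_bump:
  assumes "cbox a b \<subseteq> \<Omega>" "0 < k"
  shows "test_function \<Omega> (box_bump k a b)"
proof -
  have "{x. box_bump k a b x \<noteq> 0} \<subseteq> cbox a b"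
    using box_bump_eq_0[OF assms(2)] box_subset_cbox[of a b] by blast
  then have "closure {x. box_bump k a b x \<noteq> 0} \<subseteq> cbox a b"
    by (simp add: closed_cbox closure_minimal)
  then show ?thesis using assms(1) unfolding test_function_def
    by (auto simp: C_k_box_bump compact_eq_bounded_closed intro: bounded_subset[OF bounded_cbox])
qed

lemma box_bump_tendsto_indicator:
  "(\<lambda>k. box_bump (real (Suc k)) a b x) \<longlonglongrightarrow> indicator (box a b) x"
proof (cases "x \<in> box a b")
  case False
  then show ?thesis by (simp add: box_bump_eq_0 del: of_nat_Suc)
next
  case True
  have *: "(\<lambda>k. flat_exp 1 (real (Suc k) * c)) \<longlonglongrightarrow> 1" if "0 < c" for c
  proof -
    have "(\<lambda>k. exp (- (inverse (real (Suc k)) * inverse c))) \<longlonglongrightarrow> exp (- (0 * inverse c))"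
      by (intro tendsto_intros LIMSEQ_inverse_real_of_nat)
    moreover have "flat_exp 1 (real (Suc k) * c) = exp (- (inverse (real (Suc k)) * inverse c))" for k
      using that by (simp add: flat_exp_def divide_inverse del: of_nat_Suc)
    ultimately show ?thesis by simp
  qed
  have "(\<lambda>k. \<Prod>i\<in>UNIV. flat_exp 1 (real (Suc k) * (x $ i - a $ i)) * flat_exp 1 (real (Suc k) * (b $ i - x $ i)))
      \<longlonglongrightarrow> (\<Prod>i\<in>(UNIV::'a set). 1 * 1)"
    using True by (intro tendsto_prod tendsto_mult *) (auto simp: mem_box_cart)
  then show ?thesis using True by (simp add: box_bump_def algebra_simps)
qed

lemma test_function_C_k: "test_function \<Omega> \<phi> \<Longrightarrow> C_k k \<phi>"
  by (simp add: test_function_def)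

section \<open>Integration by parts\<close>

lemma integrable_lebesgue_compact_support:
  fixes f :: "'a::euclidean_space \<Rightarrow> 'b::euclidean_space"
  assumes "continuous_on UNIV f" "compact K" "\<And>x. x \<notin> K \<Longrightarrow> f x = 0"
  shows "integrable lebesgue f"
proof -
  have "integrable lborel (\<lambda>x. indicator K x *\<^sub>R f x)"
    using assms by (intro borel_integrable_compact continuous_on_subset[OF assms(1)]) auto
  moreover have "(\<lambda>x. indicator K x *\<^sub>R f x) = f"
    using assms(3) by (auto simp: indicator_def)
  ultimately have "integrable lborel f" by simp
  then show ?thesis
    using integrable_completion[of f lborel] borel_measurable_integrable by blast
qed

lemma eq_0_outside_support: "x \<notin> closure {x. \<psi> x \<noteq> 0} \<Longrightarrow> \<psi> x = 0"
  using closure_subset[of "{x. \<psi> x \<noteq> 0}"] by auto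

lemma compact_closure_mono:
  assumes "closure A \<subseteq> closure B" "compact (closure B)"
  shows "compact (closure A)"
  using compact_Int_closed[OF assms(2), of "closure A"] assms(1)
  by (simp add: Int_absorb1)

text \<open>The complement of the closed support is open and the function vanishes on it.\<close>

lemma partial_eq_0_outside_support:
  assumes "x \<notin> closure {x. \<psi> x \<noteq> 0}"
  shows "partial i \<psi> x = 0"
proof -
  have "(\<psi> has_derivative (\<lambda>h. 0)) (at x)"
    by (rule has_derivative_transform_within_open[where s = "- closure {x. \<psi> x \<noteq> 0}" and f = "\<lambda>x. 0"])
      (use assms eq_0_outside_support in \<open>auto intro!: derivative_eq_intros\<close>)
  then show ?thesis by (rule partial_eqI)
qed

lemma has_derivative_along_axis:
  fixes \<psi> :: "real^'n::finite \<Rightarrow> real"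
  assumes "\<And>x. \<psi> differentiable (at x)"
  shows "((\<lambda>t. \<psi> (x + t *\<^sub>R axis i 1)) has_real_derivative partial i \<psi> (x + t *\<^sub>R axis i 1)) (at t)"
proof -
  have "((\<lambda>t. x + t *\<^sub>R axis i (1::real)) has_derivative (\<lambda>h. h *\<^sub>R axis i 1)) (at t)"
    by (auto intro!: derivative_eq_intros)
  from has_derivative_compose[OF this has_derivative_frechet[OF assms]]
  have D: "((\<lambda>t. \<psi> (x + t *\<^sub>R axis i 1)) has_derivative
      (\<lambda>h. frechet_derivative \<psi> (at (x + t *\<^sub>R axis i 1)) (h *\<^sub>R axis i 1))) (at t)" .
  have "linear (frechet_derivative \<psi> (at (x + t *\<^sub>R axis i 1)))"
    using has_derivative_frechet[OF assms] has_derivative_linear by blast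
  then have "frechet_derivative \<psi> (at (x + t *\<^sub>R axis i 1)) (h *\<^sub>R axis i 1)
     = partial i \<psi> (x + t *\<^sub>R axis i 1) * h" for h
    by (simp add: partial_def linear_scale)
  with D show ?thesis by (simp add: has_field_derivative_def)
qed

text \<open>By translation invariance the difference quotients in direction \<open>i\<close> have integral 0. They converge boundedly to the
  partial derivative, and their supports stay in a fixed ball.\<close>

lemma integral_partial_eq_0:
  fixes \<psi> :: "real^'n::finite \<Rightarrow> real"
  assumes C1: "C_k (Suc 0) \<psi>" and K: "compact (closure {x. \<psi> x \<noteq> 0})"
  shows "(LINT x|lebesgue. partial i \<psi> x) = 0"
proof -
  define S where "S = closure {x. \<psi> x \<noteq> 0}"
  define e :: "real^'n" where "e = axis i 1"
  have ne: "norm e = 1" by (simp add: e_def)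
  from C1 have diff: "\<And>x. \<psi> differentiable (at x)" and cont: "continuous_on UNIV (partial i \<psi>)"
    by auto
  have cont\<psi>: "continuous_on UNIV \<psi>" using C_k_Suc_D[OF C1] by simp
  have \<psi>0: "\<psi> x = 0" if "x \<notin> S" for x
    using that eq_0_outside_support unfolding S_def by metis
  have d0: "partial i \<psi> x = 0" if "x \<notin> S" for x
    using that partial_eq_0_outside_support unfolding S_def by metis
  have "compact S" using K by (simp add: S_def)
  have "bounded (partial i \<psi> ` S)"
    by (intro compact_imp_bounded compact_continuous_image \<open>compact S\<close> continuous_on_subset[OF cont]) auto
  then obtain B0 where "\<forall>y \<in> partial i \<psi> ` S. norm y \<le> B0" by (auto simp: bounded_iff)
  \<comment> \<open>the maximum with 0 covers an empty support, on which the bound \<open>B0\<close> says nothing\<close>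
  then have B: "\<bar>partial i \<psi> x\<bar> \<le> max 0 B0" for x
    using d0[of x] by (cases "x \<in> S") force+
  obtain R where R: "\<And>x. x \<in> S \<Longrightarrow> norm x \<le> R"
    using compact_imp_bounded[OF \<open>compact S\<close>] by (auto simp: bounded_iff)
  define t where "t = (\<lambda>n. inverse (real (Suc n)))"
  have t: "0 < t n" "t n \<le> 1" for n by (auto simp: t_def inverse_eq_divide)
  define q where "q = (\<lambda>n x. (\<psi> (x + t n *\<^sub>R e) - \<psi> x) / t n)"
  have int\<psi>: "integrable lebesgue \<psi>"
    by (rule integrable_lebesgue_compact_support[OF cont\<psi> \<open>compact S\<close> \<psi>0])
  have shift_cont: "continuous_on UNIV (\<lambda>x. \<psi> (x + c))" for c
    by (rule continuous_on_compose2[OF cont\<psi>]) (auto intro!: continuous_intros)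
  have int_shift: "integrable lebesgue (\<lambda>x. \<psi> (x + c))" for c
  proof (rule integrable_lebesgue_compact_support[OF shift_cont])
    show "compact ((\<lambda>x. x - c) ` S)"
      by (intro compact_continuous_image \<open>compact S\<close> continuous_intros)
    fix x assume "x \<notin> (\<lambda>x. x - c) ` S"
    then have "x + c \<notin> S" by (metis add_diff_cancel_right' imageI)
    then show "\<psi> (x + c) = 0" by (rule \<psi>0)
  qed
  have shift: "(LINT x|lebesgue. \<psi> (x + c)) = (LINT x|lebesgue. \<psi> x)" for c
  proof -
    have m: "\<psi> \<in> borel_measurable borel" using cont\<psi> by (rule borel_measurable_continuous_onI)
    have "(LINT x|lborel. \<psi> x) = (LINT x|distr lborel borel ((+) c). \<psi> x)"
      by (simp only: lborel_distr_plus)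
    also have "\<dots> = (LINT x|lborel. \<psi> (c + x))"
      by (rule integral_distr) (auto simp: m)
    finally show ?thesis using m
      by (simp add: integral_completion borel_measurable_continuous_onI[OF shift_cont] add.commute)
  qed
  have "(\<lambda>n. LINT x|lebesgue. q n x) \<longlonglongrightarrow> (LINT x|lebesgue. partial i \<psi> x)"
  proof (rule integral_dominated_convergence)
    show "partial i \<psi> \<in> borel_measurable lebesgue"
      using borel_measurable_continuous_onI[OF cont] by (simp add: measurable_completion)
    show "q n \<in> borel_measurable lebesgue" for n
      unfolding q_def using borel_measurable_integrable[OF int\<psi>] borel_measurable_integrable[OF int_shift]
      by (intro borel_measurable_divide borel_measurable_diff) auto
    show "integrable lebesgue (\<lambda>x. max 0 B0 * indicator (cball (0::real^'n) (R + 1)) x)"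
      by (intro integrable_mult_right integrable_real_indicator)
        (use emeasure_lborel_cball_finite[of "0::real^'n" "R + 1"] in \<open>auto simp: infinity_ennreal_def\<close>)
    show "AE x in lebesgue. (\<lambda>n. q n x) \<longlonglongrightarrow> partial i \<psi> x"
    proof (rule AE_I2)
      fix x
      have "((\<lambda>h. (\<psi> (x + (0 + h) *\<^sub>R e) - \<psi> (x + 0 *\<^sub>R e)) / h) \<longlongrightarrow> partial i \<psi> (x + 0 *\<^sub>R e)) (at 0)"
        using has_derivative_along_axis[OF diff, of x i 0] unfolding e_def DERIV_def by simp
      then have *: "((\<lambda>h. (\<psi> (x + h *\<^sub>R e) - \<psi> x) / h) \<longlongrightarrow> partial i \<psi> x) (at 0)" by simp
      have "t \<longlonglongrightarrow> 0" unfolding t_def by (rule LIMSEQ_inverse_real_of_nat)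
      then have "filterlim t (at 0) sequentially"
        using t(1) by (auto simp: filterlim_at intro!: always_eventually) (metis less_irrefl)
      from filterlim_compose[OF * this] show "(\<lambda>n. q n x) \<longlonglongrightarrow> partial i \<psi> x"
        by (simp add: q_def)
    qed
    show "AE x in lebesgue. norm (q n x) \<le> max 0 B0 * indicator (cball 0 (R + 1)) x" for n
    proof (rule AE_I2)
      fix x
      show "norm (q n x) \<le> max 0 B0 * indicator (cball 0 (R + 1)) x"
      proof (cases "norm x \<le> R + 1")
        case False
        have "norm x \<le> norm (x + t n *\<^sub>R e) + t n"
          using norm_triangle_ineq4[of "x + t n *\<^sub>R e" "t n *\<^sub>R e"] ne t[of n] by simp
        then have "R < norm (x + t n *\<^sub>R e)" "R < norm x"
          using False t[of n] by linarith+
        then have "x + t n *\<^sub>R e \<notin> S" "x \<notin> S" using R by (auto simp: not_le[symmetric])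
        then show ?thesis using False by (simp add: q_def \<psi>0)
      next
        case True
        obtain z where "\<psi> (x + t n *\<^sub>R e) - \<psi> (x + 0 *\<^sub>R e) = (t n - 0) * partial i \<psi> (x + z *\<^sub>R e)"
          using MVT2[of 0 "t n" "\<lambda>t. \<psi> (x + t *\<^sub>R e)" "\<lambda>t. partial i \<psi> (x + t *\<^sub>R e)"]
            t[of n] has_derivative_along_axis[OF diff, of x i] unfolding e_def by metis
        then have "q n x = partial i \<psi> (x + z *\<^sub>R e)" using t(1)[of n] by (simp add: q_def)
        then show ?thesis using B[of "x + z *\<^sub>R e"] True by simp
      qed
    qed
  qed
  moreover have "(LINT x|lebesgue. q n x) = 0" for n
    using int\<psi> int_shift shift unfolding q_def by simp
  ultimately show ?thesis by (simp add: LIMSEQ_const_iff)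
qed

lemma integral_lebesgue_on_compact_support:
  fixes f :: "'a::euclidean_space \<Rightarrow> real"
  assumes "\<Omega> \<in> sets lebesgue" "\<And>x. x \<notin> \<Omega> \<Longrightarrow> f x = 0"
  shows "integral\<^sup>L (lebesgue_on \<Omega>) f = integral\<^sup>L lebesgue f"
proof -
  have "(\<lambda>x. if x \<in> \<Omega> then f x else 0) = f" using assms(2) by auto
  with Lebesgue_Measure.integral_restrict_UNIV[OF assms(1), of f] show ?thesis by simp
qed

lemma integrable_lebesgue_on_compact_support:
  fixes f :: "'a::euclidean_space \<Rightarrow> real"
  assumes "\<Omega> \<in> sets lebesgue" "\<And>x. x \<notin> \<Omega> \<Longrightarrow> f x = 0"
  shows "integrable (lebesgue_on \<Omega>) f \<longleftrightarrow> integrable lebesgue f"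
proof -
  have "(\<lambda>x. if x \<in> \<Omega> then f x else 0) = f" using assms(2) by auto
  with Lebesgue_Measure.integrable_restrict_UNIV[OF assms(1), of f] show ?thesis by simp
qed

lemma set_integrable_mult_compact_support:
  fixes g \<psi> :: "'a::euclidean_space \<Rightarrow> real"
  assumes g: "set_integrable lebesgue K g" and "compact K" and cont: "continuous_on UNIV \<psi>"
    and zero: "\<And>x. x \<notin> K \<Longrightarrow> \<psi> x = 0"
  shows "integrable lebesgue (\<lambda>x. g x * \<psi> x)"
proof -
  have "bounded (\<psi> ` K)"
    by (intro compact_imp_bounded compact_continuous_image \<open>compact K\<close> continuous_on_subset[OF cont]) auto
  then obtain B where B: "\<And>x. x \<in> K \<Longrightarrow> \<bar>\<psi> x\<bar> \<le> B" by (auto simp: bounded_iff)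
  have int: "integrable lebesgue (\<lambda>x. indicator K x *\<^sub>R g x)" using g by (simp add: set_integrable_def)
  have [measurable]: "\<psi> \<in> borel_measurable lebesgue"
    using borel_measurable_continuous_onI[OF cont] by (simp add: measurable_completion)
  note [measurable] = borel_measurable_integrable[OF int]
  have "integrable lebesgue (\<lambda>x. (indicator K x *\<^sub>R g x) * \<psi> x)"
  proof (rule Bochner_Integration.integrable_bound)
    show "integrable lebesgue (\<lambda>x. B * (indicator K x *\<^sub>R g x))" using int by simp
    show "(\<lambda>x. (indicator K x *\<^sub>R g x) * \<psi> x) \<in> borel_measurable lebesgue" by measurable
    show "AE x in lebesgue. norm ((indicator K x *\<^sub>R g x) * \<psi> x) \<le> norm (B * (indicator K x *\<^sub>R g x))"
    proof (rule AE_I2)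
      fix x show "norm ((indicator K x *\<^sub>R g x) * \<psi> x) \<le> norm (B * (indicator K x *\<^sub>R g x))"
        using order_trans[OF B[of x] abs_ge_self]
        by (cases "x \<in> K") (auto simp: abs_mult mult.commute[of "\<bar>g x\<bar>"] intro!: mult_right_mono)
    qed
  qed
  moreover have "(indicator K x *\<^sub>R g x) * \<psi> x = g x * \<psi> x" for x
    using zero[of x] by (cases "x \<in> K") auto
  ultimately show ?thesis by (simp only:)
qed

lemma locally_integrable_continuous:
  fixes f :: "real^'n::finite \<Rightarrow> 'b::euclidean_space"
  assumes "continuous_on UNIV f"
  shows "locally_integrable \<Omega> f"
proof -
  have "set_integrable lebesgue K f" if "compact K" for K
  proof -
    have "integrable lborel (\<lambda>x. indicator K x *\<^sub>R f x)"
      using that assms by (intro borel_integrable_compact continuous_on_subset[OF assms]) auto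
    then show ?thesis unfolding set_integrable_def
      using integrable_completion[of "\<lambda>x. indicator K x *\<^sub>R f x" lborel] borel_measurable_integrable by blast
  qed
  then show ?thesis by (simp add: locally_integrable_def)
qed

lemma locally_integrable_add:
  "locally_integrable \<Omega> f \<Longrightarrow> locally_integrable \<Omega> g \<Longrightarrow> locally_integrable \<Omega> (\<lambda>x. f x + g x)"
  by (auto simp: locally_integrable_def set_integral_add)

lemma locally_integrable_diff:
  "locally_integrable \<Omega> f \<Longrightarrow> locally_integrable \<Omega> g \<Longrightarrow> locally_integrable \<Omega> (\<lambda>x. f x - g x)"
  by (auto simp: locally_integrable_def set_integral_diff)

lemma locally_integrable_scaleR:
  "locally_integrable \<Omega> f \<Longrightarrow> locally_integrable \<Omega> (\<lambda>x. c *\<^sub>R f x)"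
  by (auto simp: locally_integrable_def)

lemma locally_integrable_component:
  fixes f :: "real^'n::finite \<Rightarrow> real^'m::finite"
  shows "locally_integrable \<Omega> f \<Longrightarrow> locally_integrable \<Omega> (\<lambda>x. f x $ i)"
  unfolding locally_integrable_def set_integrable_def
  using integrable_bounded_linear[OF bounded_linear_vec_nth, of lebesgue "\<lambda>x. indicator _ x *\<^sub>R f x" i]
  by simp

lemma locally_integrable_mult_test:
  fixes g :: "real^'n::finite \<Rightarrow> real"
  assumes "open \<Omega>" "locally_integrable \<Omega> g" "test_function \<Omega> \<phi>"
  shows "integrable (lebesgue_on \<Omega>) (\<lambda>x. g x * \<phi> x)"
    and "integrable (lebesgue_on \<Omega>) (\<lambda>x. g x * partial i \<phi> x)"
proof -
  define K where "K = closure {x. \<phi> x \<noteq> 0}"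
  have K: "compact K" "K \<subseteq> \<Omega>" and \<phi>: "C_k (Suc 0) \<phi>"
    using assms(3) unfolding test_function_def K_def by (blast+)
  have 0: "\<phi> x = 0" "partial i \<phi> x = 0" if "x \<notin> K" for x
    using that eq_0_outside_support[of x \<phi>] partial_eq_0_outside_support[of x \<phi> i] unfolding K_def by auto
  have cont: "continuous_on UNIV \<phi>" "continuous_on UNIV (partial i \<phi>)"
    using C_k_Suc_D[OF \<phi>] \<phi> by simp_all
  have "set_integrable lebesgue K g" using assms(2) K by (simp add: locally_integrable_def)
  from set_integrable_mult_compact_support[OF this K(1)] cont 0
  have "integrable lebesgue (\<lambda>x. g x * \<phi> x)" "integrable lebesgue (\<lambda>x. g x * partial i \<phi> x)"
    by blast+
  moreover have "x \<notin> K" if "x \<notin> \<Omega>" for x using K that by blast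
  ultimately show "integrable (lebesgue_on \<Omega>) (\<lambda>x. g x * \<phi> x)"
    "integrable (lebesgue_on \<Omega>) (\<lambda>x. g x * partial i \<phi> x)"
    using assms(1) 0 by (auto simp: integrable_lebesgue_on_compact_support)
qed

definition gradient :: "(real^'n::finite \<Rightarrow> real) \<Rightarrow> real^'n \<Rightarrow> real^'n" where
  "gradient u x = (\<chi> i. partial i u x)"

lemma continuous_gradient: "C_k (Suc 0) u \<Longrightarrow> continuous_on UNIV (gradient u)"
  unfolding gradient_def by (intro continuous_on_vec_lambda) auto

text \<open>\<open>integral_partial_eq_0\<close> for the product of \<open>u\<close> with a test function.\<close>

lemma has_weak_gradient_C1:
  fixes u :: "real^'n::finite \<Rightarrow> real"
  assumes "open \<Omega>" and u: "C_k (Suc 0) u"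
  shows "has_weak_gradient \<Omega> u (gradient u)"
  unfolding has_weak_gradient_def
proof (intro conjI allI impI)
  have cont: "continuous_on UNIV u" using C_k_Suc_D[OF u] by simp
  show li: "locally_integrable \<Omega> u" "locally_integrable \<Omega> (gradient u)"
    using cont continuous_gradient[OF u] by (auto intro: locally_integrable_continuous)
  fix \<phi> :: "real^'n \<Rightarrow> real" and i assume test: "test_function \<Omega> \<phi>"
  then have \<phi>: "C_k (Suc 0) \<phi>" by (simp add: test_function_def del: C_k.simps)
  define \<psi> where "\<psi> = (\<lambda>x. u x * \<phi> x)"
  have \<psi>: "C_k (Suc 0) \<psi>" unfolding \<psi>_def by (intro C_k_mult u \<phi>)
  have sub: "closure {x. \<psi> x \<noteq> 0} \<subseteq> closure {x. \<phi> x \<noteq> 0}"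
    by (intro closure_mono) (auto simp: \<psi>_def)
  then have "compact (closure {x. \<psi> x \<noteq> 0})"
    by (rule compact_closure_mono) (use test in \<open>simp add: test_function_def\<close>)
  from integral_partial_eq_0[OF \<psi> this] have "(LINT x|lebesgue. partial i \<psi> x) = 0" .
  moreover have "(LINT x|lebesgue_on \<Omega>. partial i \<psi> x) = (LINT x|lebesgue. partial i \<psi> x)"
    using assms(1) sub test partial_eq_0_outside_support[of _ \<psi> i]
    by (intro integral_lebesgue_on_compact_support) (auto simp: test_function_def)
  moreover have "partial i \<psi> x = u x * partial i \<phi> x + partial i u x * \<phi> x" for x
    unfolding \<psi>_def using u \<phi> by (intro partial_mult) auto
  moreover have "integrable (lebesgue_on \<Omega>) (\<lambda>x. u x * partial i \<phi> x)"
    "integrable (lebesgue_on \<Omega>) (\<lambda>x. partial i u x * \<phi> x)"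
    using locally_integrable_mult_test[OF assms(1) li(1) test]
      locally_integrable_mult_test(1)[OF assms(1) locally_integrable_component[OF li(2), of i] test]
    by (auto simp: gradient_def)
  ultimately show "(LINT x|lebesgue_on \<Omega>. u x * partial i \<phi> x) = - (LINT x|lebesgue_on \<Omega>. gradient u x $ i * \<phi> x)"
    by (simp add: gradient_def)
qed

section \<open>Uniqueness of the weak gradient\<close>

text \<open>The Lebesgue differentiation theorem for cubes recovers \<open>f x\<close> from averages over small cubes with corner \<open>x\<close>,
  which lie in the given box if \<open>x\<close> is an interior point.\<close>

lemma AE_eq_0_if_box_integrals_eq_0:
  fixes f :: "'a::euclidean_space \<Rightarrow> real"
  assumes f: "integrable lebesgue f"
    and zero: "\<And>a b. cbox a b \<subseteq> cbox c d \<Longrightarrow> (LINT x|lebesgue_on (cbox a b). f x) = 0"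
  shows "AE x in lebesgue. x \<in> cbox c d \<longrightarrow> f x = 0"
proof -
  have int: "f integrable_on UNIV"
    using f integrable_on_lebesgue by blast
  then have "f integrable_on cbox a b" for a b by (rule integrable_on_subcbox) auto
  then obtain N where N: "negligible N" "\<And>x e. \<lbrakk>x \<notin> N; 0 < e\<rbrakk> \<Longrightarrow>
      \<exists>\<delta>>0. \<forall>h. 0 < h \<and> h < \<delta> \<longrightarrow> norm (integral (cbox x (x + h *\<^sub>R One)) f /\<^sub>R h ^ DIM('a) - f x) < e"
    by (rule integrable_ccontinuous_explicit) blast
  have "f x = 0" if x: "x \<in> box c d" "x \<notin> N" for x
  proof (rule ccontr)
    assume "f x \<noteq> 0"
    then obtain \<delta> where \<delta>: "0 < \<delta>" "\<And>h. 0 < h \<Longrightarrow> h < \<delta> \<Longrightarrow>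
        norm (integral (cbox x (x + h *\<^sub>R One)) f /\<^sub>R h ^ DIM('a) - f x) < \<bar>f x\<bar>"
      using N(2)[of x "\<bar>f x\<bar>"] x(2) by auto
    obtain r where r: "0 < r" "ball x r \<subseteq> box c d"
      using x(1) open_box open_contains_ball by blast
    have np: "0 < norm (One::'a) + 1" by (smt (verit) norm_ge_zero)
    obtain h where h: "0 < h" "h < \<delta>" "h < r / (norm (One::'a) + 1)"
      using dense[of 0 "min \<delta> (r / (norm (One::'a) + 1))"] \<delta>(1) r(1) np by auto
    have "norm (h *\<^sub>R (One::'a)) \<le> h * (norm (One::'a) + 1)" using h by simp
    also have "\<dots> < r" using h(3) np by (simp add: pos_less_divide_eq)
    finally have "x + h *\<^sub>R One \<in> ball x r" by (simp add: dist_norm)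
    then have "x + h *\<^sub>R One \<in> cbox c d" using r box_subset_cbox by blast
    moreover have "x \<in> cbox c d" using x box_subset_cbox by blast
    ultimately have sub: "cbox x (x + h *\<^sub>R One) \<subseteq> cbox c d"
      by (auto simp: mem_box subset_box)
    have "integrable (lebesgue_on (cbox x (x + h *\<^sub>R One))) f"
      using integrable_mult_indicator[OF _ f, of "cbox x (x + h *\<^sub>R One)"]
      by (simp add: integrable_restrict_space)
    then have "integral (cbox x (x + h *\<^sub>R One)) f = 0"
      using has_integral_integral_lebesgue_on[of "cbox x (x + h *\<^sub>R One)" f] zero[OF sub]
      by (auto intro: integral_unique)
    with \<delta>(2)[OF h(1,2)] show False by simp
  qed
  moreover have "negligible (N \<union> (cbox c d - box c d))"
    by (intro negligible_Un N(1) negligible_frontier_interval)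
  then have "N \<union> (cbox c d - box c d) \<in> null_sets lebesgue"
    by (simp add: negligible_iff_null_sets)
  ultimately show ?thesis
    by (intro AE_I'[where N = "N \<union> (cbox c d - box c d)"]) auto
qed

lemma AE_lebesgue_on_open_if_AE_cbox:
  fixes \<Omega> :: "'a::euclidean_space set"
  assumes "open \<Omega>" and AE: "\<And>c d. cbox c d \<subseteq> \<Omega> \<Longrightarrow> AE x in lebesgue. x \<in> cbox c d \<longrightarrow> P x"
  shows "AE x in lebesgue_on \<Omega>. P x"
proof -
  obtain \<D> where \<D>: "countable \<D>" "\<D> \<subseteq> Pow \<Omega>" "\<And>X. X \<in> \<D> \<Longrightarrow> \<exists>a b. X = cbox a b" "\<Union>\<D> = \<Omega>"
    using open_countable_Union_open_cbox[OF assms(1)] by metis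
  have "AE x in lebesgue. x \<in> X \<longrightarrow> P x" if X: "X \<in> \<D>" for X
  proof -
    obtain c d where "X = cbox c d" using \<D>(3)[OF X] by blast
    then show ?thesis using AE[of c d] \<D>(2) X by blast
  qed
  then have "AE x in lebesgue. \<forall>X\<in>\<D>. x \<in> X \<longrightarrow> P x"
    unfolding AE_ball_countable[OF \<D>(1)] by blast
  then have "AE x in lebesgue. x \<in> \<Omega> \<longrightarrow> P x"
    by (rule eventually_mono) (use \<D>(4) in blast)
  then show ?thesis using assms(1) by (simp add: AE_restrict_space_iff)
qed

text \<open>The fundamental lemma of the calculus of variations: bump functions converge to indicators of boxes, so \<open>g\<close> has
  integral 0 over each box in the domain.\<close>

lemma AE_eq_0_if_orthogonal_to_test_functions:
  fixes g :: "real^'n::finite \<Rightarrow> real"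
  assumes "open \<Omega>" and g: "locally_integrable \<Omega> g"
    and orth: "\<And>\<phi>. test_function \<Omega> \<phi> \<Longrightarrow> (LINT x|lebesgue_on \<Omega>. g x * \<phi> x) = 0"
  shows "AE x in lebesgue_on \<Omega>. g x = 0"
proof (rule AE_lebesgue_on_open_if_AE_cbox[OF assms(1)])
  have zero: "(LINT x|lebesgue_on (cbox a b). g x) = 0" if ab: "cbox a b \<subseteq> \<Omega>" for a b
  proof -
    have int: "integrable lebesgue (\<lambda>x. indicator (cbox a b) x *\<^sub>R g x)"
      using g ab compact_cbox[of a b] by (simp add: locally_integrable_def set_integrable_def)
    have bump: "test_function \<Omega> (box_bump (real (Suc n)) a b)" for n
      using ab by (intro test_function_box_bump) auto
    have int_on: "integrable (lebesgue_on \<Omega>) (\<lambda>x. indicator (cbox a b) x *\<^sub>R g x)"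
      using int assms(1) ab
      by (subst integrable_lebesgue_on_compact_support) (auto simp: indicator_def)
    note [measurable] = borel_measurable_integrable[OF int_on]
    have "(\<lambda>n. LINT x|lebesgue_on \<Omega>. g x * box_bump (real (Suc n)) a b x)
        \<longlonglongrightarrow> (LINT x|lebesgue_on \<Omega>. g x * indicator (box a b) x)"
    proof (rule integral_dominated_convergence)
      show "(\<lambda>x. g x * box_bump (real (Suc n)) a b x) \<in> borel_measurable (lebesgue_on \<Omega>)" for n
        using locally_integrable_mult_test(1)[OF assms(1) g bump] by (rule borel_measurable_integrable)
      have "(\<lambda>x. (indicator (cbox a b) x *\<^sub>R g x) * indicator (box a b) x) \<in> borel_measurable (lebesgue_on \<Omega>)"
      proof -
        have "(\<lambda>x. indicat_real (box a b) x) \<in> borel_measurable (lebesgue_on \<Omega>)"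
          by (intro measurable_restrict_space1 borel_measurable_indicator) auto
        then show ?thesis by measurable
      qed
      moreover have "(indicator (cbox a b) x *\<^sub>R g x) * indicator (box a b) x = g x * indicator (box a b) x" for x
        using box_subset_cbox[of a b] by (auto simp: indicator_def)
      ultimately show "(\<lambda>x. g x * indicator (box a b) x) \<in> borel_measurable (lebesgue_on \<Omega>)"
        by (simp only:)
      show "integrable (lebesgue_on \<Omega>) (\<lambda>x. \<bar>indicator (cbox a b) x *\<^sub>R g x\<bar>)"
        using int_on by (rule integrable_abs)
      show "AE x in lebesgue_on \<Omega>. (\<lambda>n. g x * box_bump (real (Suc n)) a b x) \<longlonglongrightarrow> g x * indicator (box a b) x"
        by (intro AE_I2 tendsto_mult tendsto_const box_bump_tendsto_indicator)
      show "AE x in lebesgue_on \<Omega>. norm (g x * box_bump (real (Suc n)) a b x) \<le> \<bar>indicator (cbox a b) x *\<^sub>R g x\<bar>" for n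
      proof (rule AE_I2)
        fix x show "norm (g x * box_bump (real (Suc n)) a b x) \<le> \<bar>indicator (cbox a b) x *\<^sub>R g x\<bar>"
        proof (cases "x \<in> cbox a b")
          case True
          then show ?thesis using box_bump_bounds[of "real (Suc n)" a b x]
            by (auto simp: abs_mult intro!: mult_left_le)
        next
          case False
          then have "x \<notin> box a b" using box_subset_cbox by blast
          then show ?thesis by (simp add: box_bump_eq_0 del: of_nat_Suc)
        qed
      qed
    qed
    then have "(LINT x|lebesgue_on \<Omega>. g x * indicator (box a b) x) = 0"
      using orth[OF bump] by (simp add: LIMSEQ_const_iff)
    moreover have "(LINT x|lebesgue_on \<Omega>. g x * indicator (box a b) x) = (LINT x|lebesgue. g x * indicator (box a b) x)"
      using assms(1) ab box_subset_cbox[of a b]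
      by (intro integral_lebesgue_on_compact_support) (auto simp: indicator_def)
    moreover have "(LINT x|lebesgue. g x * indicator (box a b) x) = (LINT x|lebesgue. indicator (cbox a b) x *\<^sub>R g x)"
    proof (rule integral_cong_AE)
      have null: "(cbox a b - box a b) \<in> null_sets lebesgue"
        using negligible_frontier_interval[of a b] by (simp add: negligible_iff_null_sets)
      show AE: "AE x in lebesgue. g x * indicator (box a b) x = indicator (cbox a b) x *\<^sub>R g x"
      proof (rule AE_I'[OF null], rule subsetI)
        fix x assume "x \<in> {x \<in> space lebesgue. g x * indicator (box a b) x \<noteq> indicator (cbox a b) x *\<^sub>R g x}"
        then have "g x * indicator (box a b) x \<noteq> indicator (cbox a b) x *\<^sub>R g x" by simp
        then show "x \<in> (cbox a b - box a b)"
          using box_subset_cbox[of a b]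
          by (cases "x \<in> box a b"; cases "x \<in> cbox a b") auto
      qed
      show m: "(\<lambda>x. indicator (cbox a b) x *\<^sub>R g x) \<in> borel_measurable lebesgue"
        using int by (rule borel_measurable_integrable)
      show "(\<lambda>x. g x * indicator (box a b) x) \<in> borel_measurable lebesgue"
        by (rule borel_measurable_AE[OF m]) (rule eventually_mono[OF AE], rule sym)
    qed
    ultimately show ?thesis by (simp add: integral_restrict_space)
  qed
  fix c d :: "real^'n" assume cd: "cbox c d \<subseteq> \<Omega>"
  have "AE x in lebesgue. x \<in> cbox c d \<longrightarrow> indicator (cbox c d) x *\<^sub>R g x = 0"
  proof (rule AE_eq_0_if_box_integrals_eq_0)
    show "integrable lebesgue (\<lambda>x. indicator (cbox c d) x *\<^sub>R g x)"
      using g cd compact_cbox[of c d] by (simp add: locally_integrable_def set_integrable_def)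
    fix a b :: "real^'n" assume sub: "cbox a b \<subseteq> cbox c d"
    have "(LINT x|lebesgue_on (cbox a b). indicator (cbox c d) x *\<^sub>R g x) = (LINT x|lebesgue_on (cbox a b). g x)"
      using sub by (intro Bochner_Integration.integral_cong) (auto simp: indicator_def)
    also have "\<dots> = 0" using sub cd by (intro zero) blast
    finally show "(LINT x|lebesgue_on (cbox a b). indicator (cbox c d) x *\<^sub>R g x) = 0" .
  qed
  then show "AE x in lebesgue. x \<in> cbox c d \<longrightarrow> g x = 0"
    by (rule eventually_mono) auto
qed

lemma has_weak_gradient_unique:
  fixes u :: "real^'n::finite \<Rightarrow> real"
  assumes "open \<Omega>" "has_weak_gradient \<Omega> u F" "has_weak_gradient \<Omega> u G"
  shows "AE x in lebesgue_on \<Omega>. F x = G x"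
proof -
  have li: "locally_integrable \<Omega> F" "locally_integrable \<Omega> G"
    using assms by (auto simp: has_weak_gradient_def)
  have "AE x in lebesgue_on \<Omega>. F x $ i - G x $ i = 0" for i
  proof (rule AE_eq_0_if_orthogonal_to_test_functions[OF assms(1)])
    show "locally_integrable \<Omega> (\<lambda>x. F x $ i - G x $ i)"
      by (intro locally_integrable_diff locally_integrable_component li)
    fix \<phi> :: "real^'n \<Rightarrow> real" assume test: "test_function \<Omega> \<phi>"
    then have "(LINT x|lebesgue_on \<Omega>. u x * partial i \<phi> x) = - (LINT x|lebesgue_on \<Omega>. F x $ i * \<phi> x)"
      "(LINT x|lebesgue_on \<Omega>. u x * partial i \<phi> x) = - (LINT x|lebesgue_on \<Omega>. G x $ i * \<phi> x)"
      using assms(2,3) by (simp_all add: has_weak_gradient_def)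
    then have "(LINT x|lebesgue_on \<Omega>. F x $ i * \<phi> x) = (LINT x|lebesgue_on \<Omega>. G x $ i * \<phi> x)"
      by simp
    moreover have "integrable (lebesgue_on \<Omega>) (\<lambda>x. F x $ i * \<phi> x)" "integrable (lebesgue_on \<Omega>) (\<lambda>x. G x $ i * \<phi> x)"
      by (intro locally_integrable_mult_test locally_integrable_component li assms(1) test)+
    ultimately show "(LINT x|lebesgue_on \<Omega>. (F x $ i - G x $ i) * \<phi> x) = 0"
      by (simp add: left_diff_distrib)
  qed
  then have "AE x in lebesgue_on \<Omega>. \<forall>i\<in>UNIV. F x $ i - G x $ i = 0"
    by (intro AE_finite_allI) auto
  then show ?thesis by (rule eventually_mono) (auto simp: vec_eq_iff)
qed

section \<open>Sobolev functions on a bounded domain\<close>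

text \<open>The integrals \<open>\<integral> |f|\<^sup>p\<close> are used in place of the norms that they define: convergence and the Cauchy property are the
  same for both, and up to a constant factor the triangle inequality holds for the integrals.\<close>

locale bounded_domain =
  fixes \<Omega> :: "(real^'n::finite) set" and p :: real
  assumes open_domain: "open \<Omega>" and bounded_domain: "bounded \<Omega>" and p_gt_1: "1 < p"
begin

abbreviation M where "M \<equiv> lebesgue_on \<Omega>"

abbreviation modular :: "(real^'n \<Rightarrow> 'b::real_normed_vector) \<Rightarrow> real" where
  "modular f \<equiv> LINT x|M. norm (f x) powr p"

lemma domain_sets [simp]: "\<Omega> \<in> sets lebesgue"
  using open_domain by simp

lemma finite_measure_domain: "finite_measure M"
  using bounded_domain by (intro finite_measure_lebesgue_on bounded_set_imp_lmeasurable) auto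

lemma integrable_const_domain [simp]: "integrable M (\<lambda>x. c :: 'b::{banach, second_countable_topology})"
  using finite_measure_domain by (simp add: finite_measure.integrable_const)

lemma modular_nonneg [simp]: "0 \<le> modular f"
  by (intro integral_nonneg_AE) auto

lemma Lp_measurable: "f \<in> Lp \<Omega> p \<Longrightarrow> f \<in> borel_measurable M"
  and Lp_integrable_powr: "f \<in> Lp \<Omega> p \<Longrightarrow> integrable M (\<lambda>x. norm (f x) powr p)"
  by (auto simp: Lp_def)

lemma Lp_dominated:
  fixes f :: "real^'n \<Rightarrow> 'b::{banach, second_countable_topology}"
  assumes "f \<in> borel_measurable M" "integrable M g" "AE x in M. norm (f x) powr p \<le> g x"
  shows "f \<in> Lp \<Omega> p"
proof -
  have "integrable M (\<lambda>x. norm (f x) powr p)"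
  proof (rule Bochner_Integration.integrable_bound[OF assms(2)])
    show "(\<lambda>x. norm (f x) powr p) \<in> borel_measurable M" using assms(1) by measurable
    show "AE x in M. norm (norm (f x) powr p) \<le> norm (g x)"
      using assms(3) by (rule eventually_mono) auto
  qed
  with assms(1) show ?thesis by (simp add: Lp_def)
qed

lemma Lp_add:
  fixes f g :: "real^'n \<Rightarrow> 'b::{banach, second_countable_topology}"
  assumes f: "f \<in> Lp \<Omega> p" and g: "g \<in> Lp \<Omega> p"
  shows "(\<lambda>x. f x + g x) \<in> Lp \<Omega> p"
    and "modular (\<lambda>x. f x + g x) \<le> 2 powr p * (modular f + modular g)"
proof -
  note [measurable] = Lp_measurable[OF f] Lp_measurable[OF g]
  have int: "integrable M (\<lambda>x. 2 powr p * (norm (f x) powr p + norm (g x) powr p))"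
    using f g by (intro integrable_mult_right Bochner_Integration.integrable_add Lp_integrable_powr)
  have le: "norm (f x + g x) powr p \<le> 2 powr p * (norm (f x) powr p + norm (g x) powr p)" for x
    using p_gt_1 by (intro norm_add_powr_le) auto
  show L: "(\<lambda>x. f x + g x) \<in> Lp \<Omega> p"
    by (rule Lp_dominated[OF _ int]) (auto simp: le)
  have "modular (\<lambda>x. f x + g x) \<le> (LINT x|M. 2 powr p * (norm (f x) powr p + norm (g x) powr p))"
    by (intro integral_mono Lp_integrable_powr L int le)
  then show "modular (\<lambda>x. f x + g x) \<le> 2 powr p * (modular f + modular g)"
    using f g by (simp add: Lp_integrable_powr)
qed

lemma Lp_scaleR:
  fixes f :: "real^'n \<Rightarrow> 'b::{banach, second_countable_topology}"
  assumes "f \<in> Lp \<Omega> p"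
  shows "(\<lambda>x. c *\<^sub>R f x) \<in> Lp \<Omega> p"
    and "modular (\<lambda>x. c *\<^sub>R f x) = \<bar>c\<bar> powr p * modular f"
proof -
  note [measurable] = Lp_measurable[OF assms]
  have eq: "norm (c *\<^sub>R f x) powr p = \<bar>c\<bar> powr p * norm (f x) powr p" for x
    by (simp add: powr_mult)
  show "(\<lambda>x. c *\<^sub>R f x) \<in> Lp \<Omega> p" "modular (\<lambda>x. c *\<^sub>R f x) = \<bar>c\<bar> powr p * modular f"
    using Lp_integrable_powr[OF assms] by (auto simp: Lp_def eq simp del: norm_scaleR)
qed

lemma Lp_diff:
  fixes f g :: "real^'n \<Rightarrow> 'b::{banach, second_countable_topology}"
  assumes f: "f \<in> Lp \<Omega> p" and g: "g \<in> Lp \<Omega> p"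
  shows "(\<lambda>x. f x - g x) \<in> Lp \<Omega> p"
    and "modular (\<lambda>x. f x - g x) \<le> 2 powr p * (modular f + modular g)"
  using Lp_add[OF f Lp_scaleR(1)[OF g, of "-1"]] by simp_all

lemma modular_triangle:
  fixes f g h :: "real^'n \<Rightarrow> 'b::{banach, second_countable_topology}"
  assumes "f \<in> Lp \<Omega> p" "g \<in> Lp \<Omega> p" "h \<in> Lp \<Omega> p"
  shows "modular (\<lambda>x. f x - h x) \<le> 2 powr p * (modular (\<lambda>x. f x - g x) + modular (\<lambda>x. g x - h x))"
  using Lp_add(2)[OF Lp_diff(1)[OF assms(1,2)] Lp_diff(1)[OF assms(2,3)]] by simp

lemma Lp_bounded:
  fixes f :: "real^'n \<Rightarrow> 'b::{banach, second_countable_topology}"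
  assumes "f \<in> borel_measurable M" "\<And>x. x \<in> \<Omega> \<Longrightarrow> norm (f x) \<le> B"
  shows "f \<in> Lp \<Omega> p"
  using p_gt_1 assms(2)
  by (intro Lp_dominated[OF assms(1), of "\<lambda>x. B powr p"] AE_I2) (auto intro!: powr_mono2)

lemma continuous_measurable_domain:
  fixes f :: "real^'n \<Rightarrow> 'b::{banach, second_countable_topology}"
  shows "continuous_on UNIV f \<Longrightarrow> f \<in> borel_measurable M"
  by (intro measurable_restrict_space1 measurable_completion) (simp add: borel_measurable_continuous_onI)

lemma continuous_bounded_domain:
  fixes f :: "real^'n \<Rightarrow> 'b::{banach, second_countable_topology}"
  assumes "continuous_on UNIV f"
  obtains B where "0 < B" "\<And>x. x \<in> \<Omega> \<Longrightarrow> norm (f x) \<le> B"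
proof -
  have "bounded (f ` closure \<Omega>)"
    using bounded_domain assms
    by (intro compact_imp_bounded compact_continuous_image)
      (auto simp: compact_closure intro: continuous_on_subset)
  then have "bounded (f ` \<Omega>)" by (rule bounded_subset) (use closure_subset in blast)
  then show ?thesis using that by (auto simp: bounded_pos)
qed

lemma Lp_continuous:
  fixes f :: "real^'n \<Rightarrow> 'b::{banach, second_countable_topology}"
  assumes "continuous_on UNIV f"
  shows "f \<in> Lp \<Omega> p"
  using continuous_bounded_domain[OF assms] Lp_bounded[OF continuous_measurable_domain[OF assms]]
  by metis

lemma integrable_bounded_mult:
  fixes g :: "real^'n \<Rightarrow> real"
  assumes "integrable M g" "s \<in> borel_measurable M" "AE x in M. \<bar>s x\<bar> \<le> B"
  shows "integrable M (\<lambda>x. s x * g x)"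
proof (rule Bochner_Integration.integrable_bound[of M "\<lambda>x. B * g x"])
  show "integrable M (\<lambda>x. B * g x)" using assms(1) by simp
  show "(\<lambda>x. s x * g x) \<in> borel_measurable M"
    using borel_measurable_integrable[OF assms(1)] assms(2) by measurable
  show "AE x in M. norm (s x * g x) \<le> norm (B * g x)"
    using assms(3) by (rule eventually_mono) (auto simp: abs_mult intro!: mult_right_mono)
qed

text \<open>On a set of finite measure, \<open>|f|\<close> is at most \<open>\<delta>\<close> or at most \<open>\<delta> powr (1 - p) * |f|\<^sup>p\<close>. Small \<open>\<delta>\<close> shows that convergence in \<open>L\<^sup>p\<close> implies
  convergence in \<open>L\<^sup>1\<close>.\<close>

lemma Lp_norm_le:
  fixes f :: "real^'n \<Rightarrow> 'b::{banach, second_countable_topology}"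
  assumes f: "f \<in> Lp \<Omega> p" and "0 < \<delta>"
  shows "integrable M f"
    and "(LINT x|M. norm (f x)) \<le> \<delta> * measure M \<Omega> + \<delta> powr (1 - p) * modular f"
proof -
  have le: "norm (f x) \<le> \<delta> + \<delta> powr (1 - p) * norm (f x) powr p" for x
  proof (cases "norm (f x) \<le> \<delta>")
    case False
    have "1 = \<delta> powr (1 - p) * \<delta> powr (p - 1)"
      using assms(2) by (simp flip: powr_add)
    also have "\<dots> \<le> \<delta> powr (1 - p) * norm (f x) powr (p - 1)"
      using False assms(2) p_gt_1 by (intro mult_left_mono powr_mono2) auto
    finally have "norm (f x) \<le> \<delta> powr (1 - p) * norm (f x) powr (p - 1) * norm (f x)"
      using mult_right_mono[of 1 _ "norm (f x)"] by fastforce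
    also have "\<dots> = \<delta> powr (1 - p) * norm (f x) powr p"
      using powr_mult_base[of "norm (f x)" "p - 1"] by (simp add: mult_ac)
    finally show ?thesis using assms(2) by simp
  qed (use assms(2) in \<open>simp add: add_increasing2\<close>)
  have int: "integrable M (\<lambda>x. \<delta> + \<delta> powr (1 - p) * norm (f x) powr p)"
    using Lp_integrable_powr[OF f] by simp
  show f1: "integrable M f"
    by (rule Bochner_Integration.integrable_bound[OF int Lp_measurable[OF f]])
      (use order_trans[OF le abs_ge_self] in auto)
  have "(LINT x|M. norm (f x)) \<le> (LINT x|M. \<delta> + \<delta> powr (1 - p) * norm (f x) powr p)"
    by (intro integral_mono integrable_norm f1 int le)
  also have "\<dots> = \<delta> * measure M \<Omega> + \<delta> powr (1 - p) * modular f"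
    using Lp_integrable_powr[OF f] by simp
  finally show "(LINT x|M. norm (f x)) \<le> \<delta> * measure M \<Omega> + \<delta> powr (1 - p) * modular f" .
qed

lemma Lp_imp_integrable:
  fixes f :: "real^'n \<Rightarrow> 'b::{banach, second_countable_topology}"
  shows "f \<in> Lp \<Omega> p \<Longrightarrow> integrable M f"
  using Lp_norm_le(1)[of f 1] by simp

lemma L1_norm_small:
  assumes "0 < \<epsilon>"
  obtains \<delta> where "0 < \<delta>"
    "\<And>f :: real^'n \<Rightarrow> 'b::{banach, second_countable_topology}.
       f \<in> Lp \<Omega> p \<Longrightarrow> modular f < \<delta> \<Longrightarrow> (LINT x|M. norm (f x)) < \<epsilon>"
proof -
  define d where "d = \<epsilon> / (2 * (measure M \<Omega> + 1))"
  have d: "0 < d" "d * measure M \<Omega> \<le> \<epsilon> / 2"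
  proof -
    have "0 < measure M \<Omega> + 1" by (smt (verit) measure_nonneg)
    then show "0 < d" "d * measure M \<Omega> \<le> \<epsilon> / 2"
      using assms by (auto simp: d_def field_simps)
  qed
  show ?thesis
  proof
    show "0 < \<epsilon> / (2 * d powr (1 - p))" using assms d by simp
    fix f :: "real^'n \<Rightarrow> 'b"
    assume f: "f \<in> Lp \<Omega> p" and small: "modular f < \<epsilon> / (2 * d powr (1 - p))"
    have "d powr (1 - p) * modular f < \<epsilon> / 2"
      using small d by (simp add: field_simps)
    with Lp_norm_le(2)[OF f d(1)] d(2) show "(LINT x|M. norm (f x)) < \<epsilon>" by linarith
  qed
qed

lemma L1_norm_tendsto_0:
  fixes f :: "nat \<Rightarrow> real^'n \<Rightarrow> 'b::{banach, second_countable_topology}"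
  assumes "\<And>k. f k \<in> Lp \<Omega> p" "(\<lambda>k. modular (f k)) \<longlonglongrightarrow> 0"
  shows "(\<lambda>k. LINT x|M. norm (f k x)) \<longlonglongrightarrow> 0"
proof (rule LIMSEQ_I)
  fix \<epsilon> :: real assume "0 < \<epsilon>"
  then obtain \<delta> where \<delta>: "0 < \<delta>" "\<And>f :: real^'n \<Rightarrow> 'b. f \<in> Lp \<Omega> p \<Longrightarrow> modular f < \<delta> \<Longrightarrow> (LINT x|M. norm (f x)) < \<epsilon>"
    using L1_norm_small by metis
  from LIMSEQ_D[OF assms(2) \<delta>(1)] obtain N where "\<forall>k\<ge>N. modular (f k) < \<delta>" by auto
  then show "\<exists>N. \<forall>k\<ge>N. norm ((LINT x|M. norm (f k x)) - 0) < \<epsilon>"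
    using \<delta>(2)[OF assms(1)] by auto
qed

lemma integral_mult_bounded_tendsto:
  fixes f :: "nat \<Rightarrow> real^'n \<Rightarrow> real"
  assumes f: "\<And>k. f k \<in> Lp \<Omega> p" "g \<in> Lp \<Omega> p" "(\<lambda>k. modular (\<lambda>x. f k x - g x)) \<longlonglongrightarrow> 0"
    and s: "s \<in> borel_measurable M" "\<And>x. x \<in> \<Omega> \<Longrightarrow> \<bar>s x\<bar> \<le> B"
  shows "(\<lambda>k. LINT x|M. s x * f k x) \<longlonglongrightarrow> (LINT x|M. s x * g x)"
proof (rule LIM_zero_cancel, rule Lim_null_comparison)
  have L: "(\<lambda>x. f k x - g x) \<in> Lp \<Omega> p" for k using f by (intro Lp_diff)
  have sB: "AE x in M. \<bar>s x\<bar> \<le> B" using s(2) by (intro AE_I2) auto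
  show "(\<lambda>k. B * (LINT x|M. norm (f k x - g x))) \<longlonglongrightarrow> 0"
    using tendsto_mult_left[OF L1_norm_tendsto_0[OF L f(3)], of B] by simp
  have "norm ((LINT x|M. s x * f k x) - (LINT x|M. s x * g x)) \<le> B * (LINT x|M. norm (f k x - g x))" for k
  proof -
    have int: "integrable M (\<lambda>x. s x * f k x)" "integrable M (\<lambda>x. s x * g x)"
      using integrable_bounded_mult[OF Lp_imp_integrable s(1) sB] f by blast+
    have "(LINT x|M. s x * f k x) - (LINT x|M. s x * g x) = (LINT x|M. s x * (f k x - g x))"
      using int by (simp add: right_diff_distrib)
    also have "norm \<dots> \<le> (LINT x|M. B * norm (f k x - g x))"
    proof (rule order_trans[OF integral_norm_bound integral_mono])
      show "integrable M (\<lambda>x. norm (s x * (f k x - g x)))"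
        using int by (intro integrable_norm) (simp add: right_diff_distrib)
      show "integrable M (\<lambda>x. B * norm (f k x - g x))"
        using Lp_imp_integrable[OF L] by simp
      show "norm (s x * (f k x - g x)) \<le> B * norm (f k x - g x)" if "x \<in> space M" for x
        using s(2) that by (auto simp: abs_mult intro!: mult_right_mono)
    qed
    finally show ?thesis by simp
  qed
  then show "\<forall>\<^sub>F k in sequentially. norm ((LINT x|M. s x * f k x) - (LINT x|M. s x * g x))
      \<le> B * (LINT x|M. norm (f k x - g x))" by simp
qed

lemma Lp_locally_integrable:
  fixes f :: "real^'n \<Rightarrow> 'b::{banach, second_countable_topology}"
  assumes "f \<in> Lp \<Omega> p"
  shows "locally_integrable \<Omega> f"
  unfolding locally_integrable_def
proof (intro allI impI)
  fix K :: "(real^'n) set" assume K: "compact K \<and> K \<subseteq> \<Omega>"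
  have "set_integrable lebesgue \<Omega> f"
    using Lp_imp_integrable[OF assms] by (simp add: integrable_restrict_space set_integrable_def)
  then show "set_integrable lebesgue K f"
    by (rule set_integrable_subset) (use K lmeasurable_compact[of K] in auto)
qed

text \<open>Lebesgue measure is complete. This makes the weak gradient measurable, which is chosen arbitrarily within its class.\<close>

lemma measurable_AE_eq:
  fixes f g :: "real^'n \<Rightarrow> 'b::euclidean_space"
  assumes "f \<in> borel_measurable M" "AE x in M. f x = g x"
  shows "g \<in> borel_measurable M"
proof -
  have "(\<lambda>x. indicator \<Omega> x *\<^sub>R f x) \<in> borel_measurable lebesgue"
    using assms(1) by (simp add: borel_measurable_restrict_space_iff)
  moreover have "AE x in lebesgue. indicator \<Omega> x *\<^sub>R f x = indicator \<Omega> x *\<^sub>R g x"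
    using assms(2) by (auto simp: AE_restrict_space_iff indicator_def elim!: eventually_mono)
  ultimately have "(\<lambda>x. indicator \<Omega> x *\<^sub>R g x) \<in> borel_measurable lebesgue"
    by (rule borel_measurable_AE)
  then show ?thesis by (simp add: borel_measurable_restrict_space_iff)
qed

text \<open>Carrying the weak gradient along as an explicit second component separates the analysis from the choice made by
  \<open>wgrad\<close>, which enters through \<open>weak_pair_wgrad\<close>.\<close>

definition weak_pair :: "(real^'n \<Rightarrow> real) \<Rightarrow> (real^'n \<Rightarrow> real^'n) \<Rightarrow> bool" where
  "weak_pair u G \<longleftrightarrow> u \<in> Lp \<Omega> p \<and> G \<in> Lp \<Omega> p \<and> has_weak_gradient \<Omega> u G"

lemma sobolev_iff_weak_pair: "u \<in> sobolev \<Omega> p \<longleftrightarrow> (\<exists>G. weak_pair u G)"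
  by (auto simp: sobolev_def weak_pair_def)

lemma weak_pair_wgrad:
  assumes "weak_pair u G"
  shows "AE x in M. G x = wgrad \<Omega> u x" and "weak_pair u (wgrad \<Omega> u)"
proof -
  have "has_weak_gradient \<Omega> u (wgrad \<Omega> u)"
    using assms unfolding wgrad_def weak_pair_def by (metis someI)
  moreover have G: "has_weak_gradient \<Omega> u G" "G \<in> Lp \<Omega> p" using assms by (auto simp: weak_pair_def)
  ultimately show AE: "AE x in M. G x = wgrad \<Omega> u x"
    using has_weak_gradient_unique[OF open_domain] by blast
  have "wgrad \<Omega> u \<in> borel_measurable M"
    using measurable_AE_eq[OF Lp_measurable[OF G(2)] AE] .
  then have "wgrad \<Omega> u \<in> Lp \<Omega> p"
    by (rule Lp_dominated[OF _ Lp_integrable_powr[OF G(2)]]) (use AE in \<open>auto elim!: eventually_mono\<close>)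
  then show "weak_pair u (wgrad \<Omega> u)"
    using assms \<open>has_weak_gradient \<Omega> u (wgrad \<Omega> u)\<close> by (simp add: weak_pair_def)
qed

lemma sobolev_weak_pair: "u \<in> sobolev \<Omega> p \<Longrightarrow> weak_pair u (wgrad \<Omega> u)"
  using weak_pair_wgrad(2) by (auto simp: sobolev_iff_weak_pair)

lemma weak_pair_add:
  assumes "weak_pair u F" "weak_pair v G"
  shows "weak_pair (\<lambda>x. u x + v x) (\<lambda>x. F x + G x)"
proof -
  from assms have li: "locally_integrable \<Omega> u" "locally_integrable \<Omega> F" "locally_integrable \<Omega> v" "locally_integrable \<Omega> G"
    by (auto simp: weak_pair_def has_weak_gradient_def)
  have "has_weak_gradient \<Omega> (\<lambda>x. u x + v x) (\<lambda>x. F x + G x)"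
    unfolding has_weak_gradient_def
  proof (intro conjI allI impI locally_integrable_add li)
    fix \<phi> :: "real^'n \<Rightarrow> real" and i assume t: "test_function \<Omega> \<phi>"
    have int: "integrable M (\<lambda>x. u x * partial i \<phi> x)" "integrable M (\<lambda>x. v x * partial i \<phi> x)"
      "integrable M (\<lambda>x. F x $ i * \<phi> x)" "integrable M (\<lambda>x. G x $ i * \<phi> x)"
      by (intro locally_integrable_mult_test locally_integrable_component li t open_domain)+
    have "(LINT x|M. u x * partial i \<phi> x) = - (LINT x|M. F x $ i * \<phi> x)"
      "(LINT x|M. v x * partial i \<phi> x) = - (LINT x|M. G x $ i * \<phi> x)"
      using assms t by (auto simp: weak_pair_def has_weak_gradient_def)
    with int show "(LINT x|M. (u x + v x) * partial i \<phi> x) = - (LINT x|M. (F x + G x) $ i * \<phi> x)"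
      by (simp add: distrib_right)
  qed
  with assms show ?thesis by (auto simp: weak_pair_def Lp_add)
qed

lemma weak_pair_scaleR:
  assumes "weak_pair u F"
  shows "weak_pair (\<lambda>x. c * u x) (\<lambda>x. c *\<^sub>R F x)"
proof -
  from assms have li: "locally_integrable \<Omega> u" "locally_integrable \<Omega> F"
    by (auto simp: weak_pair_def has_weak_gradient_def)
  have "has_weak_gradient \<Omega> (\<lambda>x. c * u x) (\<lambda>x. c *\<^sub>R F x)"
    unfolding has_weak_gradient_def
  proof (intro conjI allI impI)
    show "locally_integrable \<Omega> (\<lambda>x. c * u x)" "locally_integrable \<Omega> (\<lambda>x. c *\<^sub>R F x)"
      using li[THEN locally_integrable_scaleR, of c] by auto
    fix \<phi> :: "real^'n \<Rightarrow> real" and i assume t: "test_function \<Omega> \<phi>"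
    have "(LINT x|M. u x * partial i \<phi> x) = - (LINT x|M. F x $ i * \<phi> x)"
      using assms t by (auto simp: weak_pair_def has_weak_gradient_def)
    then show "(LINT x|M. (c * u x) * partial i \<phi> x) = - (LINT x|M. (c *\<^sub>R F x) $ i * \<phi> x)"
      by (simp add: mult.assoc)
  qed
  with assms show ?thesis using Lp_scaleR(1)[of u c] Lp_scaleR(1)[of F c] by (auto simp: weak_pair_def)
qed

lemma weak_pair_diff:
  assumes "weak_pair u F" "weak_pair v G"
  shows "weak_pair (\<lambda>x. u x - v x) (\<lambda>x. F x - G x)"
  using weak_pair_add[OF assms(1) weak_pair_scaleR[OF assms(2), of "-1"]] by simp

lemma weak_pair_C1:
  assumes "C_k (Suc 0) u"
  shows "weak_pair u (gradient u)"
  unfolding weak_pair_def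
  using has_weak_gradient_C1[OF open_domain assms] continuous_gradient[OF assms] C_k_Suc_D[OF assms]
  by (auto intro: Lp_continuous)

text \<open>For a fixed test function both sides of the defining identity are continuous in \<open>L\<^sup>1\<close>.\<close>

lemma weak_pair_limit:
  assumes pair: "\<And>k. weak_pair (u k) (G k)" and L: "v \<in> Lp \<Omega> p" "F \<in> Lp \<Omega> p"
    and u: "(\<lambda>k. modular (\<lambda>x. u k x - v x)) \<longlonglongrightarrow> 0"
    and G: "(\<lambda>k. modular (\<lambda>x. G k x - F x)) \<longlonglongrightarrow> 0"
  shows "weak_pair v F"
  unfolding weak_pair_def has_weak_gradient_def
proof (intro conjI allI impI L Lp_locally_integrable)
  fix \<phi> :: "real^'n \<Rightarrow> real" and i assume t: "test_function \<Omega> \<phi>"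
  have \<phi>: "C_k (Suc 0) \<phi>" using t by (rule test_function_C_k)
  then have cont: "continuous_on UNIV \<phi>" "continuous_on UNIV (partial i \<phi>)"
    using C_k_Suc_D[OF \<phi>] by auto
  obtain B1 where B1: "\<And>x. x \<in> \<Omega> \<Longrightarrow> norm (\<phi> x) \<le> B1" using continuous_bounded_domain[OF cont(1)] by metis
  obtain B2 where B2: "\<And>x. x \<in> \<Omega> \<Longrightarrow> norm (partial i \<phi> x) \<le> B2" using continuous_bounded_domain[OF cont(2)] by metis
  have Lu: "\<And>k. u k \<in> Lp \<Omega> p" "\<And>k. G k \<in> Lp \<Omega> p" using pair by (auto simp: weak_pair_def)
  have comp: "(\<lambda>x. H x $ i) \<in> Lp \<Omega> p" "modular (\<lambda>x. H x $ i) \<le> modular H" if H: "H \<in> Lp \<Omega> p" for H :: "real^'n \<Rightarrow> real^'n"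
  proof -
    have le: "norm (H x $ i) powr p \<le> norm (H x) powr p" for x
      using p_gt_1 component_le_norm_cart[of "H x" i] by (intro powr_mono2) auto
    have "(\<lambda>x. H x $ i) \<in> borel_measurable M"
    proof (rule measurable_compose[OF Lp_measurable[OF H]])
      show "(\<lambda>v::real^'n. v $ i) \<in> borel_measurable borel"
        by (intro borel_measurable_continuous_onI continuous_intros)
    qed
    then show L: "(\<lambda>x. H x $ i) \<in> Lp \<Omega> p"
      by (rule Lp_dominated[OF _ Lp_integrable_powr[OF H]]) (use le in auto)
    show "modular (\<lambda>x. H x $ i) \<le> modular H"
      by (intro integral_mono Lp_integrable_powr L H le)
  qed
  have 1: "(\<lambda>k. LINT x|M. partial i \<phi> x * u k x) \<longlonglongrightarrow> (LINT x|M. partial i \<phi> x * v x)"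
    using B2 by (intro integral_mult_bounded_tendsto[where B = B2] Lu L u continuous_measurable_domain cont) auto
  have "(\<lambda>k. modular (\<lambda>x. G k x $ i - F x $ i)) \<longlonglongrightarrow> 0"
  proof (rule tendsto_sandwich[OF _ _ tendsto_const G])
    show "\<forall>\<^sub>F k in sequentially. modular (\<lambda>x. G k x $ i - F x $ i) \<le> modular (\<lambda>x. G k x - F x)"
      using comp(2)[OF Lp_diff(1)[OF Lu(2) L(2)]] by simp
  qed simp
  then have 2: "(\<lambda>k. LINT x|M. \<phi> x * G k x $ i) \<longlonglongrightarrow> (LINT x|M. \<phi> x * F x $ i)"
    using B1 by (intro integral_mult_bounded_tendsto[where B = B1] comp Lu L continuous_measurable_domain cont) auto
  have "(LINT x|M. partial i \<phi> x * u k x) = - (LINT x|M. \<phi> x * G k x $ i)" for k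
    using pair[of k] t by (simp add: weak_pair_def has_weak_gradient_def mult.commute)
  with 1 have "(\<lambda>k. - (LINT x|M. \<phi> x * G k x $ i)) \<longlonglongrightarrow> (LINT x|M. partial i \<phi> x * v x)" by simp
  with tendsto_minus[OF 2] have "(LINT x|M. partial i \<phi> x * v x) = - (LINT x|M. \<phi> x * F x $ i)"
    using LIMSEQ_unique by blast
  then show "(LINT x|M. v x * partial i \<phi> x) = - (LINT x|M. F x $ i * \<phi> x)"
    by (simp add: mult.commute)
qed

end

section \<open>Zero boundary values and the Poincare inequality\<close>

lemma test_function_add:
  fixes \<phi> \<psi> :: "real^'n::finite \<Rightarrow> real"
  assumes "test_function \<Omega> \<phi>" "test_function \<Omega> \<psi>"
  shows "test_function \<Omega> (\<lambda>x. \<phi> x + \<psi> x)"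
proof -
  have sub: "closure {x. \<phi> x + \<psi> x \<noteq> 0} \<subseteq> closure {x. \<phi> x \<noteq> 0} \<union> closure {x. \<psi> x \<noteq> 0}"
    unfolding closure_Un[symmetric] by (intro closure_mono) auto
  have "compact (closure {x. \<phi> x + \<psi> x \<noteq> 0})"
  proof (rule compact_closure_mono)
    show "closure {x. \<phi> x + \<psi> x \<noteq> 0} \<subseteq> closure ({x. \<phi> x \<noteq> 0} \<union> {x. \<psi> x \<noteq> 0})"
      using sub by (simp only: closure_Un)
    show "compact (closure ({x. \<phi> x \<noteq> 0} \<union> {x. \<psi> x \<noteq> 0}))"
      unfolding closure_Un using assms by (intro compact_Un) (auto simp: test_function_def)
  qed
  then show ?thesis using sub assms by (auto simp: test_function_def C_k_add)
qed

lemma test_function_scale: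
  fixes \<phi> :: "real^'n::finite \<Rightarrow> real"
  assumes "test_function \<Omega> \<phi>"
  shows "test_function \<Omega> (\<lambda>x. c * \<phi> x)"
proof -
  have sub: "closure {x. c * \<phi> x \<noteq> 0} \<subseteq> closure {x. \<phi> x \<noteq> 0}"
    by (intro closure_mono) auto
  have "compact (closure {x. c * \<phi> x \<noteq> 0})"
    by (rule compact_closure_mono[OF sub]) (use assms in \<open>simp add: test_function_def\<close>)
  then show ?thesis using sub assms by (auto simp: test_function_def C_k_mult C_k_const)
qed

lemma test_function_0: "test_function \<Omega> (\<lambda>x. 0)"
  by (simp add: test_function_def C_k_const)

text \<open>The tangents at \<open>t\<close> and at \<open>t + h\<close> bound the remainder by \<open>p |p_flux p (t + h) - p_flux p t| |h|\<close>, and the flux is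
  continuous. This covers \<open>t = 0\<close> for all \<open>p > 1\<close>.\<close>

lemma norm_powr_has_real_derivative:
  fixes t :: real
  assumes "1 < p"
  shows "((\<lambda>t. \<bar>t\<bar> powr p) has_real_derivative p * p_flux p t) (at t)"
  unfolding DERIV_def
proof (rule LIM_zero_cancel, rule Lim_null_comparison)
  have "((\<lambda>h. p_flux p (t + h)) \<longlongrightarrow> p_flux p (t + 0)) (at 0)"
    by (rule isCont_tendsto_compose[OF continuous_p_flux[OF assms]]) (auto intro!: tendsto_eq_intros)
  then have "((\<lambda>h. p * \<bar>p_flux p (t + h) - p_flux p t\<bar>) \<longlongrightarrow> p * \<bar>p_flux p t - p_flux p t\<bar>) (at 0)"
    by (intro tendsto_intros) auto
  then show "((\<lambda>h. p * \<bar>p_flux p (t + h) - p_flux p t\<bar>) \<longlongrightarrow> 0) (at 0)" by simp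
  have "norm ((\<bar>t + h\<bar> powr p - \<bar>t\<bar> powr p) / h - p * p_flux p t) \<le> p * \<bar>p_flux p (t + h) - p_flux p t\<bar>"
    if "h \<noteq> 0" for h
  proof -
    define r where "r = \<bar>t + h\<bar> powr p - \<bar>t\<bar> powr p - p * p_flux p t * h"
    have "0 \<le> r" "r \<le> p * (p_flux p (t + h) - p_flux p t) * h"
      using norm_powr_above_tangent[OF assms, of t "t + h"] norm_powr_above_tangent[OF assms, of "t + h" t]
      by (auto simp: r_def algebra_simps)
    then have "\<bar>r\<bar> \<le> \<bar>p * (p_flux p (t + h) - p_flux p t) * h\<bar>" by linarith
    then have "\<bar>r\<bar> \<le> p * \<bar>p_flux p (t + h) - p_flux p t\<bar> * \<bar>h\<bar>" using assms by (simp add: abs_mult)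
    then have "\<bar>r / h\<bar> \<le> p * \<bar>p_flux p (t + h) - p_flux p t\<bar>"
      using that by (simp add: pos_divide_le_eq)
    moreover have "r / h = (\<bar>t + h\<bar> powr p - \<bar>t\<bar> powr p) / h - p * p_flux p t"
      using that by (simp add: r_def diff_divide_distrib)
    ultimately show ?thesis by simp
  qed
  then show "\<forall>\<^sub>F h in at 0. norm ((\<bar>t + h\<bar> powr p - \<bar>t\<bar> powr p) / h - p * p_flux p t)
      \<le> p * \<bar>p_flux p (t + h) - p_flux p t\<bar>"
    by (auto simp: eventually_at_filter)
qed

lemma C1_norm_powr:
  fixes u :: "real^'n::finite \<Rightarrow> real"
  assumes "1 < p" and u: "C_k (Suc 0) u"
  shows "C_k (Suc 0) (\<lambda>x. \<bar>u x\<bar> powr p)"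
    and "partial i (\<lambda>x. \<bar>u x\<bar> powr p) x = p * p_flux p (u x) * partial i u x"
proof -
  have D: "((\<lambda>x. \<bar>u x\<bar> powr p) has_derivative
      (\<lambda>h. p * p_flux p (u x) * frechet_derivative u (at x) h)) (at x)" for x
  proof -
    have "(u has_derivative frechet_derivative u (at x)) (at x)"
      using u by (intro has_derivative_frechet) simp
    from has_derivative_compose[OF this
        norm_powr_has_real_derivative[OF assms(1), unfolded has_field_derivative_def]]
    show ?thesis .
  qed
  show P: "partial i (\<lambda>x. \<bar>u x\<bar> powr p) x = p * p_flux p (u x) * partial i u x" for i x
    using partial_eqI[OF D] by (simp add: partial_def)
  have "continuous_on UNIV (\<lambda>x. p_flux p (u x))"
    using C_k_Suc_D[OF u] assms(1)
    by (intro continuous_on_compose2[OF continuous_on_p_flux[of p UNIV]]) auto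
  then have "continuous_on UNIV (\<lambda>x. p * p_flux p (u x) * partial i u x)" for i
    using u by (intro continuous_on_mult continuous_on_const) auto
  moreover have "partial i (\<lambda>x. \<bar>u x\<bar> powr p) = (\<lambda>x. p * p_flux p (u x) * partial i u x)" for i
    using P by blast
  ultimately show "C_k (Suc 0) (\<lambda>x. \<bar>u x\<bar> powr p)"
    using D by (auto simp: differentiable_def)
qed

lemma C1_coordinate:
  fixes i :: "'n::finite"
  shows "C_k (Suc 0) (\<lambda>x::real^'n. x $ i)" and "partial i (\<lambda>x::real^'n. x $ i) x = 1"
proof -
  have D: "((\<lambda>x::real^'n. x $ i) has_derivative (\<lambda>h. h $ i)) (at x)" for x
    by (rule bounded_linear.has_derivative[OF bounded_linear_vec_nth has_derivative_ident])
  show "partial i (\<lambda>x::real^'n. x $ i) x = 1" using partial_eqI[OF D] by simp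
  have "partial j (\<lambda>x::real^'n. x $ i) = (\<lambda>x. axis j 1 $ i)" for j
    using partial_eqI[OF D] by auto
  then show "C_k (Suc 0) (\<lambda>x::real^'n. x $ i)"
    using D by (auto simp: differentiable_def)
qed

context bounded_domain
begin

lemma test_weak_pair: "test_function \<Omega> \<phi> \<Longrightarrow> weak_pair \<phi> (gradient \<phi>)"
  by (intro weak_pair_C1 test_function_C_k)

lemma weak_pair_Lp: "weak_pair u G \<Longrightarrow> u \<in> Lp \<Omega> p" "weak_pair u G \<Longrightarrow> G \<in> Lp \<Omega> p"
  by (auto simp: weak_pair_def)

lemma modular_cong_AE:
  fixes f g :: "real^'n \<Rightarrow> 'b::{banach, second_countable_topology}"
  assumes "f \<in> Lp \<Omega> p" "g \<in> Lp \<Omega> p" "AE x in M. f x = g x"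
  shows "modular f = modular g"
  using assms(3) Lp_measurable[OF assms(1)] Lp_measurable[OF assms(2)]
  by (intro integral_cong_AE) (auto elim!: eventually_mono)

lemma modular_wgrad_diff:
  assumes "weak_pair u F" "weak_pair v G"
  shows "modular (wgrad \<Omega> (\<lambda>x. u x - v x)) = modular (\<lambda>x. F x - G x)"
  using weak_pair_wgrad[OF weak_pair_diff[OF assms]] weak_pair_Lp[OF weak_pair_diff[OF assms]]
  by (intro modular_cong_AE) (auto simp: weak_pair_def elim!: eventually_mono)

text \<open>Membership in \<open>sobolev_zero\<close> as approximation up to every \<open>\<epsilon>\<close>, with the root in the norm removed and with an arbitrary
  representative of the weak gradient.\<close>

lemma sobolev_zero_iff:
  assumes u: "weak_pair u G"
  shows "u \<in> sobolev_zero \<Omega> p \<longleftrightarrow>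
    (\<forall>\<epsilon>>0. \<exists>\<phi>. test_function \<Omega> \<phi> \<and> modular (\<lambda>x. u x - \<phi> x) < \<epsilon> \<and> modular (\<lambda>x. G x - gradient \<phi> x) < \<epsilon>)"
    (is "_ \<longleftrightarrow> ?R")
proof
  have eq: "sobolev_norm \<Omega> p (\<lambda>x. u x - \<phi> x)
      = (modular (\<lambda>x. u x - \<phi> x) + modular (\<lambda>x. G x - gradient \<phi> x)) powr (1 / p)"
    if "test_function \<Omega> \<phi>" for \<phi>
    unfolding sobolev_norm_def using modular_wgrad_diff[OF u test_weak_pair[OF that]] by simp
  {
    assume "u \<in> sobolev_zero \<Omega> p"
    then obtain \<phi> where \<phi>: "\<And>k. test_function \<Omega> (\<phi> k)"
      and lim: "(\<lambda>k. sobolev_norm \<Omega> p (\<lambda>x. u x - \<phi> k x)) \<longlonglongrightarrow> 0"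
      unfolding sobolev_zero_def by blast
    show ?R
    proof (intro allI impI)
      fix \<epsilon> :: real assume "0 < \<epsilon>"
      then have "0 < \<epsilon> powr (1 / p)" by simp
      from LIMSEQ_D[OF lim this] obtain k where "norm (sobolev_norm \<Omega> p (\<lambda>x. u x - \<phi> k x) - 0) < \<epsilon> powr (1 / p)"
        by blast
      then have "(modular (\<lambda>x. u x - \<phi> k x) + modular (\<lambda>x. G x - gradient (\<phi> k) x)) powr (1 / p) < \<epsilon> powr (1 / p)"
        unfolding eq[OF \<phi>] by (simp only: diff_zero real_norm_def abs_of_nonneg[OF powr_ge_zero])
      then have "modular (\<lambda>x. u x - \<phi> k x) + modular (\<lambda>x. G x - gradient (\<phi> k) x) < \<epsilon>"
        using powr_mono2[of "1 / p" \<epsilon> "modular (\<lambda>x. u x - \<phi> k x) + modular (\<lambda>x. G x - gradient (\<phi> k) x)"]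
          \<open>0 < \<epsilon>\<close> p_gt_1 by (auto simp: not_less[symmetric])
      then show "\<exists>\<phi>. test_function \<Omega> \<phi> \<and> modular (\<lambda>x. u x - \<phi> x) < \<epsilon> \<and> modular (\<lambda>x. G x - gradient \<phi> x) < \<epsilon>"
        using \<phi>[of k] modular_nonneg[of "\<lambda>x. u x - \<phi> k x"] modular_nonneg[of "\<lambda>x. G x - gradient (\<phi> k) x"]
        by (intro exI[of _ "\<phi> k"]) linarith
    qed
  }
  {
    assume ?R
    have "\<forall>k. \<exists>\<phi>. test_function \<Omega> \<phi> \<and> modular (\<lambda>x. u x - \<phi> x) < inverse (real (Suc k))
        \<and> modular (\<lambda>x. G x - gradient \<phi> x) < inverse (real (Suc k))" (is "\<forall>k. ?T k")
    proof (intro allI)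
      fix k
      have "0 < inverse (real (Suc k))" by simp
      with \<open>?R\<close> show "?T k" by blast
    qed
    from choice[OF this] obtain \<phi> where \<phi>: "\<And>k. test_function \<Omega> (\<phi> k)"
      and small: "\<And>k. modular (\<lambda>x. u x - \<phi> k x) < inverse (real (Suc k))"
        "\<And>k. modular (\<lambda>x. G x - gradient (\<phi> k) x) < inverse (real (Suc k))"
      by blast
    have "(\<lambda>k. modular (\<lambda>x. u x - \<phi> k x) + modular (\<lambda>x. G x - gradient (\<phi> k) x)) \<longlonglongrightarrow> 0 + 0"
      by (intro tendsto_add; rule tendsto_sandwich[OF _ _ tendsto_const LIMSEQ_inverse_real_of_nat])
        (use small less_imp_le in \<open>auto intro!: always_eventually\<close>)
    then have "(\<lambda>k. (modular (\<lambda>x. u x - \<phi> k x) + modular (\<lambda>x. G x - gradient (\<phi> k) x)) powr (1 / p)) \<longlonglongrightarrow> 0 powr (1 / p)"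
      using p_gt_1 by (intro tendsto_powr' tendsto_const) (auto intro!: always_eventually add_nonneg_nonneg)
    then have "(\<lambda>k. sobolev_norm \<Omega> p (\<lambda>x. u x - \<phi> k x)) \<longlonglongrightarrow> 0" by (simp add: eq[OF \<phi>])
    moreover have "u \<in> sobolev \<Omega> p" using u by (auto simp: sobolev_iff_weak_pair)
    ultimately show "u \<in> sobolev_zero \<Omega> p" using \<phi> by (auto simp: sobolev_zero_def)
  }
qed

lemma sobolev_zero_subset: "u \<in> sobolev_zero \<Omega> p \<Longrightarrow> u \<in> sobolev \<Omega> p"
  by (simp add: sobolev_zero_def)

lemma sobolev_zero_closed:
  assumes u: "weak_pair u G"
    and approx: "\<And>\<epsilon>. 0 < \<epsilon> \<Longrightarrow> \<exists>w F. weak_pair w F \<and> w \<in> sobolev_zero \<Omega> p \<and>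
      modular (\<lambda>x. u x - w x) < \<epsilon> \<and> modular (\<lambda>x. G x - F x) < \<epsilon>"
  shows "u \<in> sobolev_zero \<Omega> p"
  unfolding sobolev_zero_iff[OF u]
proof (intro allI impI)
  fix \<epsilon> :: real assume "0 < \<epsilon>"
  define d where "d = \<epsilon> / (2 powr p * 2)"
  have d: "0 < d" "2 powr p * (d + d) = \<epsilon>" using \<open>0 < \<epsilon>\<close> by (auto simp: d_def)
  obtain w F where w: "weak_pair w F" "w \<in> sobolev_zero \<Omega> p"
    "modular (\<lambda>x. u x - w x) < d" "modular (\<lambda>x. G x - F x) < d"
    using approx[OF d(1)] by blast
  obtain \<phi> where \<phi>: "test_function \<Omega> \<phi>" "modular (\<lambda>x. w x - \<phi> x) < d" "modular (\<lambda>x. F x - gradient \<phi> x) < d"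
    using w(2) d(1) unfolding sobolev_zero_iff[OF w(1)] by blast
  note L = weak_pair_Lp[OF u] weak_pair_Lp[OF w(1)] weak_pair_Lp[OF test_weak_pair[OF \<phi>(1)]]
  have "modular (\<lambda>x. u x - \<phi> x) < \<epsilon>"
    by (rule order_le_less_trans[OF modular_triangle[of u w \<phi>]]) (use L w \<phi> d(2)[symmetric] in simp_all)
  moreover have "modular (\<lambda>x. G x - gradient \<phi> x) < \<epsilon>"
    by (rule order_le_less_trans[OF modular_triangle[of G F "gradient \<phi>"]]) (use L w \<phi> d(2)[symmetric] in simp_all)
  ultimately show "\<exists>\<phi>. test_function \<Omega> \<phi> \<and> modular (\<lambda>x. u x - \<phi> x) < \<epsilon> \<and> modular (\<lambda>x. G x - gradient \<phi> x) < \<epsilon>"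
    using \<phi>(1) by blast
qed

lemma sobolev_zero_test:
  assumes "test_function \<Omega> \<phi>"
  shows "\<phi> \<in> sobolev_zero \<Omega> p"
  unfolding sobolev_zero_iff[OF test_weak_pair[OF assms]]
  by (intro allI impI exI[of _ \<phi>]) (simp add: assms)

lemma sobolev_zero_add:
  assumes "u \<in> sobolev_zero \<Omega> p" "v \<in> sobolev_zero \<Omega> p"
  shows "(\<lambda>x. u x + v x) \<in> sobolev_zero \<Omega> p"
proof -
  note uv = assms[THEN sobolev_zero_subset, THEN sobolev_weak_pair]
  show ?thesis
  proof (rule sobolev_zero_closed[OF weak_pair_add[OF uv]])
    fix \<epsilon> :: real assume "0 < \<epsilon>"
    define d where "d = \<epsilon> / (2 powr p * 2)"
    have d: "0 < d" "2 powr p * (d + d) = \<epsilon>" using \<open>0 < \<epsilon>\<close> by (auto simp: d_def)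
    obtain \<phi> where \<phi>: "test_function \<Omega> \<phi>" "modular (\<lambda>x. u x - \<phi> x) < d" "modular (\<lambda>x. wgrad \<Omega> u x - gradient \<phi> x) < d"
      using assms(1) d(1) unfolding sobolev_zero_iff[OF uv(1)] by blast
    obtain \<psi> where \<psi>: "test_function \<Omega> \<psi>" "modular (\<lambda>x. v x - \<psi> x) < d" "modular (\<lambda>x. wgrad \<Omega> v x - gradient \<psi> x) < d"
      using assms(2) d(1) unfolding sobolev_zero_iff[OF uv(2)] by blast
    note pairs = test_weak_pair[OF \<phi>(1)] test_weak_pair[OF \<psi>(1)]
    have "modular (\<lambda>x. (u x - \<phi> x) + (v x - \<psi> x)) < \<epsilon>"
      by (rule order_le_less_trans[OF Lp_add(2)])
        (use weak_pair_Lp[OF weak_pair_diff[OF uv(1) pairs(1)]] weak_pair_Lp[OF weak_pair_diff[OF uv(2) pairs(2)]] \<phi> \<psi> d(2)[symmetric] in simp_all)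
    moreover have "modular (\<lambda>x. (wgrad \<Omega> u x - gradient \<phi> x) + (wgrad \<Omega> v x - gradient \<psi> x)) < \<epsilon>"
      by (rule order_le_less_trans[OF Lp_add(2)])
        (use weak_pair_Lp[OF weak_pair_diff[OF uv(1) pairs(1)]] weak_pair_Lp[OF weak_pair_diff[OF uv(2) pairs(2)]] \<phi> \<psi> d(2)[symmetric] in simp_all)
    ultimately show "\<exists>w F. weak_pair w F \<and> w \<in> sobolev_zero \<Omega> p \<and>
      modular (\<lambda>x. (u x + v x) - w x) < \<epsilon> \<and> modular (\<lambda>x. (wgrad \<Omega> u x + wgrad \<Omega> v x) - F x) < \<epsilon>"
      by (intro exI[of _ "\<lambda>x. \<phi> x + \<psi> x"] exI[of _ "\<lambda>x. gradient \<phi> x + gradient \<psi> x"])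
        (simp add: weak_pair_add pairs sobolev_zero_test test_function_add \<phi> \<psi> add_diff_add)
  qed
qed

lemma sobolev_zero_scale:
  assumes "u \<in> sobolev_zero \<Omega> p"
  shows "(\<lambda>x. c * u x) \<in> sobolev_zero \<Omega> p"
proof -
  note u = assms[THEN sobolev_zero_subset, THEN sobolev_weak_pair]
  show ?thesis
  proof (rule sobolev_zero_closed[OF weak_pair_scaleR[OF u]])
    fix \<epsilon> :: real assume "0 < \<epsilon>"
    define d where "d = \<epsilon> / (\<bar>c\<bar> powr p + 1)"
    have d: "0 < d" "\<bar>c\<bar> powr p * d < \<epsilon>"
    proof -
      have pos: "0 < \<bar>c\<bar> powr p + 1" using powr_ge_zero[of "\<bar>c\<bar>" p] by linarith
      then show "0 < d" using \<open>0 < \<epsilon>\<close> by (simp add: d_def)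
      have "(\<bar>c\<bar> powr p + 1) * d = \<epsilon>" using pos by (simp add: d_def)
      then show "\<bar>c\<bar> powr p * d < \<epsilon>" using \<open>0 < d\<close> by (simp add: distrib_right)
    qed
    obtain \<phi> where \<phi>: "test_function \<Omega> \<phi>" "modular (\<lambda>x. u x - \<phi> x) < d" "modular (\<lambda>x. wgrad \<Omega> u x - gradient \<phi> x) < d"
      using assms(1) d(1) unfolding sobolev_zero_iff[OF u] by blast
    note pair = test_weak_pair[OF \<phi>(1)]
    note L = weak_pair_Lp[OF weak_pair_diff[OF u pair]]
    have "modular (\<lambda>x. c *\<^sub>R (u x - \<phi> x)) < \<epsilon>"
      unfolding Lp_scaleR(2)[OF L(1)]
      by (rule order_le_less_trans[OF mult_left_mono[OF less_imp_le[OF \<phi>(2)] powr_ge_zero] d(2)])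
    moreover have "modular (\<lambda>x. c *\<^sub>R (wgrad \<Omega> u x - gradient \<phi> x)) < \<epsilon>"
      unfolding Lp_scaleR(2)[OF L(2)]
      by (rule order_le_less_trans[OF mult_left_mono[OF less_imp_le[OF \<phi>(3)] powr_ge_zero] d(2)])
    ultimately show "\<exists>w F. weak_pair w F \<and> w \<in> sobolev_zero \<Omega> p \<and>
      modular (\<lambda>x. c * u x - w x) < \<epsilon> \<and> modular (\<lambda>x. c *\<^sub>R wgrad \<Omega> u x - F x) < \<epsilon>"
      by (intro exI[of _ "\<lambda>x. c * \<phi> x"] exI[of _ "\<lambda>x. c *\<^sub>R gradient \<phi> x"])
        (simp add: weak_pair_scaleR pair sobolev_zero_test test_function_scale \<phi> scaleR_diff_right right_diff_distrib del: norm_scaleR)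
  qed
qed

text \<open>The integral of \<open>\<partial>\<^sub>i (x\<^sub>i |\<phi>|\<^sup>p)\<close> vanishes. By the product rule, \<open>\<integral> |\<phi>|\<^sup>p\<close> is at most \<open>p R \<integral> |\<phi>| powr (p - 1) |\<nabla>\<phi>|\<close> if
  the domain lies in the ball of radius \<open>R\<close>, and Young's inequality absorbs half of the left-hand side.\<close>

lemma poincare_test_function:
  obtains C where "0 \<le> C" "\<And>\<phi>. test_function \<Omega> \<phi> \<Longrightarrow> modular \<phi> \<le> C * modular (gradient \<phi>)"
proof -
  obtain R where R: "0 < R" "\<And>x. x \<in> \<Omega> \<Longrightarrow> norm x \<le> R"
    using bounded_domain by (auto simp: bounded_pos)
  \<comment> \<open>with this weight the first term of Young's inequality is half of the left-hand side\<close>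
  define l where "l = 1 / (2 * p * R)"
  define C where "C = p * R * l powr (1 - p)"
  have l: "0 < l" "p * R * l = 1 / 2" using R p_gt_1 by (auto simp: l_def)
  have young: "p * R * (a powr (p - 1) * b) \<le> a powr p / 2 + C * b powr p" if "0 \<le> a" "0 \<le> b" for a b
  proof -
    have "a powr (p - 1) * b \<le> l * a powr p + l powr (1 - p) * b powr p"
      using powr_minus_one_mult_le_scaled[OF p_gt_1 that l(1)] .
    then have "p * R * (a powr (p - 1) * b) \<le> p * R * (l * a powr p + l powr (1 - p) * b powr p)"
      using R p_gt_1 by (intro mult_left_mono) auto
    also have "\<dots> = (p * R * l) * a powr p + C * b powr p" by (simp add: C_def algebra_simps)
    finally show ?thesis unfolding l by simp
  qed
  show ?thesis
  proof
    show "0 \<le> 2 * C" using R p_gt_1 by (simp add: C_def)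
    fix \<phi> :: "real^'n \<Rightarrow> real" assume t: "test_function \<Omega> \<phi>"
    \<comment> \<open>any coordinate\<close>
    define i :: 'n where "i = undefined"
    define \<psi> where "\<psi> = (\<lambda>x::real^'n. x $ i * \<bar>\<phi> x\<bar> powr p)"
    have \<phi>: "C_k (Suc 0) \<phi>" using t by (rule test_function_C_k)
    note C1 = C1_norm_powr[OF p_gt_1 \<phi>] C1_coordinate[of i]
    have \<psi>: "C_k (Suc 0) \<psi>" unfolding \<psi>_def by (intro C_k_mult C1)
    have sub: "closure {x. \<psi> x \<noteq> 0} \<subseteq> closure {x. \<phi> x \<noteq> 0}"
      by (intro closure_mono) (auto simp: \<psi>_def)
    then have "compact (closure {x. \<psi> x \<noteq> 0})"
      by (rule compact_closure_mono) (use t in \<open>simp add: test_function_def\<close>)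
    from integral_partial_eq_0[OF \<psi> this] have "(LINT x|lebesgue. partial i \<psi> x) = 0" .
    moreover have "(LINT x|M. partial i \<psi> x) = (LINT x|lebesgue. partial i \<psi> x)"
      using sub t partial_eq_0_outside_support[of _ \<psi> i]
      by (intro integral_lebesgue_on_compact_support) (auto simp: test_function_def)
    ultimately have zero: "(LINT x|M. partial i \<psi> x) = 0" by simp
    have P: "partial i \<psi> x = x $ i * (p * p_flux p (\<phi> x) * partial i \<phi> x) + \<bar>\<phi> x\<bar> powr p" for x
    proof -
      have "partial i \<psi> x = x $ i * partial i (\<lambda>x. \<bar>\<phi> x\<bar> powr p) x + partial i (\<lambda>x. x $ i) x * \<bar>\<phi> x\<bar> powr p"
        unfolding \<psi>_def using C1(1,3) by (intro partial_mult) auto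
      then show ?thesis by (simp add: C1(2,4))
    qed
    have L: "\<phi> \<in> Lp \<Omega> p" "gradient \<phi> \<in> Lp \<Omega> p" using weak_pair_Lp[OF test_weak_pair[OF t]] .
    have le: "\<bar>\<phi> x\<bar> powr p / 2 - C * norm (gradient \<phi> x) powr p \<le> partial i \<psi> x" if "x \<in> \<Omega>" for x
    proof -
      have "\<bar>x $ i * (p * p_flux p (\<phi> x) * partial i \<phi> x)\<bar> \<le> R * (p * \<bar>\<phi> x\<bar> powr (p - 1) * norm (gradient \<phi> x))"
      proof -
        have "\<bar>x $ i\<bar> \<le> R" using component_le_norm_cart[of x i] R(2)[OF that] by linarith
        moreover have "\<bar>p_flux p (\<phi> x)\<bar> = \<bar>\<phi> x\<bar> powr (p - 1)" using norm_p_flux[of p "\<phi> x"] by simp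
        moreover have "\<bar>partial i \<phi> x\<bar> \<le> norm (gradient \<phi> x)"
          using component_le_norm_cart[of "gradient \<phi> x" i] by (simp add: gradient_def)
        ultimately show ?thesis using p_gt_1 by (simp add: abs_mult mult_mono)
      qed
      then show ?thesis unfolding P using young[of "\<bar>\<phi> x\<bar>" "norm (gradient \<phi> x)"]
        by (simp add: mult_ac abs_le_iff)
    qed
    have "(LINT x|M. \<bar>\<phi> x\<bar> powr p / 2 - C * norm (gradient \<phi> x) powr p) \<le> (LINT x|M. partial i \<psi> x)"
    proof (rule integral_mono)
      show "integrable M (partial i \<psi>)"
        using \<psi> by (intro Lp_imp_integrable Lp_continuous) simp
      show "integrable M (\<lambda>x. \<bar>\<phi> x\<bar> powr p / 2 - C * norm (gradient \<phi> x) powr p)"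
        using Lp_integrable_powr[OF L(1)] Lp_integrable_powr[OF L(2)] by simp
    qed (use le in auto)
    then show "modular \<phi> \<le> 2 * C * modular (gradient \<phi>)"
      unfolding zero using Lp_integrable_powr[OF L(1)] Lp_integrable_powr[OF L(2)] by simp
  qed
qed

text \<open>Approximation by test functions; the constant deteriorates because the triangle inequality for \<open>\<integral> |f|\<^sup>p\<close> holds up to a
  factor only.\<close>

lemma poincare:
  obtains C where "0 \<le> C" "\<And>w G. weak_pair w G \<Longrightarrow> w \<in> sobolev_zero \<Omega> p \<Longrightarrow> modular w \<le> C * modular G"
proof -
  obtain C where C: "0 \<le> C" "\<And>\<phi>. test_function \<Omega> \<phi> \<Longrightarrow> modular \<phi> \<le> C * modular (gradient \<phi>)"
    using poincare_test_function by blast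
  define K where "K = (2::real) powr p"
  have K: "0 < K" by (simp add: K_def)
  show ?thesis
  proof
    show "0 \<le> K * (C * K)" using C K by simp
    fix w G assume w: "weak_pair w G" "w \<in> sobolev_zero \<Omega> p"
    show "modular w \<le> K * (C * K) * modular G"
    proof (rule field_le_epsilon)
      fix e :: real assume e: "0 < e"
      define d where "d = e / (K + K * (C * K))"
      have pos: "0 < K + K * (C * K)" using K C by (simp add: add_pos_nonneg)
      then have d: "0 < d" "(K + K * (C * K)) * d = e" using e by (auto simp: d_def)
      obtain \<phi> where \<phi>: "test_function \<Omega> \<phi>" "modular (\<lambda>x. w x - \<phi> x) < d" "modular (\<lambda>x. G x - gradient \<phi> x) < d"
        using w(2) d(1) unfolding sobolev_zero_iff[OF w(1)] by blast
      note pair = test_weak_pair[OF \<phi>(1)]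
      note L = weak_pair_Lp[OF w(1)] weak_pair_Lp[OF pair] weak_pair_Lp[OF weak_pair_diff[OF w(1) pair]]
      have "modular (gradient \<phi>) \<le> K * (modular G + modular (\<lambda>x. G x - gradient \<phi> x))"
        using Lp_diff(2)[OF L(2) L(6)] by (simp add: K_def)
      also have "\<dots> \<le> K * (modular G + d)" using \<phi>(3) K by (intro mult_left_mono) auto
      finally have "C * modular (gradient \<phi>) \<le> C * (K * (modular G + d))" using C by (intro mult_left_mono)
      with C(2)[OF \<phi>(1)] have "modular \<phi> \<le> C * (K * (modular G + d))" by linarith
      moreover have "modular w \<le> K * (modular (\<lambda>x. w x - \<phi> x) + modular \<phi>)"
        using Lp_add(2)[OF L(5) L(3)] by (simp add: K_def)
      moreover have "K * (modular (\<lambda>x. w x - \<phi> x) + modular \<phi>) \<le> K * (d + C * (K * (modular G + d)))"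
        using \<phi>(2) K calculation(1) by (intro mult_left_mono) auto
      moreover have "K * (d + C * (K * (modular G + d))) = K * (C * K) * modular G + (K + K * (C * K)) * d"
        by (simp add: algebra_simps)
      ultimately show "modular w \<le> K * (C * K) * modular G + e" unfolding d(2) by linarith
    qed
  qed
qed

end

section \<open>Energy minimizers and the Dirichlet-Neumann map\<close>

context bounded_domain
begin

lemma Lp_Fatou:
  fixes h :: "nat \<Rightarrow> real^'n \<Rightarrow> 'b::{banach, second_countable_topology}"
  assumes h: "\<And>i. h i \<in> Lp \<Omega> p" and g: "g \<in> borel_measurable M"
    and lim: "AE x in M. (\<lambda>i. h i x) \<longlonglongrightarrow> g x"
    and bound: "\<forall>\<^sub>F i in sequentially. modular (h i) \<le> c"
  shows "g \<in> Lp \<Omega> p" and "modular g \<le> c"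
proof -
  have c: "0 \<le> c"
    using eventually_happens[OF bound] order_trans[OF modular_nonneg] by auto
  have "(\<integral>\<^sup>+x. ennreal (norm (g x) powr p) \<partial>M) = (\<integral>\<^sup>+x. liminf (\<lambda>i. ennreal (norm (h i x) powr p)) \<partial>M)"
  proof (rule nn_integral_cong_AE)
    show "AE x in M. ennreal (norm (g x) powr p) = liminf (\<lambda>i. ennreal (norm (h i x) powr p))"
      using lim
    proof (rule eventually_mono)
      fix x assume "(\<lambda>i. h i x) \<longlonglongrightarrow> g x"
      then have "(\<lambda>i. ennreal (norm (h i x) powr p)) \<longlonglongrightarrow> ennreal (norm (g x) powr p)"
        using p_gt_1 by (intro tendsto_ennrealI tendsto_powr' tendsto_norm tendsto_const) auto
      then show "ennreal (norm (g x) powr p) = liminf (\<lambda>i. ennreal (norm (h i x) powr p))"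
        using lim_imp_Liminf[OF sequentially_bot] by metis
    qed
  qed
  also have "\<dots> \<le> liminf (\<lambda>i. \<integral>\<^sup>+x. ennreal (norm (h i x) powr p) \<partial>M)"
    using Lp_measurable[OF h] by (intro nn_integral_liminf) measurable
  also have "\<dots> = liminf (\<lambda>i. ennreal (modular (h i)))"
    using Lp_integrable_powr[OF h] by (simp add: nn_integral_eq_integral)
  also have "\<dots> \<le> ennreal c"
    using bound by (intro Liminf_le) (auto elim!: eventually_mono intro: ennreal_leI)
  finally have le: "(\<integral>\<^sup>+x. ennreal (norm (g x) powr p) \<partial>M) \<le> ennreal c" .
  have "integrable M (\<lambda>x. norm (g x) powr p)"
    using g le by (intro integrableI_bounded) (auto simp: top.extremum_strict intro: order_le_less_trans)
  then show L: "g \<in> Lp \<Omega> p" using g by (simp add: Lp_def)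
  then show "modular g \<le> c"
    using le c by (simp add: nn_integral_eq_integral Lp_integrable_powr)
qed

text \<open>A Cauchy sequence in \<open>L\<^sup>p\<close> is Cauchy in \<open>L\<^sup>1\<close>, so a subsequence converges almost everywhere. Fatou's lemma, applied to the
  differences with a fixed member, yields convergence in \<open>L\<^sup>p\<close>.\<close>

lemma Lp_complete:
  fixes f :: "nat \<Rightarrow> real^'n \<Rightarrow> 'b::{banach, second_countable_topology}"
  assumes f: "\<And>k. f k \<in> Lp \<Omega> p"
    and cauchy: "\<And>\<epsilon>. 0 < \<epsilon> \<Longrightarrow> \<exists>N. \<forall>i\<ge>N. \<forall>j\<ge>N. modular (\<lambda>x. f i x - f j x) < \<epsilon>"
  obtains g where "g \<in> Lp \<Omega> p" "(\<lambda>k. modular (\<lambda>x. f k x - g x)) \<longlonglongrightarrow> 0"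
proof -
  have L: "(\<lambda>x. f i x - f j x) \<in> Lp \<Omega> p" for i j by (intro Lp_diff f)
  have "\<exists>N. \<forall>i\<ge>N. \<forall>j\<ge>N. (LINT x|M. norm (f i x - f j x)) < \<epsilon>" if pos: "0 < \<epsilon>" for \<epsilon>
  proof -
    obtain \<delta> where \<delta>: "0 < \<delta>" "\<And>f :: real^'n \<Rightarrow> 'b. f \<in> Lp \<Omega> p \<Longrightarrow> modular f < \<delta> \<Longrightarrow> (LINT x|M. norm (f x)) < \<epsilon>"
      using L1_norm_small[OF pos] by metis
    obtain N where "\<forall>i\<ge>N. \<forall>j\<ge>N. modular (\<lambda>x. f i x - f j x) < \<delta>" using cauchy[OF \<delta>(1)] by blast
    then show ?thesis using \<delta>(2)[OF L] by blast
  qed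
  then obtain r where r: "strict_mono r" "AE x in M. Cauchy (\<lambda>i. f (r i) x)"
    using cauchy_L1_AE_cauchy_subseq[of M f] Lp_imp_integrable[OF f] by blast
  define g where "g = (\<lambda>x. lim (\<lambda>i. f (r i) x))"
  have [measurable]: "\<And>k. f k \<in> borel_measurable M" by (intro Lp_measurable f)
  have g: "g \<in> borel_measurable M" unfolding g_def by measurable
  note [measurable] = g
  have lim: "AE x in M. (\<lambda>i. f (r i) x) \<longlonglongrightarrow> g x"
    using r(2) by (rule eventually_mono) (simp add: g_def Cauchy_convergent convergent_LIMSEQ_iff[symmetric])
  have main: "\<exists>N. \<forall>k\<ge>N. (\<lambda>x. f k x - g x) \<in> Lp \<Omega> p \<and> modular (\<lambda>x. f k x - g x) \<le> \<epsilon>" if "0 < \<epsilon>" for \<epsilon>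
  proof -
    obtain N where N: "\<And>i j. i \<ge> N \<Longrightarrow> j \<ge> N \<Longrightarrow> modular (\<lambda>x. f i x - f j x) < \<epsilon>"
      using cauchy[OF \<open>0 < \<epsilon>\<close>] by blast
    have "(\<lambda>x. f k x - g x) \<in> Lp \<Omega> p \<and> modular (\<lambda>x. f k x - g x) \<le> \<epsilon>" if "k \<ge> N" for k
    proof -
      have l: "AE x in M. (\<lambda>i. f k x - f (r i) x) \<longlonglongrightarrow> f k x - g x"
        using lim by (rule eventually_mono) (intro tendsto_diff tendsto_const)
      have b: "\<forall>\<^sub>F i in sequentially. modular (\<lambda>x. f k x - f (r i) x) \<le> \<epsilon>"
        using eventually_ge_at_top[of N]
      proof (rule eventually_mono)
        fix i assume "i \<ge> N"
        then have "r i \<ge> N" using seq_suble[OF r(1), of i] by linarith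
        then show "modular (\<lambda>x. f k x - f (r i) x) \<le> \<epsilon>" using N[OF that] by (simp add: less_imp_le)
      qed
      have m: "(\<lambda>x. f k x - g x) \<in> borel_measurable M" by measurable
      show ?thesis using Lp_Fatou[OF L m l b] by blast
    qed
    then show ?thesis by blast
  qed
  obtain N where "(\<lambda>x. f N x - g x) \<in> Lp \<Omega> p" using main[of 1] by auto
  from Lp_diff(1)[OF f[of N] this] have "g \<in> Lp \<Omega> p" by simp
  moreover have "(\<lambda>k. modular (\<lambda>x. f k x - g x)) \<longlonglongrightarrow> 0"
  proof (rule LIMSEQ_I)
    fix \<epsilon> :: real assume "0 < \<epsilon>"
    then obtain N where "\<forall>k\<ge>N. modular (\<lambda>x. f k x - g x) \<le> \<epsilon> / 2" using main[of "\<epsilon> / 2"] by auto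
    with \<open>0 < \<epsilon>\<close> show "\<exists>N. \<forall>k\<ge>N. norm (modular (\<lambda>x. f k x - g x) - 0) < \<epsilon>"
      by (intro exI[of _ N]) (auto intro: order_le_less_trans)
  qed
  ultimately show ?thesis using that by blast
qed

text \<open>The element of \<open>boundary_space\<close> that is represented by \<open>u\<close>.\<close>

definition coset :: "(real^'n \<Rightarrow> real) \<Rightarrow> (real^'n \<Rightarrow> real) set" where
  "coset u = {v \<in> sobolev \<Omega> p. (\<lambda>x. u x - v x) \<in> sobolev_zero \<Omega> p}"

lemma coset_self: "u \<in> sobolev \<Omega> p \<Longrightarrow> u \<in> coset u"
  by (simp add: coset_def sobolev_zero_test test_function_0)

lemma coset_boundary_space: "u \<in> sobolev \<Omega> p \<Longrightarrow> coset u \<in> boundary_space \<Omega> p"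
  unfolding boundary_space_def quotient_def coset_def by auto

lemma coset_diff:
  assumes "v \<in> coset u" "w \<in> coset u"
  shows "(\<lambda>x. v x - w x) \<in> sobolev_zero \<Omega> p"
proof -
  have "(\<lambda>x. - 1 * (u x - v x) + (u x - w x)) \<in> sobolev_zero \<Omega> p"
    using assms by (intro sobolev_zero_add sobolev_zero_scale) (auto simp: coset_def)
  then show ?thesis by simp
qed

lemma coset_add:
  assumes "v \<in> coset u" "w \<in> sobolev_zero \<Omega> p"
  shows "(\<lambda>x. v x + t * w x) \<in> coset u"
proof -
  have v: "weak_pair v (wgrad \<Omega> v)" using assms(1) by (auto simp: coset_def intro: sobolev_weak_pair)
  have w: "weak_pair w (wgrad \<Omega> w)" using assms(2) by (auto intro: sobolev_weak_pair sobolev_zero_subset)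
  have "(\<lambda>x. (u x - v x) + (- t) * w x) \<in> sobolev_zero \<Omega> p"
    using assms by (intro sobolev_zero_add sobolev_zero_scale) (auto simp: coset_def)
  moreover have "(\<lambda>x. v x + t * w x) \<in> sobolev \<Omega> p"
    using weak_pair_add[OF v weak_pair_scaleR[OF w, of t]] by (auto simp: sobolev_iff_weak_pair)
  ultimately show ?thesis by (simp add: coset_def diff_diff_eq)
qed

end

locale conducting_domain = bounded_domain \<Omega> p
  for \<Omega> :: "(real^'n::finite) set" and p +
  fixes \<sigma> :: "real^'n \<Rightarrow> real" and c C :: real
  assumes \<sigma>_measurable: "\<sigma> \<in> borel_measurable (lebesgue_on \<Omega>)" and c_pos: "0 < c"
    and \<sigma>_bounds: "AE x in lebesgue_on \<Omega>. c \<le> \<sigma> x \<and> \<sigma> x \<le> C"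
begin

abbreviation energy :: "(real^'n \<Rightarrow> real^'n) \<Rightarrow> real" where
  "energy G \<equiv> LINT x|M. \<sigma> x * norm (G x) powr p"

lemma AE_\<sigma>_abs: "AE x in M. \<bar>\<sigma> x\<bar> \<le> C"
  using \<sigma>_bounds by (rule eventually_mono) (use c_pos in auto)

lemma AE_\<sigma>_pos: "AE x in M. 0 < \<sigma> x"
  using \<sigma>_bounds by (rule eventually_mono) (use c_pos in auto)

lemma integrable_\<sigma>: "integrable M g \<Longrightarrow> integrable M (\<lambda>x. \<sigma> x * g x)"
  using integrable_bounded_mult[OF _ \<sigma>_measurable AE_\<sigma>_abs] .

lemma integrable_energy: "G \<in> Lp \<Omega> p \<Longrightarrow> integrable M (\<lambda>x. \<sigma> x * norm (G x) powr p)"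
  by (intro integrable_\<sigma> Lp_integrable_powr)

lemma integral_\<sigma>_mono:
  assumes "integrable M f" "integrable M g" "\<And>x. f x \<le> g x"
  shows "(LINT x|M. \<sigma> x * f x) \<le> (LINT x|M. \<sigma> x * g x)"
  using AE_\<sigma>_pos assms by (intro integral_mono_AE integrable_\<sigma>) (auto elim!: eventually_mono intro!: mult_left_mono)

lemma energy_nonneg: "0 \<le> energy G"
  using AE_\<sigma>_pos by (intro integral_nonneg_AE) (auto elim!: eventually_mono)

lemma modular_le_energy:
  assumes "G \<in> Lp \<Omega> p" shows "c * modular G \<le> energy G"
proof -
  have "(LINT x|M. c * norm (G x) powr p) \<le> energy G"
    using assms by (intro integral_mono_AE integrable_energy integrable_mult_right Lp_integrable_powr
        eventually_mono[OF \<sigma>_bounds]) (auto intro: mult_right_mono)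
  then show ?thesis by simp
qed

lemma energy_le_modular:
  assumes "G \<in> Lp \<Omega> p" shows "energy G \<le> C * modular G"
proof -
  have "energy G \<le> (LINT x|M. C * norm (G x) powr p)"
    using assms by (intro integral_mono_AE integrable_energy integrable_mult_right Lp_integrable_powr
        eventually_mono[OF \<sigma>_bounds]) (auto intro: mult_right_mono)
  then show ?thesis by simp
qed

lemma p_energy_eq:
  assumes "weak_pair u G"
  shows "p_energy \<Omega> p \<sigma> u = energy G"
  unfolding p_energy_def
proof (rule integral_cong_AE)
  show "(\<lambda>x. \<sigma> x * norm (wgrad \<Omega> u x) powr p) \<in> borel_measurable M" "(\<lambda>x. \<sigma> x * norm (G x) powr p) \<in> borel_measurable M"
    using weak_pair_wgrad(2)[OF assms] assms by (auto simp: weak_pair_def intro!: borel_measurable_integrable integrable_energy)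
  show "AE x in M. \<sigma> x * norm (wgrad \<Omega> u x) powr p = \<sigma> x * norm (G x) powr p"
    using weak_pair_wgrad(1)[OF assms] by (rule eventually_mono) simp
qed

lemma integrable_flux:
  assumes F: "F \<in> Lp \<Omega> p" and G: "G \<in> Lp \<Omega> p"
  shows "integrable M (\<lambda>x. p_flux p (F x :: real^'n) \<bullet> G x)"
proof (rule Bochner_Integration.integrable_bound)
  show "integrable M (\<lambda>x. norm (F x) powr p + norm (G x) powr p)"
    using F G by (intro Bochner_Integration.integrable_add Lp_integrable_powr)
  have "(\<lambda>x. p_flux p (F x)) \<in> borel_measurable M"
    using p_gt_1 by (intro measurable_compose[OF Lp_measurable[OF F]] borel_measurable_continuous_onI continuous_on_p_flux)
  then show "(\<lambda>x. p_flux p (F x) \<bullet> G x) \<in> borel_measurable M"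
    using Lp_measurable[OF G] by measurable
  have "\<bar>p_flux p (F x) \<bullet> G x\<bar> \<le> norm (F x) powr p + norm (G x) powr p" for x
    using Cauchy_Schwarz_ineq2[of "p_flux p (F x)" "G x"] powr_minus_one_mult_le[OF p_gt_1, of "norm (F x)" "norm (G x)"]
    by (simp add: norm_p_flux)
  then show "AE x in M. norm (p_flux p (F x) \<bullet> G x) \<le> norm (norm (F x) powr p + norm (G x) powr p)"
    by (intro AE_I2) (simp add: add_nonneg_nonneg)
qed

text \<open>By convexity \<open>|F|\<^sup>p \<le> |G\<^sub>k|\<^sup>p + p |F| powr (p - 1) |F - G\<^sub>k|\<close>. Young's inequality with a small weight \<open>l\<close> splits the last term
  into \<open>l |F|\<^sup>p\<close> and a multiple of \<open>|F - G\<^sub>k|\<^sup>p\<close>; first \<open>k\<close> tends to infinity, then \<open>l\<close> to 0.\<close>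

lemma energy_lower_semicontinuous:
  assumes G: "\<And>k. G k \<in> Lp \<Omega> p" "F \<in> Lp \<Omega> p" and lim: "(\<lambda>k. modular (\<lambda>x. F x - G k x)) \<longlonglongrightarrow> 0"
    and energy: "(\<lambda>k. energy (G k)) \<longlonglongrightarrow> I"
  shows "energy F \<le> I"
proof -
  have Young: "energy F \<le> energy (G k) + p * (l * energy F + l powr (1 - p) * (C * modular (\<lambda>x. F x - G k x)))"
    if "0 < l" for l k
  proof -
    have L: "(\<lambda>x. F x - G k x) \<in> Lp \<Omega> p" by (intro Lp_diff G)
    note int = Lp_integrable_powr[OF G(1)[of k]] Lp_integrable_powr[OF G(2)] Lp_integrable_powr[OF L]
    have le: "norm (F x) powr p \<le> norm (G k x) powr p + p * (l * norm (F x) powr p + l powr (1 - p) * norm (F x - G k x) powr p)" for x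
    proof -
      have "norm (F x) powr p \<le> norm (G k x) powr p + p * (p_flux p (F x) \<bullet> (F x - G k x))"
        using norm_powr_above_tangent[OF p_gt_1, of "F x" "G k x"] by (simp add: inner_diff_right algebra_simps)
      also have "p_flux p (F x) \<bullet> (F x - G k x) \<le> norm (F x) powr (p - 1) * norm (F x - G k x)"
        by (rule p_flux_inner_le)
      also have "\<dots> \<le> l * norm (F x) powr p + l powr (1 - p) * norm (F x - G k x) powr p"
        using p_gt_1 that by (intro powr_minus_one_mult_le_scaled) auto
      finally show ?thesis using p_gt_1 by simp
    qed
    have "energy F \<le> (LINT x|M. \<sigma> x * (norm (G k x) powr p + p * (l * norm (F x) powr p + l powr (1 - p) * norm (F x - G k x) powr p)))"
      using int by (intro integral_\<sigma>_mono le) auto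
    also have "\<dots> = energy (G k) + p * (l * energy F + l powr (1 - p) * energy (\<lambda>x. F x - G k x))"
      using integrable_energy[OF G(1)[of k]] integrable_energy[OF G(2)] integrable_energy[OF L]
      by (simp add: distrib_left mult.left_commute[of "\<sigma> _"])
    also have "\<dots> \<le> energy (G k) + p * (l * energy F + l powr (1 - p) * (C * modular (\<lambda>x. F x - G k x)))"
      using energy_le_modular[OF L] p_gt_1 by (intro add_left_mono mult_left_mono) auto
    finally show ?thesis .
  qed
  have "energy F \<le> I + p * (l * energy F)" if "0 < l" for l
  proof -
    have "(\<lambda>k. energy (G k) + p * (l * energy F + l powr (1 - p) * (C * modular (\<lambda>x. F x - G k x))))
      \<longlonglongrightarrow> I + p * (l * energy F + l powr (1 - p) * (C * 0))"
      by (intro tendsto_intros energy lim)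
    then have "energy F \<le> I + p * (l * energy F + l powr (1 - p) * (C * 0))"
      by (rule LIMSEQ_le_const) (use Young[OF that] in blast)
    then show ?thesis by simp
  qed
  then have "\<forall>\<^sub>F l in at_right 0. energy F \<le> I + p * (l * energy F)"
    by (auto simp: eventually_at_right_less intro: eventually_mono[OF eventually_at_right_less])
  moreover have "((\<lambda>l. I + p * (l * energy F)) \<longlongrightarrow> I + p * (0 * energy F)) (at_right 0)"
    by (intro tendsto_intros)
  ultimately have "energy F \<le> I + p * (0 * energy F)"
    by (intro tendsto_lowerbound) auto
  then show ?thesis by simp
qed

text \<open>As midpoints have energy at least \<open>I\<close>, the integral of the convexity defect of two late members is small, and
  \<open>difference_le_convexity_defect\<close> turns this into smallness of the difference.\<close>

lemma minimizing_sequence_Cauchy: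
  fixes G :: "nat \<Rightarrow> real^'n \<Rightarrow> real^'n"
  assumes G: "\<And>k. G k \<in> Lp \<Omega> p" and energy: "(\<lambda>k. energy (G k)) \<longlonglongrightarrow> I"
    and mid: "\<And>i j. I \<le> energy (\<lambda>x. (1/2) *\<^sub>R (G i x + G j x))" and "0 < \<epsilon>"
  shows "\<exists>N. \<forall>i\<ge>N. \<forall>j\<ge>N. modular (\<lambda>x. G i x - G j x) < \<epsilon>"
proof -
  have "I \<ge> 0" using energy_nonneg by (intro LIMSEQ_le_const[OF energy]) auto
  \<comment> \<open>late members have energy at most \<open>I + 1\<close>, so the \<open>e\<close>-terms add up to at most \<open>c * \<epsilon> / 2\<close>\<close>
  define e where "e = c * \<epsilon> / (4 * (I + 1))"
  have e: "0 < e" "4 * (e * (I + 1)) = c * \<epsilon>"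
  proof -
    have "I + 1 > 0" using \<open>I \<ge> 0\<close> by simp
    then show "0 < e" using c_pos \<open>0 < \<epsilon>\<close> by (simp add: e_def)
    have "e * (4 * (I + 1)) = c * \<epsilon>" unfolding e_def
      by (rule nonzero_eq_divide_eq[THEN iffD1, OF _ refl]) (use \<open>I + 1 > 0\<close> in simp)
    then show "4 * (e * (I + 1)) = c * \<epsilon>" by (simp only: mult_ac)
  qed
  obtain K where K: "0 \<le> K" "\<And>a b :: real^'n. norm (a - b) powr p \<le> K * convexity_defect p a b + e * (norm a powr p + norm b powr p)"
    using difference_le_convexity_defect[OF p_gt_1 e(1)] by blast
  define d where "d = min 1 (c * \<epsilon> / 4 / (K + 1))"
  have "0 < d" using c_pos \<open>0 < \<epsilon>\<close> K(1) by (simp add: d_def)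
  have Kd: "K * d < c * \<epsilon> / 2"
  proof -
    have "K * d \<le> (K + 1) * (c * \<epsilon> / 4 / (K + 1))"
      using K(1) \<open>0 < d\<close> by (intro mult_mono) (auto simp: d_def)
    also have "\<dots> = c * \<epsilon> / 4"
    proof -
      have "K + 1 \<noteq> 0" using K(1) by simp
      then show ?thesis by (metis nonzero_mult_div_cancel_left times_divide_eq_right)
    qed
    also have "\<dots> < c * \<epsilon> / 2" using c_pos \<open>0 < \<epsilon>\<close> by simp
    finally show ?thesis .
  qed
  obtain N where N: "\<And>k. k \<ge> N \<Longrightarrow> \<bar>energy (G k) - I\<bar> < d"
    using LIMSEQ_D[OF energy \<open>0 < d\<close>] by auto
  have "modular (\<lambda>x. G i x - G j x) < \<epsilon>" if ij: "i \<ge> N" "j \<ge> N" for i j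
  proof -
    have L: "(\<lambda>x. G i x - G j x) \<in> Lp \<Omega> p" "(\<lambda>x. (1/2) *\<^sub>R (G i x + G j x)) \<in> Lp \<Omega> p"
      using G by (auto intro!: Lp_diff Lp_scaleR(1) Lp_add)
    note int = Lp_integrable_powr[OF G(1)[of i]] Lp_integrable_powr[OF G(1)[of j]] Lp_integrable_powr[OF L(2)]
    note inte = integrable_energy[OF G(1)[of i]] integrable_energy[OF G(1)[of j]] integrable_energy[OF L(2)]
    have ei: "energy (G i) < I + d" "energy (G j) < I + d" using N[of i] N[of j] ij by auto
    have intd: "integrable M (\<lambda>x. convexity_defect p (G i x) (G j x))"
      unfolding convexity_defect_def using int by (simp del: norm_scaleR)
    have "c * modular (\<lambda>x. G i x - G j x) \<le> energy (\<lambda>x. G i x - G j x)"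
      by (rule modular_le_energy[OF L(1)])
    also have "\<dots> \<le> (LINT x|M. \<sigma> x * (K * convexity_defect p (G i x) (G j x) + e * (norm (G i x) powr p + norm (G j x) powr p)))"
      using int intd by (intro integral_\<sigma>_mono K(2) Lp_integrable_powr L) auto
    also have "\<dots> = K * (LINT x|M. \<sigma> x * convexity_defect p (G i x) (G j x)) + e * (energy (G i) + energy (G j))"
      using inte integrable_\<sigma>[OF intd] by (simp add: distrib_left mult.left_commute[of "\<sigma> _"])
    also have "(LINT x|M. \<sigma> x * convexity_defect p (G i x) (G j x))
        = (energy (G i) + energy (G j)) / 2 - energy (\<lambda>x. (1/2) *\<^sub>R (G i x + G j x))"
    proof -
      have "(\<lambda>x. \<sigma> x * convexity_defect p (G i x) (G j x)) = (\<lambda>x. (\<sigma> x * norm (G i x) powr p + \<sigma> x * norm (G j x) powr p) / 2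
          - \<sigma> x * norm ((1/2) *\<^sub>R (G i x + G j x)) powr p)"
        by (simp add: convexity_defect_def algebra_simps)
      then show ?thesis using inte by (simp del: norm_scaleR)
    qed
    also have "K * ((energy (G i) + energy (G j)) / 2 - energy (\<lambda>x. (1/2) *\<^sub>R (G i x + G j x))) \<le> K * d"
    proof (rule mult_left_mono[OF _ K(1)])
      show "(energy (G i) + energy (G j)) / 2 - energy (\<lambda>x. (1/2) *\<^sub>R (G i x + G j x)) \<le> d"
        using ei mid[of i j] by argo
    qed
    also have "e * (energy (G i) + energy (G j)) \<le> e * (2 * (I + 1))"
    proof (rule mult_left_mono)
      have "d \<le> 1" by (simp add: d_def)
      with ei show "energy (G i) + energy (G j) \<le> 2 * (I + 1)" by argo
    qed (use e(1) in simp)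
    also have "e * (2 * (I + 1)) = c * \<epsilon> / 2"
      unfolding mult.left_commute[of e 2] using e(2) by argo
    also have "K * d + c * \<epsilon> / 2 < c * \<epsilon>" using Kd by simp
    finally show ?thesis using c_pos by simp
  qed
  then show ?thesis by blast
qed

text \<open>The direct method with strong convergence: the gradients of a minimizing sequence are Cauchy in \<open>L\<^sup>p\<close>, by the
  Poincare inequality so are the functions, and the limit lies in the same class.\<close>

theorem dirichlet_minimizer_exists:
  assumes u: "u \<in> sobolev \<Omega> p"
  obtains v where "v \<in> coset u" "\<And>w. w \<in> coset u \<Longrightarrow> p_energy \<Omega> p \<sigma> v \<le> p_energy \<Omega> p \<sigma> w"
proof -
  define E where "E = p_energy \<Omega> p \<sigma>"
  define I where "I = Inf (E ` coset u)"
  have pair: "weak_pair w (wgrad \<Omega> w)" if "w \<in> coset u" for w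
    using that by (auto simp: coset_def intro: sobolev_weak_pair)
  have E: "E w = energy (wgrad \<Omega> w)" for w by (simp add: E_def p_energy_def)
  have bdd: "bdd_below (E ` coset u)"
    by (rule bdd_belowI2[where m = 0]) (simp add: E energy_nonneg)
  have I_le: "I \<le> E w" if "w \<in> coset u" for w
    unfolding I_def using bdd that by (intro cInf_lower) auto
  have ne: "E ` coset u \<noteq> {}" using coset_self[OF u] by blast
  have "\<exists>w. w \<in> coset u \<and> E w < I + inverse (real (Suc k))" for k
  proof -
    have "Inf (E ` coset u) < I + inverse (real (Suc k))" by (simp add: I_def)
    then show ?thesis using cInf_less_iff[OF ne bdd] by blast
  qed
  then obtain v where v: "\<And>k. v k \<in> coset u" "\<And>k. E (v k) < I + inverse (real (Suc k))" by metis
  define G where "G = (\<lambda>k. wgrad \<Omega> (v k))"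
  have pv: "weak_pair (v k) (G k)" for k unfolding G_def by (intro pair v)
  note L = weak_pair_Lp[OF pv]
  have limE: "(\<lambda>k. energy (G k)) \<longlonglongrightarrow> I"
  proof (rule tendsto_sandwich[OF _ _ tendsto_const])
    show "\<forall>\<^sub>F k in sequentially. I \<le> energy (G k)" using I_le[OF v(1)] by (simp add: E G_def)
    show "\<forall>\<^sub>F k in sequentially. energy (G k) \<le> I + inverse (real (Suc k))"
      using v(2) by (intro always_eventually allI less_imp_le) (simp add: E G_def)
    show "(\<lambda>k. I + inverse (real (Suc k))) \<longlonglongrightarrow> I"
      using tendsto_add[OF tendsto_const LIMSEQ_inverse_real_of_nat, of I] by simp
  qed
  have mid: "I \<le> energy (\<lambda>x. (1/2) *\<^sub>R (G i x + G j x))" for i j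
  proof -
    have "(\<lambda>x. v i x + (1/2) * (v j x - v i x)) \<in> coset u"
      by (intro coset_add coset_diff[where u = u] v)
    moreover have "(\<lambda>x. v i x + (1/2) * (v j x - v i x)) = (\<lambda>x. (1/2) * (v i x + v j x))"
      by (simp add: field_simps)
    ultimately have "I \<le> E (\<lambda>x. (1/2) * (v i x + v j x))" using I_le by metis
    then show ?thesis
      unfolding E_def p_energy_eq[OF weak_pair_scaleR[OF weak_pair_add[OF pv pv]]] .
  qed
  have cauchyG: "\<exists>N. \<forall>i\<ge>N. \<forall>j\<ge>N. modular (\<lambda>x. G i x - G j x) < \<epsilon>" if "0 < \<epsilon>" for \<epsilon>
    by (rule minimizing_sequence_Cauchy[OF L(2) limE mid that])
  obtain K where K: "0 \<le> K" "\<And>w G. weak_pair w G \<Longrightarrow> w \<in> sobolev_zero \<Omega> p \<Longrightarrow> modular w \<le> K * modular G"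
    using poincare by blast
  have cauchyv: "\<exists>N. \<forall>i\<ge>N. \<forall>j\<ge>N. modular (\<lambda>x. v i x - v j x) < \<epsilon>" if "0 < \<epsilon>" for \<epsilon>
  proof -
    have "0 < \<epsilon> / (K + 1)" using that K(1) by simp
    from cauchyG[OF this] obtain N where N: "\<And>i j. i \<ge> N \<Longrightarrow> j \<ge> N \<Longrightarrow> modular (\<lambda>x. G i x - G j x) < \<epsilon> / (K + 1)" by blast
    have "modular (\<lambda>x. v i x - v j x) < \<epsilon>" if "i \<ge> N" "j \<ge> N" for i j
    proof -
      have "modular (\<lambda>x. v i x - v j x) \<le> K * modular (\<lambda>x. G i x - G j x)"
        by (intro K(2) weak_pair_diff pv coset_diff[where u = u] v)
      also have "\<dots> \<le> (K + 1) * modular (\<lambda>x. G i x - G j x)" by (simp add: distrib_right)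
      also have "\<dots> < \<epsilon>" using N[OF that] K(1) by (simp add: pos_less_divide_eq mult.commute)
      finally show ?thesis .
    qed
    then show ?thesis by blast
  qed
  obtain v' where v': "v' \<in> Lp \<Omega> p" "(\<lambda>k. modular (\<lambda>x. v k x - v' x)) \<longlonglongrightarrow> 0"
    using Lp_complete[OF L(1) cauchyv] by blast
  obtain G' where G': "G' \<in> Lp \<Omega> p" "(\<lambda>k. modular (\<lambda>x. G k x - G' x)) \<longlonglongrightarrow> 0"
    using Lp_complete[OF L(2) cauchyG] by blast
  have pv': "weak_pair v' G'" by (rule weak_pair_limit[OF pv v'(1) G'(1) v'(2) G'(2)])
  have pu: "weak_pair u (wgrad \<Omega> u)" by (rule sobolev_weak_pair[OF u])
  have "(\<lambda>x. u x - v' x) \<in> sobolev_zero \<Omega> p"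
  proof (rule sobolev_zero_closed[OF weak_pair_diff[OF pu pv']])
    fix \<epsilon> :: real assume "0 < \<epsilon>"
    from LIMSEQ_D[OF v'(2) this] LIMSEQ_D[OF G'(2) this] obtain N1 N2 where
      "\<And>k. k \<ge> N1 \<Longrightarrow> modular (\<lambda>x. v k x - v' x) < \<epsilon>" "\<And>k. k \<ge> N2 \<Longrightarrow> modular (\<lambda>x. G k x - G' x) < \<epsilon>"
      by auto
    then have "modular (\<lambda>x. v (max N1 N2) x - v' x) < \<epsilon>" "modular (\<lambda>x. G (max N1 N2) x - G' x) < \<epsilon>"
      by simp_all
    moreover have "(\<lambda>x. u x - v (max N1 N2) x) \<in> sobolev_zero \<Omega> p" using v(1) by (simp add: coset_def)
    ultimately show "\<exists>w F. weak_pair w F \<and> w \<in> sobolev_zero \<Omega> p \<and>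
      modular (\<lambda>x. (u x - v' x) - w x) < \<epsilon> \<and> modular (\<lambda>x. (wgrad \<Omega> u x - G' x) - F x) < \<epsilon>"
      using weak_pair_diff[OF pu pv[of "max N1 N2"]]
      by (intro exI[of _ "\<lambda>x. u x - v (max N1 N2) x"] exI[of _ "\<lambda>x. wgrad \<Omega> u x - G (max N1 N2) x"]) simp
  qed
  then have "v' \<in> coset u" using pv' by (auto simp: coset_def sobolev_iff_weak_pair)
  moreover have "E v' \<le> I"
    unfolding E_def p_energy_eq[OF pv']
    by (rule energy_lower_semicontinuous[OF L(2) G'(1) _ limE]) (use G'(2) in \<open>simp add: norm_minus_commute\<close>)
  ultimately show ?thesis using that I_le unfolding E_def by (meson order_trans)
qed

text \<open>Compare \<open>v\<close> with \<open>v + t w\<close> and bound \<open>|G|\<^sup>p\<close> from below by the tangent at \<open>G + t W\<close>. This gives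
  \<open>\<integral> \<sigma> p_flux p (G + t W) \<bullet> W \<ge> 0\<close> for \<open>t > 0\<close>, and dominated convergence permits \<open>t\<close> to tend to 0. The same holds for
  \<open>- w\<close>.\<close>

theorem euler_lagrange:
  assumes v: "v \<in> coset u" and min: "\<And>w. w \<in> coset u \<Longrightarrow> p_energy \<Omega> p \<sigma> v \<le> p_energy \<Omega> p \<sigma> w"
    and pv: "weak_pair v G" and w: "w \<in> sobolev_zero \<Omega> p" and pw: "weak_pair w W"
  shows "(LINT x|M. \<sigma> x * (p_flux p (G x) \<bullet> W x)) = 0"
proof -
  have nonneg: "0 \<le> (LINT x|M. \<sigma> x * (p_flux p (G x) \<bullet> W x))"
    if w: "w \<in> sobolev_zero \<Omega> p" and pw: "weak_pair w W" for w W
  proof -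
    note L = weak_pair_Lp[OF pv] weak_pair_Lp[OF pw]
    define t where "t = (\<lambda>n. inverse (real (Suc n)))"
    have t: "0 < t n" "t n \<le> 1" for n by (auto simp: t_def inverse_eq_divide)
    have LW: "(\<lambda>x. G x + t n *\<^sub>R W x) \<in> Lp \<Omega> p" for n
      by (intro Lp_add Lp_scaleR L)
    define h where "h = (\<lambda>n x. p_flux p (G x + t n *\<^sub>R W x) \<bullet> W x)"
    have int: "integrable M (\<lambda>x. h n x)" for n
      unfolding h_def by (rule integrable_flux[OF LW L(4)])
    have "0 \<le> (LINT x|M. \<sigma> x * h n x)" for n
    proof -
      have "(\<lambda>x. v x + t n * w x) \<in> coset u" by (rule coset_add[OF v w])
      from min[OF this] have "energy G \<le> energy (\<lambda>x. G x + t n *\<^sub>R W x)"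
        unfolding p_energy_eq[OF pv] p_energy_eq[OF weak_pair_add[OF pv weak_pair_scaleR[OF pw]]] .
      moreover have "(LINT x|M. \<sigma> x * (norm (G x + t n *\<^sub>R W x) powr p + (- (p * t n)) * h n x)) \<le> energy G"
      proof (rule integral_\<sigma>_mono)
        show "integrable M (\<lambda>x. norm (G x + t n *\<^sub>R W x) powr p + (- (p * t n)) * h n x)"
          by (intro Bochner_Integration.integrable_add integrable_mult_right Lp_integrable_powr LW int)
        show "integrable M (\<lambda>x. norm (G x) powr p)" by (intro Lp_integrable_powr L)
        show "norm (G x + t n *\<^sub>R W x) powr p + (- (p * t n)) * h n x \<le> norm (G x) powr p" for x
          using norm_powr_above_tangent[OF p_gt_1, of "G x + t n *\<^sub>R W x" "G x"] by (simp add: h_def)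
      qed
      moreover have "(LINT x|M. \<sigma> x * (norm (G x + t n *\<^sub>R W x) powr p + (- (p * t n)) * h n x))
        = energy (\<lambda>x. G x + t n *\<^sub>R W x) - p * t n * (LINT x|M. \<sigma> x * h n x)"
        using integrable_energy[OF LW[of n]] integrable_\<sigma>[OF int[of n]]
        by (simp add: distrib_left right_diff_distrib mult.left_commute[of "\<sigma> _"])
      ultimately have "0 \<le> p * t n * (LINT x|M. \<sigma> x * h n x)" by linarith
      moreover have "0 < p * t n" using p_gt_1 t(1)[of n] by simp
      ultimately show ?thesis by (simp add: zero_le_mult_iff)
    qed
    moreover have "(\<lambda>n. LINT x|M. \<sigma> x * h n x) \<longlonglongrightarrow> (LINT x|M. \<sigma> x * (p_flux p (G x) \<bullet> W x))"
    proof (rule integral_dominated_convergence)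
      show "(\<lambda>x. \<sigma> x * (p_flux p (G x) \<bullet> W x)) \<in> borel_measurable M"
        by (intro borel_measurable_integrable integrable_\<sigma> integrable_flux L)
      show "(\<lambda>x. \<sigma> x * h n x) \<in> borel_measurable M" for n
        by (intro borel_measurable_integrable integrable_\<sigma> int)
      show "integrable M (\<lambda>x. C * (2 powr p * (norm (G x) powr p + norm (W x) powr p) + norm (W x) powr p))"
        by (intro integrable_mult_right Bochner_Integration.integrable_add Lp_integrable_powr L)
      show "AE x in M. (\<lambda>n. \<sigma> x * h n x) \<longlonglongrightarrow> \<sigma> x * (p_flux p (G x) \<bullet> W x)"
      proof (rule AE_I2)
        fix x
        have "t \<longlonglongrightarrow> 0" unfolding t_def by (rule LIMSEQ_inverse_real_of_nat)
        then have "(\<lambda>n. G x + t n *\<^sub>R W x) \<longlonglongrightarrow> G x + 0 *\<^sub>R W x" by (intro tendsto_intros)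
        then have "(\<lambda>n. p_flux p (G x + t n *\<^sub>R W x)) \<longlonglongrightarrow> p_flux p (G x)"
          by (intro isCont_tendsto_compose[OF continuous_p_flux[OF p_gt_1]]) simp
        then show "(\<lambda>n. \<sigma> x * h n x) \<longlonglongrightarrow> \<sigma> x * (p_flux p (G x) \<bullet> W x)"
          unfolding h_def by (intro tendsto_intros)
      qed
      show "AE x in M. norm (\<sigma> x * h n x)
          \<le> C * (2 powr p * (norm (G x) powr p + norm (W x) powr p) + norm (W x) powr p)" for n
        using AE_\<sigma>_abs
      proof (rule eventually_mono)
        fix x assume "\<bar>\<sigma> x\<bar> \<le> C"
        have "\<bar>h n x\<bar> \<le> norm (G x + t n *\<^sub>R W x) powr (p - 1) * norm (W x)"
          using Cauchy_Schwarz_ineq2[of "p_flux p (G x + t n *\<^sub>R W x)" "W x"] by (simp add: norm_p_flux h_def)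
        also have "\<dots> \<le> norm (G x + t n *\<^sub>R W x) powr p + norm (W x) powr p"
          using p_gt_1 by (intro powr_minus_one_mult_le) auto
        also have "norm (G x + t n *\<^sub>R W x) powr p \<le> 2 powr p * (norm (G x) powr p + norm (t n *\<^sub>R W x) powr p)"
          using p_gt_1 by (intro norm_add_powr_le) auto
        also have "norm (t n *\<^sub>R W x) powr p \<le> norm (W x) powr p"
          using p_gt_1 t[of n] by (intro powr_mono2) (auto intro!: mult_left_le_one_le)
        finally have "\<bar>h n x\<bar> \<le> 2 powr p * (norm (G x) powr p + norm (W x) powr p) + norm (W x) powr p"
          by simp
        with \<open>\<bar>\<sigma> x\<bar> \<le> C\<close> show "norm (\<sigma> x * h n x)
          \<le> C * (2 powr p * (norm (G x) powr p + norm (W x) powr p) + norm (W x) powr p)"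
          unfolding real_norm_def abs_mult by (intro mult_mono) auto
      qed
    qed
    ultimately show ?thesis by (intro LIMSEQ_le_const) auto
  qed
  have "0 \<le> (LINT x|M. \<sigma> x * (p_flux p (G x) \<bullet> (- 1 *\<^sub>R W x)))"
    by (rule nonneg[OF sobolev_zero_scale[OF w] weak_pair_scaleR[OF pw]])
  then have "(LINT x|M. \<sigma> x * (p_flux p (G x) \<bullet> W x)) \<le> 0" by simp
  with nonneg[OF w pw] show ?thesis by simp
qed

text \<open>Any representative \<open>g\<close> of the boundary value differs from the minimizer \<open>v\<close> by an element of \<open>sobolev_zero\<close>, to which the
  flux of \<open>v\<close> is orthogonal; so \<open>g\<close> may be replaced by \<open>v\<close>.\<close>

theorem DN_map_diagonal:
  assumes u: "u \<in> sobolev \<Omega> p"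
  obtains v where "v \<in> coset u" "\<And>w. w \<in> coset u \<Longrightarrow> p_energy \<Omega> p \<sigma> v \<le> p_energy \<Omega> p \<sigma> w"
    "DN_map \<Omega> p \<sigma> (coset u) (coset u) = p_energy \<Omega> p \<sigma> v"
proof -
  define v where "v = dirichlet_solution \<Omega> p \<sigma> (coset u)"
  have "\<exists>v. v \<in> coset u \<and> (\<forall>w\<in>coset u. p_energy \<Omega> p \<sigma> v \<le> p_energy \<Omega> p \<sigma> w)"
    using dirichlet_minimizer_exists[OF u] by metis
  from someI_ex[OF this] have v: "v \<in> coset u" "\<And>w. w \<in> coset u \<Longrightarrow> p_energy \<Omega> p \<sigma> v \<le> p_energy \<Omega> p \<sigma> w"
    unfolding v_def dirichlet_solution_def by auto
  define g where "g = (SOME g. g \<in> coset u)"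
  have g: "g \<in> coset u" unfolding g_def by (rule someI[of "\<lambda>g. g \<in> coset u", OF coset_self[OF u]])
  have pairs: "weak_pair v (wgrad \<Omega> v)" "weak_pair g (wgrad \<Omega> g)"
    using v(1) g by (auto simp: coset_def intro: sobolev_weak_pair)
  have "DN_map \<Omega> p \<sigma> (coset u) (coset u) = (LINT x|M. \<sigma> x * (p_flux p (wgrad \<Omega> v x) \<bullet> wgrad \<Omega> g x))"
    using coset_boundary_space[OF u] by (simp add: DN_map_def Let_def v_def g_def p_flux_def mult.assoc)
  also have "\<dots> = p_energy \<Omega> p \<sigma> v"
  proof -
    have "(LINT x|M. \<sigma> x * (p_flux p (wgrad \<Omega> v x) \<bullet> (wgrad \<Omega> g x - wgrad \<Omega> v x))) = 0"
      by (rule euler_lagrange[OF v pairs(1) coset_diff[OF g v(1)] weak_pair_diff[OF pairs(2,1)]])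
    moreover have "integrable M (\<lambda>x. \<sigma> x * (p_flux p (wgrad \<Omega> v x) \<bullet> wgrad \<Omega> g x))"
      by (intro integrable_\<sigma> integrable_flux weak_pair_Lp(2)[OF pairs(1)] weak_pair_Lp(2)[OF pairs(2)])
    moreover have "integrable M (\<lambda>x. \<sigma> x * norm (wgrad \<Omega> v x) powr p)"
      by (intro integrable_energy weak_pair_Lp(2)[OF pairs(1)])
    ultimately show ?thesis
      by (simp add: inner_diff_right p_flux_inner_self right_diff_distrib p_energy_def)
  qed
  finally show ?thesis using that v by blast
qed

end

section \<open>Wolff solutions of the p-Laplace equation\<close>

text \<open>Insert \<open>exp s * a y\<close> into the p-Laplace equation and write \<open>(a, - a') = r (cos \<phi>, sin \<phi>)\<close>. The equation becomes the system
  \<open>\<phi>' = (p - 1) / wolff_density p \<phi>\<close> and \<open>r' / r = (p - 2) sin \<phi> cos \<phi> / wolff_density p \<phi>\<close>.\<close>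

definition wolff_density :: "real \<Rightarrow> real \<Rightarrow> real" where
  "wolff_density p \<phi> = (p - 1) * (sin \<phi>)\<^sup>2 + (cos \<phi>)\<^sup>2"

text \<open>The variable \<open>y\<close> as a function of the angle, an antiderivative of \<open>wolff_density p \<phi> / (p - 1)\<close>.\<close>

definition wolff_time :: "real \<Rightarrow> real \<Rightarrow> real" where
  "wolff_time p \<phi> = (p / 2 * \<phi> + (2 - p) / 2 * (sin \<phi> * cos \<phi>)) / (p - 1)"

lemma wolff_density_pos: "1 < p \<Longrightarrow> 0 < wolff_density p \<phi>"
  using sin_cos_squared_add[of \<phi>] sin_zero_abs_cos_one[of \<phi>]
  by (cases "sin \<phi> = 0") (auto simp: wolff_density_def intro!: add_pos_nonneg)

lemma wolff_time_deriv:
  assumes "1 < p"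
  shows "(wolff_time p has_real_derivative wolff_density p \<phi> / (p - 1)) (at \<phi>)"
proof -
  have "(wolff_time p has_real_derivative
      (p / 2 + (2 - p) / 2 * ((cos \<phi>)\<^sup>2 - (sin \<phi>)\<^sup>2)) / (p - 1)) (at \<phi>)"
    unfolding wolff_time_def using assms
    by (auto intro!: derivative_eq_intros simp: power2_eq_square)
  moreover have "p / 2 + (2 - p) / 2 * ((cos \<phi>)\<^sup>2 - (sin \<phi>)\<^sup>2) = wolff_density p \<phi>"
    unfolding wolff_density_def cos_squared_eq by (simp add: field_simps)
  ultimately show ?thesis by simp
qed

text \<open>\<open>wolff_time\<close> is strictly increasing, and it is onto because it differs from a linear function by a bounded one.\<close>

lemma wolff_time_inverse:
  assumes p: "1 < p"
  obtains \<theta> where "\<And>y. (\<theta> has_real_derivative (p - 1) / wolff_density p (\<theta> y)) (at y)"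
proof -
  have cont: "isCont (wolff_time p) x" for x using wolff_time_deriv[OF p] DERIV_isCont by blast
  have less: "wolff_time p x < wolff_time p y" if "x < y" for x y
    using that p wolff_density_pos[OF p]
    by (intro DERIV_pos_imp_increasing[OF that]) (auto intro!: exI wolff_time_deriv divide_pos_pos)
  then have inj: "inj (wolff_time p)"
    by (metis injI less_irrefl linorder_neqE_linordered_idom)
  have surj: "\<exists>x. wolff_time p x = y" for y
  proof -
    \<comment> \<open>large enough for the linear part of \<open>wolff_time\<close> to outweigh the bounded part and \<open>y\<close>\<close>
    define b where "b = (\<bar>2 - p\<bar> + \<bar>(p - 1) * y\<bar>) * 2 / p"
    have pb: "p / 2 * b = \<bar>2 - p\<bar> + \<bar>(p - 1) * y\<bar>" using p by (simp add: b_def)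
    have "0 \<le> b" using p by (simp add: b_def)
    have sc: "\<bar>(2 - p) / 2 * (sin x * cos x)\<bar> \<le> \<bar>2 - p\<bar>" for x
    proof -
      have "\<bar>sin x * cos x\<bar> \<le> 1" by (simp add: abs_mult mult_le_one)
      then have "\<bar>(2 - p) / 2\<bar> * \<bar>sin x * cos x\<bar> \<le> \<bar>(2 - p) / 2\<bar> * 1" by (intro mult_left_mono) auto
      then have "\<bar>(2 - p) / 2 * (sin x * cos x)\<bar> \<le> \<bar>2 - p\<bar> / 2" by (simp only: abs_mult) simp
      also have "\<dots> \<le> \<bar>2 - p\<bar>" by simp
      finally show ?thesis .
    qed
    have "(p - 1) * y \<le> p / 2 * b + (2 - p) / 2 * (sin b * cos b)"
      unfolding pb using sc[of b] by linarith
    then have 1: "y \<le> wolff_time p b"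
      using p by (simp add: wolff_time_def pos_le_divide_eq mult.commute)
    have "p / 2 * (- b) + (2 - p) / 2 * (sin (- b) * cos (- b)) \<le> (p - 1) * y"
      using sc[of "- b"] pb by linarith
    then have 2: "wolff_time p (- b) \<le> y"
      using p by (simp add: wolff_time_def pos_divide_le_eq mult.commute)
    show ?thesis
      using IVT[of "wolff_time p" "- b" y b, OF 2 1] \<open>0 \<le> b\<close> cont by auto
  qed
  define \<theta> where "\<theta> = inv (wolff_time p)"
  have \<theta>1: "\<theta> (wolff_time p x) = x" for x unfolding \<theta>_def using inj by simp
  have \<theta>2: "wolff_time p (\<theta> y) = y" for y unfolding \<theta>_def
    by (rule f_inv_into_f) (metis surj rangeI)
  have cont\<theta>: "isCont \<theta> y" for y
    using isCont_inverse_function[of 1 "\<theta> y" \<theta> "wolff_time p"] cont \<theta>1 \<theta>2 by simp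
  have "(\<theta> has_real_derivative (p - 1) / wolff_density p (\<theta> y)) (at y)" for y
  proof -
    have "(\<theta> has_real_derivative inverse (wolff_density p (\<theta> y) / (p - 1))) (at y)"
      by (rule DERIV_inverse_function[of "wolff_time p" _ _ _ "y - 1" "y + 1"])
        (use wolff_time_deriv[OF p] wolff_density_pos[OF p, of "\<theta> y"] p cont\<theta> \<theta>2 in auto)
    then show ?thesis by simp
  qed
  with that show ?thesis by blast
qed

text \<open>With the angle \<open>\<theta>\<close> as a function of \<open>y\<close>, dividing the two equations of the system gives
  \<open>r = exp ((p - 2) sin\<^sup>2 \<theta> / (2 (p - 1)))\<close>, which is bounded above and away from 0. The statement lists what the
  construction of the solutions uses: \<open>a = r cos \<theta>\<close>, \<open>b = r sin \<theta> = - a'\<close>, and the two components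
  \<open>r powr (p - 2) * a\<close>, \<open>r powr (p - 2) * b\<close> of the flux, of which the second has derivative \<open>p - 1\<close> times the first.\<close>

lemma wolff_profile:
  assumes p: "1 < p"
  obtains a b r B' :: "real \<Rightarrow> real" and m K :: real where
    "\<And>y. r y = sqrt ((a y)\<^sup>2 + (b y)\<^sup>2)" "0 < m" "\<And>y. m \<le> r y" "\<And>y. r y \<le> K"
    "\<And>y. (a has_real_derivative - b y) (at y)" "continuous_on UNIV b"
    "\<And>y. ((\<lambda>y. r y powr (p - 2) * a y) has_real_derivative B' y) (at y)"
    "continuous_on UNIV B'"
    "\<And>y. ((\<lambda>y. r y powr (p - 2) * b y)
       has_real_derivative (p - 1) * (r y powr (p - 2) * a y)) (at y)"
proof -
  obtain \<theta> where \<theta>: "\<And>y. (\<theta> has_real_derivative (p - 1) / wolff_density p (\<theta> y)) (at y)"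
    using wolff_time_inverse[OF p] by blast
  have cont\<theta>: "continuous_on UNIV \<theta>"
    using \<theta> DERIV_isCont by (intro continuous_at_imp_continuous_on) blast
  define E :: "real \<Rightarrow> real \<Rightarrow> real" where "E = (\<lambda>k \<phi>. exp (k * (sin \<phi>)\<^sup>2 / 2))"
  define k where "k = (p - 2) / (p - 1)"
  define a where "a = (\<lambda>y. E k (\<theta> y) * cos (\<theta> y))"
  define b where "b = (\<lambda>y. E k (\<theta> y) * sin (\<theta> y))"
  have r: "E k (\<theta> y) = sqrt ((a y)\<^sup>2 + (b y)\<^sup>2)" for y
  proof -
    have "(a y)\<^sup>2 + (b y)\<^sup>2 = (E k (\<theta> y))\<^sup>2 * ((sin (\<theta> y))\<^sup>2 + (cos (\<theta> y))\<^sup>2)"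
      by (simp only: a_def b_def power_mult_distrib distrib_left add.commute)
    then show ?thesis by (simp add: E_def)
  qed
  have r_powr: "E k \<phi> powr (p - 2) * E k \<phi> = E (p - 2) \<phi>" for \<phi>
  proof -
    have "E k \<phi> powr (p - 2) * E k \<phi> = exp ((p - 1) * (k * (sin \<phi>)\<^sup>2 / 2))"
      unfolding E_def by (simp add: exp_powr_real flip: exp_add) (simp add: field_simps)
    also have "(p - 1) * (k * (sin \<phi>)\<^sup>2 / 2) = (p - 2) * (sin \<phi>)\<^sup>2 / 2"
    proof -
      have "(p - 1) * k = p - 2" using p by (simp add: k_def)
      then show ?thesis by (simp only: mult.assoc[symmetric] times_divide_eq_right)
    qed
    finally show ?thesis by (simp add: E_def)
  qed
  have E_deriv: "(E j has_real_derivative j * sin \<phi> * cos \<phi> * E j \<phi>) (at \<phi>)" for j \<phi>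
    unfolding E_def by (auto intro!: derivative_eq_intros simp: power2_eq_square)
  have chain: "((\<lambda>y. f (\<theta> y)) has_real_derivative d (\<theta> y)) (at y)"
    if "\<And>\<phi>. (f has_real_derivative e \<phi>) (at \<phi>)" "\<And>\<phi>. e \<phi> * ((p - 1) / wolff_density p \<phi>) = d \<phi>" for f d e y
    using DERIV_chain2[OF that(1) \<theta>, of y] that(2) by simp
  have D0: "wolff_density p \<phi> \<noteq> 0" for \<phi> using wolff_density_pos[OF p, of \<phi>] by simp
  have a': "(a has_real_derivative - b y) (at y)" for y
  proof -
    have "((\<lambda>y. E k (\<theta> y) * cos (\<theta> y)) has_real_derivative - (E k (\<theta> y) * sin (\<theta> y))) (at y)"
    proof (rule chain[where f = "\<lambda>\<phi>. E k \<phi> * cos \<phi>" and d = "\<lambda>\<phi>. - (E k \<phi> * sin \<phi>)"])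
      show "((\<lambda>\<phi>. E k \<phi> * cos \<phi>) has_real_derivative E k \<phi> * sin \<phi> * (k * (cos \<phi>)\<^sup>2 - 1)) (at \<phi>)" for \<phi>
        by (auto intro!: derivative_eq_intros E_deriv simp: algebra_simps power2_eq_square)
      have "k * (cos \<phi>)\<^sup>2 - 1 = - wolff_density p \<phi> / (p - 1)" for \<phi>
        using p unfolding k_def wolff_density_def cos_squared_eq by (simp add: field_simps)
      then show "E k \<phi> * sin \<phi> * (k * (cos \<phi>)\<^sup>2 - 1) * ((p - 1) / wolff_density p \<phi>) = - (E k \<phi> * sin \<phi>)" for \<phi>
        using p D0[of \<phi>] by simp
    qed
    then show ?thesis by (simp add: a_def b_def)
  qed
  define B' where "B' = (\<lambda>y. E (p - 2) (\<theta> y) * sin (\<theta> y) * ((p - 2) * (cos (\<theta> y))\<^sup>2 - 1) * ((p - 1) / wolff_density p (\<theta> y)))"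
  have B: "E k (\<theta> y) powr (p - 2) * a y = E (p - 2) (\<theta> y) * cos (\<theta> y)"
    "E k (\<theta> y) powr (p - 2) * b y = E (p - 2) (\<theta> y) * sin (\<theta> y)" for y
    unfolding r_powr[symmetric] by (simp_all add: a_def b_def)
  have B_deriv: "((\<lambda>y. E (p - 2) (\<theta> y) * cos (\<theta> y)) has_real_derivative B' y) (at y)" for y
    unfolding B'_def
  proof (rule chain[where f = "\<lambda>\<phi>. E (p - 2) \<phi> * cos \<phi>"
        and d = "\<lambda>\<phi>. E (p - 2) \<phi> * sin \<phi> * ((p - 2) * (cos \<phi>)\<^sup>2 - 1) * ((p - 1) / wolff_density p \<phi>)"])
    show "((\<lambda>\<phi>. E (p - 2) \<phi> * cos \<phi>) has_real_derivative E (p - 2) \<phi> * sin \<phi> * ((p - 2) * (cos \<phi>)\<^sup>2 - 1)) (at \<phi>)" for \<phi>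
      by (auto intro!: derivative_eq_intros E_deriv simp: algebra_simps power2_eq_square)
  qed simp
  have C_deriv: "((\<lambda>y. E (p - 2) (\<theta> y) * sin (\<theta> y)) has_real_derivative (p - 1) * (E (p - 2) (\<theta> y) * cos (\<theta> y))) (at y)" for y
  proof (rule chain[where f = "\<lambda>\<phi>. E (p - 2) \<phi> * sin \<phi>" and d = "\<lambda>\<phi>. (p - 1) * (E (p - 2) \<phi> * cos \<phi>)"])
    show "((\<lambda>\<phi>. E (p - 2) \<phi> * sin \<phi>) has_real_derivative E (p - 2) \<phi> * cos \<phi> * ((p - 2) * (sin \<phi>)\<^sup>2 + 1)) (at \<phi>)" for \<phi>
      by (auto intro!: derivative_eq_intros E_deriv simp: algebra_simps power2_eq_square)
    have "(p - 2) * (sin \<phi>)\<^sup>2 + 1 = wolff_density p \<phi>" for \<phi>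
      unfolding wolff_density_def cos_squared_eq by (simp add: algebra_simps)
    then show "E (p - 2) \<phi> * cos \<phi> * ((p - 2) * (sin \<phi>)\<^sup>2 + 1) * ((p - 1) / wolff_density p \<phi>) = (p - 1) * (E (p - 2) \<phi> * cos \<phi>)" for \<phi>
      using D0[of \<phi>] by simp
  qed
  have contE: "continuous_on UNIV (\<lambda>y. E j (\<theta> y))" for j
    unfolding E_def by (intro continuous_intros cont\<theta>) auto
  have contB': "continuous_on UNIV B'"
    unfolding B'_def using D0 unfolding wolff_density_def by (intro continuous_intros cont\<theta> contE) auto
  have contb: "continuous_on UNIV b" unfolding b_def by (intro continuous_intros cont\<theta> contE)
  have bounds: "exp (- \<bar>k\<bar>) \<le> E k \<phi>" "E k \<phi> \<le> exp \<bar>k\<bar>" for \<phi>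
  proof -
    have "\<bar>k * (sin \<phi>)\<^sup>2 / 2\<bar> \<le> \<bar>k\<bar>"
    proof -
      have "(sin \<phi>)\<^sup>2 \<le> 1" by (simp add: abs_square_le_1)
      then have "\<bar>k\<bar> * ((sin \<phi>)\<^sup>2 / 2) \<le> \<bar>k\<bar> * 1" by (intro mult_left_mono) auto
      then show ?thesis by (simp add: abs_mult)
    qed
    then show "exp (- \<bar>k\<bar>) \<le> E k \<phi>" "E k \<phi> \<le> exp \<bar>k\<bar>" unfolding E_def by (auto simp: abs_le_iff)
  qed
  show ?thesis
    by (rule that[of "\<lambda>y. E k (\<theta> y)" a b "exp (- \<bar>k\<bar>)" "exp \<bar>k\<bar>" B'], unfold B)
      (rule r bounds a' contb B_deriv contB' C_deriv exp_gt_zero)+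
qed

lemma C1_product_of_waves:
  fixes \<rho> \<eta> :: "real^'n::finite"
  assumes P: "\<And>t. (P has_real_derivative P' t) (at t)" and Q: "\<And>t. (Q has_real_derivative Q' t) (at t)"
    and cont: "continuous_on UNIV P'" "continuous_on UNIV Q'"
  shows "C_k (Suc 0) (\<lambda>x. P (x \<bullet> \<rho>) * Q (x \<bullet> \<eta>))"
    and "partial i (\<lambda>x. P (x \<bullet> \<rho>) * Q (x \<bullet> \<eta>)) x
      = P' (x \<bullet> \<rho>) * Q (x \<bullet> \<eta>) * \<rho> $ i + P (x \<bullet> \<rho>) * Q' (x \<bullet> \<eta>) * \<eta> $ i"
proof -
  have wave: "((\<lambda>x::real^'n. F (x \<bullet> v)) has_derivative (\<lambda>h. F' (x \<bullet> v) * (h \<bullet> v))) (at x)"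
    if "\<And>t. (F has_real_derivative F' t) (at t)" for F F' v x
  proof -
    have "((\<lambda>x::real^'n. x \<bullet> v) has_derivative (\<lambda>h. h \<bullet> v)) (at x)"
      by (auto intro!: derivative_eq_intros)
    from has_derivative_compose[OF this that[unfolded has_field_derivative_def]] show ?thesis .
  qed
  have D: "((\<lambda>x. P (x \<bullet> \<rho>) * Q (x \<bullet> \<eta>)) has_derivative
      (\<lambda>h. P (x \<bullet> \<rho>) * (Q' (x \<bullet> \<eta>) * (h \<bullet> \<eta>)) + P' (x \<bullet> \<rho>) * (h \<bullet> \<rho>) * Q (x \<bullet> \<eta>))) (at x)" for x
    by (intro has_derivative_mult wave P Q)
  show part: "partial i (\<lambda>x. P (x \<bullet> \<rho>) * Q (x \<bullet> \<eta>)) x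
      = P' (x \<bullet> \<rho>) * Q (x \<bullet> \<eta>) * \<rho> $ i + P (x \<bullet> \<rho>) * Q' (x \<bullet> \<eta>) * \<eta> $ i" for i x
    using partial_eqI[OF D] by (simp add: inner_axis' algebra_simps)
  have contPQ: "continuous_on UNIV P" "continuous_on UNIV Q"
    using P Q DERIV_isCont by (blast intro: continuous_at_imp_continuous_on)+
  have "continuous_on UNIV (\<lambda>x::real^'n. F (x \<bullet> v))" if "continuous_on UNIV F" for F :: "real \<Rightarrow> real" and v
    by (rule continuous_on_compose2[OF that]) (auto intro!: continuous_intros)
  note c = this[OF contPQ(1), of \<rho>] this[OF contPQ(2), of \<eta>] this[OF cont(1), of \<rho>] this[OF cont(2), of \<eta>]
  have "partial i (\<lambda>x. P (x \<bullet> \<rho>) * Q (x \<bullet> \<eta>))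
      = (\<lambda>x. P' (x \<bullet> \<rho>) * Q (x \<bullet> \<eta>) * \<rho> $ i + P (x \<bullet> \<rho>) * Q' (x \<bullet> \<eta>) * \<eta> $ i)" for i
    using part by blast
  moreover have "continuous_on UNIV (\<lambda>x. P' (x \<bullet> \<rho>) * Q (x \<bullet> \<eta>) * \<rho> $ i + P (x \<bullet> \<rho>) * Q' (x \<bullet> \<eta>) * \<eta> $ i)" for i
    by (intro continuous_intros c)
  ultimately show "C_k (Suc 0) (\<lambda>x. P (x \<bullet> \<rho>) * Q (x \<bullet> \<eta>))"
    using D by (auto simp: differentiable_def)
qed

definition weakly_p_harmonic :: "(real^'n::finite) set \<Rightarrow> real \<Rightarrow> (real^'n \<Rightarrow> real) \<Rightarrow> bool" where
  "weakly_p_harmonic \<Omega> p u \<longleftrightarrow>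
     (\<forall>\<phi>. test_function \<Omega> \<phi> \<longrightarrow> (LINT x|lebesgue_on \<Omega>. p_flux p (gradient u x) \<bullet> gradient \<phi> x) = 0)"

lemma weakly_p_harmonic_if_divergence_free:
  fixes u :: "real^'n::finite \<Rightarrow> real"
  assumes "open \<Omega>" and C1: "\<And>i. C_k (Suc 0) (\<lambda>x. p_flux p (gradient u x) $ i)"
    and div: "\<And>x. (\<Sum>i\<in>UNIV. partial i (\<lambda>x. p_flux p (gradient u x) $ i) x) = 0"
  shows "weakly_p_harmonic \<Omega> p u"
  unfolding weakly_p_harmonic_def
proof (intro allI impI)
  fix \<phi> :: "real^'n \<Rightarrow> real" assume t: "test_function \<Omega> \<phi>"
  define F where "F = (\<lambda>i x. p_flux p (gradient u x) $ i)"
  have wg: "has_weak_gradient \<Omega> (F i) (gradient (F i))" for i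
    unfolding F_def by (rule has_weak_gradient_C1[OF assms(1) C1])
  then have li: "locally_integrable \<Omega> (F i)" "locally_integrable \<Omega> (gradient (F i))" for i
    by (auto simp: has_weak_gradient_def)
  have int: "integrable (lebesgue_on \<Omega>) (\<lambda>x. F i x * partial i \<phi> x)"
    "integrable (lebesgue_on \<Omega>) (\<lambda>x. gradient (F i) x $ i * \<phi> x)" for i
    by (intro locally_integrable_mult_test locally_integrable_component li assms(1) t)+
  have "(LINT x|lebesgue_on \<Omega>. p_flux p (gradient u x) \<bullet> gradient \<phi> x)
      = (LINT x|lebesgue_on \<Omega>. (\<Sum>i\<in>UNIV. F i x * partial i \<phi> x))"
    by (simp add: inner_vec_def F_def gradient_def)
  also have "\<dots> = (\<Sum>i\<in>UNIV. LINT x|lebesgue_on \<Omega>. F i x * partial i \<phi> x)"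
    using int by (intro Bochner_Integration.integral_sum) auto
  also have "\<dots> = (\<Sum>i\<in>UNIV. - (LINT x|lebesgue_on \<Omega>. gradient (F i) x $ i * \<phi> x))"
    using wg t by (intro sum.cong) (auto simp: has_weak_gradient_def)
  also have "\<dots> = - (LINT x|lebesgue_on \<Omega>. (\<Sum>i\<in>UNIV. gradient (F i) x $ i * \<phi> x))"
    using int by (simp add: sum_negf Bochner_Integration.integral_sum)
  also have "(\<lambda>x. \<Sum>i\<in>UNIV. gradient (F i) x $ i * \<phi> x) = (\<lambda>x. 0)"
    using div by (simp add: gradient_def F_def flip: sum_distrib_right)
  finally show "(LINT x|lebesgue_on \<Omega>. p_flux p (gradient u x) \<bullet> gradient \<phi> x) = 0" by simp
qed

text \<open>The flux of \<open>u(x) = exp (x \<bullet> \<rho>) a(x \<bullet> \<eta>)\<close> is a multiple of \<open>exp ((p - 1) (x \<bullet> \<rho>)) (r powr (p - 2) a \<rho> - r powr (p - 2) b \<eta>)\<close>. In its divergence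
  the mixed terms vanish by \<open>\<rho> \<bullet> \<eta> = 0\<close>, and the other two cancel by \<open>|\<eta>| = |\<rho>|\<close> and \<open>(r powr (p - 2) b)' = (p - 1) r powr (p - 2) a\<close>. The
  constants are chosen before the domain and the direction.\<close>

theorem wolff_solutions:
  assumes n: "CARD('n) \<ge> 2" and p: "1 < p"
  shows "\<exists>m K. 0 < m \<and> (\<forall>\<Omega> (\<rho> :: real^'n). open \<Omega> \<longrightarrow> \<rho> \<noteq> 0 \<longrightarrow> (\<exists>u. C_k (Suc 0) u \<and> weakly_p_harmonic \<Omega> p u \<and>
       (\<forall>x. m * (norm \<rho> * exp (x \<bullet> \<rho>)) \<le> norm (gradient u x) \<and> norm (gradient u x) \<le> K * (norm \<rho> * exp (x \<bullet> \<rho>)))))"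
proof -
  obtain a b r B' m K where r: "\<And>y. r y = sqrt ((a y)\<^sup>2 + (b y)\<^sup>2)" and m: "0 < m" "\<And>y. m \<le> r y" "\<And>y. r y \<le> K"
    and a: "\<And>y. (a has_real_derivative - b y) (at y)" "continuous_on UNIV b"
    and B: "\<And>y. ((\<lambda>y. r y powr (p - 2) * a y) has_real_derivative B' y) (at y)"
      "continuous_on UNIV B'"
    and C: "\<And>y. ((\<lambda>y. r y powr (p - 2) * b y)
       has_real_derivative (p - 1) * (r y powr (p - 2) * a y)) (at y)"
    by (rule wolff_profile[OF p]) (rule that)
  define B0 where "B0 = (\<lambda>y. r y powr (p - 2) * a y)"
  define C0 where "C0 = (\<lambda>y. r y powr (p - 2) * b y)"
  have B0: "(B0 has_real_derivative B' y) (at y)" and C0: "(C0 has_real_derivative (p - 1) * B0 y) (at y)" for y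
    using B(1) C unfolding B0_def C0_def by auto
  have contB0: "continuous_on UNIV (\<lambda>y. (p - 1) * B0 y)"
    using B0 DERIV_isCont by (intro continuous_on_mult continuous_on_const continuous_at_imp_continuous_on) blast
  show ?thesis
  proof (rule exI[of _ m], rule exI[of _ K], intro conjI allI impI)
    show "0 < m" by (rule m(1))
    fix \<Omega> :: "(real^'n) set" and \<rho> :: "real^'n" assume "open \<Omega>" and \<rho>: "\<rho> \<noteq> 0"
    obtain y :: "real^'n" where y: "y \<noteq> 0" "orthogonal \<rho> y"
      using orthogonal_to_vector_exists[of \<rho>] n by auto
    \<comment> \<open>the normalization \<open>norm \<eta> = norm \<rho>\<close> makes the divergence vanish\<close>
    define \<eta> where "\<eta> = (norm \<rho> / norm y) *\<^sub>R y"
    have \<eta>: "\<rho> \<bullet> \<eta> = 0" "norm \<eta> = norm \<rho>" "\<eta> \<bullet> \<eta> = \<rho> \<bullet> \<rho>"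
      using y \<rho> by (auto simp: \<eta>_def orthogonal_def dot_square_norm power_divide)
    define u where "u = (\<lambda>x::real^'n. exp (x \<bullet> \<rho>) * a (x \<bullet> \<eta>))"
    have e: "(exp has_real_derivative exp t) (at t)" for t :: real by (rule DERIV_exp)
    have contexp: "continuous_on UNIV (exp :: real \<Rightarrow> real)" by (intro continuous_intros)
    have contb: "continuous_on UNIV (\<lambda>y. - b y)" using a(2) by (intro continuous_intros)
    note U = C1_product_of_waves[OF e a(1) contexp contb, where \<rho> = \<rho> and \<eta> = \<eta>]
    have grad: "gradient u x = exp (x \<bullet> \<rho>) *\<^sub>R (a (x \<bullet> \<eta>) *\<^sub>R \<rho> - b (x \<bullet> \<eta>) *\<^sub>R \<eta>)" for x
      by (simp add: gradient_def vec_eq_iff u_def U(2) algebra_simps)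
    have norm_ab: "norm (s *\<^sub>R \<rho> - t *\<^sub>R \<eta>) = norm \<rho> * sqrt (s\<^sup>2 + t\<^sup>2)" for s t
    proof -
      have "(s *\<^sub>R \<rho> - t *\<^sub>R \<eta>) \<bullet> (s *\<^sub>R \<rho> - t *\<^sub>R \<eta>) = (s\<^sup>2 + t\<^sup>2) * (\<rho> \<bullet> \<rho>)"
        using \<eta> by (simp add: inner_diff inner_commute[of \<eta> \<rho>] power2_eq_square algebra_simps)
      then show ?thesis by (simp add: norm_eq_sqrt_inner real_sqrt_mult)
    qed
    have norm_grad: "norm (gradient u x) = norm \<rho> * exp (x \<bullet> \<rho>) * r (x \<bullet> \<eta>)" for x
      unfolding grad norm_scaleR norm_ab r by simp
    define k where "k = norm \<rho> powr (p - 2)"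
    have flux: "p_flux p (gradient u x) $ i
        = k * \<rho> $ i * (exp ((p - 1) * (x \<bullet> \<rho>)) * B0 (x \<bullet> \<eta>))
          + - (k * \<eta> $ i) * (exp ((p - 1) * (x \<bullet> \<rho>)) * C0 (x \<bullet> \<eta>))" for x i
    proof -
      have "0 \<le> r (x \<bullet> \<eta>)" by (simp add: r)
      then have "norm (gradient u x) powr (p - 2) = k * exp ((p - 2) * (x \<bullet> \<rho>)) * r (x \<bullet> \<eta>) powr (p - 2)"
        unfolding norm_grad by (simp add: powr_mult k_def exp_powr_real mult.commute)
      moreover have "exp ((p - 1) * (x \<bullet> \<rho>)) = exp ((p - 2) * (x \<bullet> \<rho>)) * exp (x \<bullet> \<rho>)"
        by (simp add: algebra_simps flip: exp_add)
      ultimately show ?thesis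
        unfolding p_flux_def by (simp add: grad B0_def C0_def algebra_simps)
    qed
    have e2: "((\<lambda>t. exp ((p - 1) * t)) has_real_derivative (p - 1) * exp ((p - 1) * t)) (at t)" for t
      by (auto intro!: derivative_eq_intros)
    have conte2: "continuous_on UNIV (\<lambda>t. (p - 1) * exp ((p - 1) * t))" by (intro continuous_intros)
    note W1 = C1_product_of_waves[OF e2 B0 conte2 B(2), where \<rho> = \<rho> and \<eta> = \<eta>]
    note W2 = C1_product_of_waves[OF e2 C0 conte2 contB0, where \<rho> = \<rho> and \<eta> = \<eta>]
    have "weakly_p_harmonic \<Omega> p u"
    proof (rule weakly_p_harmonic_if_divergence_free[OF \<open>open \<Omega>\<close>])
      show "C_k (Suc 0) (\<lambda>x. p_flux p (gradient u x) $ i)" for i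
        unfolding flux by (intro C_k_add C_k_mult C_k_const W1 W2)
      fix x
      define s where "s = exp ((p - 1) * (x \<bullet> \<rho>))"
      have "partial i (\<lambda>x. p_flux p (gradient u x) $ i) x
         = k * s * ((p - 1) * B0 (x \<bullet> \<eta>) * (\<rho> $ i * \<rho> $ i) + B' (x \<bullet> \<eta>) * (\<rho> $ i * \<eta> $ i)
           - (p - 1) * C0 (x \<bullet> \<eta>) * (\<rho> $ i * \<eta> $ i) - (p - 1) * B0 (x \<bullet> \<eta>) * (\<eta> $ i * \<eta> $ i))" for i
      proof -
        have scale: "partial i (\<lambda>x. q * f x) x = q * partial i f x" "(\<lambda>x. q * f x) differentiable at x"
          if "C_k (Suc 0) f" for q and f :: "real^'n \<Rightarrow> real"
          using that partial_mult[of "\<lambda>x. q" x f] C_k_mult[OF C_k_const that, of q] by simp_all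
        show ?thesis
          unfolding flux partial_add[OF scale(2)[OF W1(1)] scale(2)[OF W2(1)]]
            scale(1)[OF W1(1)] scale(1)[OF W2(1)] W1(2) W2(2) s_def[symmetric]
          by (simp add: algebra_simps)
      qed
      moreover have dots: "\<rho> \<bullet> \<rho> = (\<Sum>i\<in>UNIV. \<rho> $ i * \<rho> $ i)" "\<rho> \<bullet> \<eta> = (\<Sum>i\<in>UNIV. \<rho> $ i * \<eta> $ i)"
        "\<eta> \<bullet> \<eta> = (\<Sum>i\<in>UNIV. \<eta> $ i * \<eta> $ i)"
        by (simp_all add: inner_vec_def)
      ultimately have "(\<Sum>i\<in>UNIV. partial i (\<lambda>x. p_flux p (gradient u x) $ i) x)
         = k * s * ((p - 1) * B0 (x \<bullet> \<eta>) * (\<rho> \<bullet> \<rho>) + B' (x \<bullet> \<eta>) * (\<rho> \<bullet> \<eta>)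
           - (p - 1) * C0 (x \<bullet> \<eta>) * (\<rho> \<bullet> \<eta>) - (p - 1) * B0 (x \<bullet> \<eta>) * (\<eta> \<bullet> \<eta>))"
        by (simp only: dots sum_distrib_left[symmetric] sum.distrib sum_subtractf)
      also have "\<dots> = 0" by (simp add: \<eta>)
      finally show "(\<Sum>i\<in>UNIV. partial i (\<lambda>x. p_flux p (gradient u x) $ i) x) = 0" .
    qed
    moreover have "m * (norm \<rho> * exp (x \<bullet> \<rho>)) \<le> norm (gradient u x)" "norm (gradient u x) \<le> K * (norm \<rho> * exp (x \<bullet> \<rho>))" for x
      unfolding norm_grad using m(2,3)[of "x \<bullet> \<eta>"]
      by (auto simp: mult.commute[of m] mult.commute[of K] intro!: mult_left_mono)
    moreover have "C_k (Suc 0) u" unfolding u_def by (rule U(1))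
    ultimately show "\<exists>u. C_k (Suc 0) u \<and> weakly_p_harmonic \<Omega> p u \<and>
       (\<forall>x. m * (norm \<rho> * exp (x \<bullet> \<rho>)) \<le> norm (gradient u x) \<and> norm (gradient u x) \<le> K * (norm \<rho> * exp (x \<bullet> \<rho>)))"
      by blast
  qed
qed

section \<open>Monotonicity bounds for the Dirichlet-Neumann map\<close>

context bounded_domain
begin

text \<open>The flux of a continuously differentiable function is bounded on the domain, so orthogonality passes from test functions to their limits.\<close>

lemma weakly_p_harmonic_sobolev_zero:
  assumes u: "C_k (Suc 0) u" "weakly_p_harmonic \<Omega> p u"
    and w: "w \<in> sobolev_zero \<Omega> p" and pw: "weak_pair w W"
  shows "integrable M (\<lambda>x. p_flux p (gradient u x) \<bullet> W x)"
    and "(LINT x|M. p_flux p (gradient u x) \<bullet> W x) = 0"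
proof -
  define F where "F = (\<lambda>x. p_flux p (gradient u x))"
  have contF: "continuous_on UNIV F"
    unfolding F_def using p_gt_1
    by (intro continuous_on_compose2[OF continuous_on_p_flux[of p UNIV] continuous_gradient[OF u(1)]]) auto
  obtain B where B: "0 < B" "\<And>x. x \<in> \<Omega> \<Longrightarrow> norm (F x) \<le> B" using continuous_bounded_domain[OF contF] by metis
  have [measurable]: "F \<in> borel_measurable M" by (rule continuous_measurable_domain[OF contF])
  have main: "integrable M (\<lambda>x. F x \<bullet> V x) \<and> \<bar>LINT x|M. F x \<bullet> V x\<bar> \<le> B * (LINT x|M. norm (V x))"
    if V: "V \<in> Lp \<Omega> p" for V
  proof -
    note [measurable] = Lp_measurable[OF V]
    have intV: "integrable M (\<lambda>x. B * norm (V x))" using Lp_imp_integrable[OF V] by simp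
    have le: "\<bar>F x \<bullet> V x\<bar> \<le> B * norm (V x)" if "x \<in> \<Omega>" for x
      using Cauchy_Schwarz_ineq2[of "F x" "V x"] mult_right_mono[OF B(2)[OF that] norm_ge_zero[of "V x"]]
      by linarith
    have int: "integrable M (\<lambda>x. F x \<bullet> V x)"
      by (rule Bochner_Integration.integrable_bound[OF intV]) (use le B(1) in auto)
    moreover have "\<bar>LINT x|M. F x \<bullet> V x\<bar> \<le> (LINT x|M. \<bar>F x \<bullet> V x\<bar>)" by (rule integral_abs_bound)
    moreover have "(LINT x|M. \<bar>F x \<bullet> V x\<bar>) \<le> (LINT x|M. B * norm (V x))"
      using le int by (intro integral_mono intV) auto
    ultimately show ?thesis
      using order_trans[of "\<bar>LINT x|M. F x \<bullet> V x\<bar>"] by (simp del: integral_abs_bound)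
  qed
  have LW: "W \<in> Lp \<Omega> p" using pw by (simp add: weak_pair_def)
  show int: "integrable M (\<lambda>x. p_flux p (gradient u x) \<bullet> W x)" using main[OF LW] by (simp add: F_def)
  have "\<bar>LINT x|M. F x \<bullet> W x\<bar> \<le> 0 + e" if "0 < e" for e
  proof -
    have "0 < e / B" using that B by simp
    then obtain \<delta> where \<delta>: "0 < \<delta>" "\<And>f :: real^'n \<Rightarrow> real^'n. f \<in> Lp \<Omega> p \<Longrightarrow> modular f < \<delta> \<Longrightarrow> (LINT x|M. norm (f x)) < e / B"
      using L1_norm_small by metis
    obtain \<phi> where \<phi>: "test_function \<Omega> \<phi>" "modular (\<lambda>x. W x - gradient \<phi> x) < \<delta>"
      using w \<delta>(1) unfolding sobolev_zero_iff[OF pw] by blast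
    have L\<phi>: "gradient \<phi> \<in> Lp \<Omega> p" by (rule weak_pair_Lp(2)[OF test_weak_pair[OF \<phi>(1)]])
    have L: "(\<lambda>x. W x - gradient \<phi> x) \<in> Lp \<Omega> p" by (rule Lp_diff(1)[OF LW L\<phi>])
    have "(LINT x|M. F x \<bullet> gradient \<phi> x) = 0"
      using u(2) \<phi>(1) by (simp add: weakly_p_harmonic_def F_def)
    then have "(LINT x|M. F x \<bullet> W x) = (LINT x|M. F x \<bullet> (W x - gradient \<phi> x))"
      using main[OF LW] main[OF L\<phi>] by (simp add: inner_diff_right)
    then have "\<bar>LINT x|M. F x \<bullet> W x\<bar> \<le> B * (LINT x|M. norm (W x - gradient \<phi> x))" using main[OF L] by simp
    also have "\<dots> \<le> B * (e / B)" using \<delta>(2)[OF L \<phi>(2)] B(1) by (intro mult_left_mono) auto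
    finally show ?thesis using B(1) by simp
  qed
  then have "\<bar>LINT x|M. F x \<bullet> W x\<bar> \<le> 0" by (rule field_le_epsilon)
  then show "(LINT x|M. p_flux p (gradient u x) \<bullet> W x) = 0" by (simp add: F_def)
qed

end

context conducting_domain
begin

abbreviation lower_contrast :: "real^'n \<Rightarrow> real" where
  "lower_contrast x \<equiv> (p - 1) * (1 - \<sigma> x powr (- 1 / (p - 1)))"

abbreviation upper_contrast :: "real^'n \<Rightarrow> real" where
  "upper_contrast x \<equiv> \<sigma> x - 1"

lemma integrable_contrast:
  assumes "G \<in> Lp \<Omega> p"
  shows "integrable M (\<lambda>x. lower_contrast x * norm (G x) powr p)"
    and "integrable M (\<lambda>x. upper_contrast x * norm (G x) powr p)"
proof -
  note [measurable] = \<sigma>_measurable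
  have "AE x in M. \<bar>lower_contrast x\<bar> \<le> (p - 1) * (1 + c powr (- 1 / (p - 1)))"
    using \<sigma>_bounds
  proof (rule eventually_mono)
    fix x assume "c \<le> \<sigma> x \<and> \<sigma> x \<le> C"
    then have "\<sigma> x powr (- 1 / (p - 1)) \<le> c powr (- 1 / (p - 1))"
      using c_pos p_gt_1 by (intro powr_mono2') auto
    then have "\<bar>1 - \<sigma> x powr (- 1 / (p - 1))\<bar> \<le> 1 + c powr (- 1 / (p - 1))"
      using powr_ge_zero[of "\<sigma> x" "- 1 / (p - 1)"] by linarith
    then show "\<bar>lower_contrast x\<bar> \<le> (p - 1) * (1 + c powr (- 1 / (p - 1)))"
      using p_gt_1 by (simp add: abs_mult)
  qed
  then show "integrable M (\<lambda>x. lower_contrast x * norm (G x) powr p)"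
    by (rule integrable_bounded_mult[OF Lp_integrable_powr[OF assms], rotated]) measurable
  show "integrable M (\<lambda>x. upper_contrast x * norm (G x) powr p)"
    using integrable_energy[OF assms] Lp_integrable_powr[OF assms] by (simp add: left_diff_distrib)
qed

text \<open>The upper bound compares the minimizer with \<open>u\<close>. For the lower bound, \<open>weighted_norm_powr_lower_bound\<close> is integrated
  with \<open>\<xi>\<close> the gradient of the minimizer and \<open>\<eta>\<close> that of \<open>u\<close>; the linear term drops out because \<open>u\<close> is p-harmonic.\<close>

theorem DN_map_gap:
  assumes u: "C_k (Suc 0) u" "weakly_p_harmonic \<Omega> p u"
  defines "Q \<equiv> DN_map \<Omega> p \<sigma> (coset u) (coset u)"
  shows "(LINT x|M. lower_contrast x * norm (gradient u x) powr p) \<le> Q - modular (gradient u)"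
    and "Q - modular (gradient u) \<le> (LINT x|M. upper_contrast x * norm (gradient u x) powr p)"
proof -
  have pu: "weak_pair u (gradient u)" by (rule weak_pair_C1[OF u(1)])
  have L: "gradient u \<in> Lp \<Omega> p" by (rule weak_pair_Lp(2)[OF pu])
  have us: "u \<in> sobolev \<Omega> p" using pu by (auto simp: sobolev_iff_weak_pair)
  obtain v where v: "v \<in> coset u" "\<And>w. w \<in> coset u \<Longrightarrow> p_energy \<Omega> p \<sigma> v \<le> p_energy \<Omega> p \<sigma> w"
    and "DN_map \<Omega> p \<sigma> (coset u) (coset u) = p_energy \<Omega> p \<sigma> v"
    by (rule DN_map_diagonal[OF us]) (rule that)
  then have Q: "Q = p_energy \<Omega> p \<sigma> v" by (simp only: Q_def)
  have "Q \<le> energy (gradient u)"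
    unfolding Q using v(2)[OF coset_self[OF us]] p_energy_eq[OF pu] by simp
  then show "Q - modular (gradient u) \<le> (LINT x|M. upper_contrast x * norm (gradient u x) powr p)"
    using integrable_energy[OF L] Lp_integrable_powr[OF L] by (simp add: left_diff_distrib)
  define G where "G = wgrad \<Omega> v"
  have pv: "weak_pair v G" unfolding G_def using v(1) by (auto simp: coset_def intro: sobolev_weak_pair)
  have LG: "G \<in> Lp \<Omega> p" by (rule weak_pair_Lp(2)[OF pv])
  note orth = weakly_p_harmonic_sobolev_zero[OF u coset_diff[OF v(1) coset_self[OF us]] weak_pair_diff[OF pv pu]]
  note int = Lp_integrable_powr[OF L] orth(1) integrable_contrast(1)[OF L]
  have "modular (gradient u) + (LINT x|M. lower_contrast x * norm (gradient u x) powr p)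
    = (LINT x|M. norm (gradient u x) powr p + p * (p_flux p (gradient u x) \<bullet> (G x - gradient u x))
        + lower_contrast x * norm (gradient u x) powr p)"
    using int orth(2) by simp
  also have "\<dots> \<le> energy G"
  proof (rule integral_mono_AE)
    show "integrable M (\<lambda>x. norm (gradient u x) powr p + p * (p_flux p (gradient u x) \<bullet> (G x - gradient u x))
        + lower_contrast x * norm (gradient u x) powr p)"
      using int by (intro Bochner_Integration.integrable_add integrable_mult_right)
    show "integrable M (\<lambda>x. \<sigma> x * norm (G x) powr p)" by (rule integrable_energy[OF LG])
    show "AE x in M. norm (gradient u x) powr p + p * (p_flux p (gradient u x) \<bullet> (G x - gradient u x))
        + lower_contrast x * norm (gradient u x) powr p \<le> \<sigma> x * norm (G x) powr p"
      using AE_\<sigma>_pos by (rule eventually_mono) (intro weighted_norm_powr_lower_bound p_gt_1)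
  qed
  also have "energy G = Q" unfolding Q by (simp add: p_energy_eq[OF pv])
  finally show "(LINT x|M. lower_contrast x * norm (gradient u x) powr p) \<le> Q - modular (gradient u)"
    by simp
qed

end

section \<open>Comparison of weights through Wolff solutions\<close>

context bounded_domain
begin

definition bounded_weight :: "(real^'n \<Rightarrow> real) \<Rightarrow> bool" where
  "bounded_weight d \<longleftrightarrow> d \<in> borel_measurable M \<and> (\<exists>B. AE x in M. 0 \<le> d x \<and> d x \<le> B)"

lemma bounded_weight_integrable:
  assumes "bounded_weight d" "continuous_on UNIV g"
  shows "integrable M (\<lambda>x. d x * g x)"
proof -
  obtain B where B: "AE x in M. 0 \<le> d x \<and> d x \<le> B" and d: "d \<in> borel_measurable M"
    using assms(1) by (auto simp: bounded_weight_def)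
  have "AE x in M. \<bar>d x\<bar> \<le> B" using B by (rule eventually_mono) auto
  from integrable_bounded_mult[OF Lp_imp_integrable[OF Lp_continuous[OF assms(2)]] d this] show ?thesis .
qed

lemma bounded_weight_AE_nonneg: "bounded_weight d \<Longrightarrow> AE x in M. 0 \<le> d x"
  by (auto simp: bounded_weight_def elim!: eventually_mono)

text \<open>The form in which the comparison of two contrasts through Wolff solutions is used: the factor \<open>L\<close> is the same for all
  directions and all growth rates, both of which are encoded in \<open>\<rho>\<close>.\<close>

definition exp_dominated :: "(real^'n \<Rightarrow> real) \<Rightarrow> (real^'n \<Rightarrow> real) \<Rightarrow> bool" where
  "exp_dominated e d \<longleftrightarrow> bounded_weight e \<and> bounded_weight d \<and>
     (\<exists>L\<ge>0. \<forall>\<rho>. \<rho> \<noteq> 0 \<longrightarrow> (LINT x|M. e x * exp (x \<bullet> \<rho>)) \<le> L * (LINT x|M. d x * exp (x \<bullet> \<rho>)))"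

text \<open>Use \<open>\<tau> \<rho>\<close> as direction and divide by \<open>exp (\<tau> t)\<close>. The integral with \<open>d\<close> stays bounded in \<open>\<tau>\<close>, since \<open>d\<close> lives where
  \<open>x \<bullet> \<rho> \<le> t\<close>. By \<open>exp z \<ge> z\<close> the integral with \<open>e\<close> is at least \<open>\<tau> \<integral> e max 0 (x \<bullet> \<rho> - t)\<close>, so the latter integral is 0.\<close>

lemma exp_dominated_half_space_nonzero:
  assumes dom: "exp_dominated e d" and \<rho>: "\<rho> \<noteq> 0" and zero: "AE x in M. t < x \<bullet> \<rho> \<longrightarrow> d x = 0"
  shows "AE x in M. t < x \<bullet> \<rho> \<longrightarrow> e x = 0"
proof -
  obtain L where L: "0 \<le> L" "\<And>\<rho>. \<rho> \<noteq> 0 \<Longrightarrow> (LINT x|M. e x * exp (x \<bullet> \<rho>)) \<le> L * (LINT x|M. d x * exp (x \<bullet> \<rho>))"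
    and e: "bounded_weight e" and d: "bounded_weight d"
    using dom by (auto simp: exp_dominated_def)
  define z where "z = (\<lambda>x::real^'n. max 0 (x \<bullet> \<rho> - t))"
  have contz: "continuous_on UNIV z" unfolding z_def by (intro continuous_intros)
  have int_d: "integrable M d" using bounded_weight_integrable[OF d, of "\<lambda>x. 1"] by simp
  have int_ez: "integrable M (\<lambda>x. e x * z x)" by (rule bounded_weight_integrable[OF e contz])
  have scaled: "\<tau> * (LINT x|M. e x * z x) \<le> L * (LINT x|M. d x)" if \<tau>: "0 < \<tau>" for \<tau>
  proof -
    have contexp: "continuous_on UNIV (\<lambda>x::real^'n. exp (x \<bullet> (\<tau> *\<^sub>R \<rho>)))" by (intro continuous_intros)
    have exp_eq: "exp (x \<bullet> (\<tau> *\<^sub>R \<rho>)) = exp (\<tau> * t) * exp (\<tau> * (x \<bullet> \<rho> - t))" for x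
      by (simp add: algebra_simps flip: exp_add)
    have "exp (\<tau> * t) * (\<tau> * (LINT x|M. e x * z x)) = (LINT x|M. exp (\<tau> * t) * (\<tau> * (e x * z x)))" by simp
    also have "\<dots> \<le> (LINT x|M. e x * exp (x \<bullet> (\<tau> *\<^sub>R \<rho>)))"
    proof (rule integral_mono_AE)
      show "integrable M (\<lambda>x. exp (\<tau> * t) * (\<tau> * (e x * z x)))" using int_ez by simp
      show "integrable M (\<lambda>x. e x * exp (x \<bullet> (\<tau> *\<^sub>R \<rho>)))" by (rule bounded_weight_integrable[OF e contexp])
      show "AE x in M. exp (\<tau> * t) * (\<tau> * (e x * z x)) \<le> e x * exp (x \<bullet> (\<tau> *\<^sub>R \<rho>))"
        using bounded_weight_AE_nonneg[OF e]
      proof (rule eventually_mono)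
        fix x assume "0 \<le> e x"
        have "\<tau> * z x \<le> exp (\<tau> * (x \<bullet> \<rho> - t))"
        proof (cases "t \<le> x \<bullet> \<rho>")
          case True
          then have "\<tau> * z x = \<tau> * (x \<bullet> \<rho> - t)" by (simp add: z_def)
          also have "\<dots> \<le> exp (\<tau> * (x \<bullet> \<rho> - t))"
            using exp_ge_add_one_self[of "\<tau> * (x \<bullet> \<rho> - t)"] by linarith
          finally show ?thesis .
        qed (simp add: z_def)
        then have "e x * (\<tau> * z x) \<le> e x * exp (\<tau> * (x \<bullet> \<rho> - t))" using \<open>0 \<le> e x\<close> by (rule mult_left_mono)
        then have "exp (\<tau> * t) * (e x * (\<tau> * z x)) \<le> exp (\<tau> * t) * (e x * exp (\<tau> * (x \<bullet> \<rho> - t)))"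
          by (rule mult_left_mono) simp
        then show "exp (\<tau> * t) * (\<tau> * (e x * z x)) \<le> e x * exp (x \<bullet> (\<tau> *\<^sub>R \<rho>))"
          unfolding exp_eq by (simp add: mult_ac)
      qed
    qed
    also have "\<dots> \<le> L * (LINT x|M. d x * exp (x \<bullet> (\<tau> *\<^sub>R \<rho>)))" using \<rho> \<tau> by (intro L) simp
    also have "\<dots> \<le> L * (LINT x|M. exp (\<tau> * t) * d x)"
    proof (intro mult_left_mono[OF _ L(1)] integral_mono_AE)
      show "integrable M (\<lambda>x. d x * exp (x \<bullet> (\<tau> *\<^sub>R \<rho>)))" by (rule bounded_weight_integrable[OF d contexp])
      show "integrable M (\<lambda>x. exp (\<tau> * t) * d x)" using int_d by simp
      show "AE x in M. d x * exp (x \<bullet> (\<tau> *\<^sub>R \<rho>)) \<le> exp (\<tau> * t) * d x"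
        using bounded_weight_AE_nonneg[OF d] zero
      proof eventually_elim
        case (elim x)
        show ?case
        proof (cases "t < x \<bullet> \<rho>")
          case False
          then have "exp (x \<bullet> (\<tau> *\<^sub>R \<rho>)) \<le> exp (\<tau> * t)" using \<tau> by simp
          then have "d x * exp (x \<bullet> (\<tau> *\<^sub>R \<rho>)) \<le> d x * exp (\<tau> * t)" using elim(1) by (rule mult_left_mono)
          then show ?thesis by (simp add: mult.commute)
        qed (use elim(2) in simp)
      qed
    qed
    also have "\<dots> = exp (\<tau> * t) * (L * (LINT x|M. d x))" by simp
    finally show ?thesis by simp
  qed
  have nonneg: "AE x in M. 0 \<le> e x * z x"
    using bounded_weight_AE_nonneg[OF e] by (rule eventually_mono) (simp add: z_def)
  have "(LINT x|M. e x * z x) \<le> 0"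
  proof (rule ccontr)
    assume "\<not> (LINT x|M. e x * z x) \<le> 0"
    then have pos: "0 < (LINT x|M. e x * z x)" by simp
    obtain n where "L * (LINT x|M. d x) < real n * (LINT x|M. e x * z x)"
      using reals_Archimedean3[OF pos] by blast
    moreover have "real n * (LINT x|M. e x * z x) \<le> L * (LINT x|M. d x)"
    proof (cases "n = 0")
      case True
      have "0 \<le> (LINT x|M. d x)" using bounded_weight_AE_nonneg[OF d] by (rule integral_nonneg_AE)
      with True L(1) show ?thesis by simp
    qed (use scaled[of "real n"] in simp)
    ultimately show False by simp
  qed
  then have "(LINT x|M. e x * z x) = 0" using integral_nonneg_AE[OF nonneg] by simp
  then have "AE x in M. e x * z x = 0"
    using integral_nonneg_eq_0_iff_AE[OF int_ez nonneg] by blast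
  then show ?thesis by (rule eventually_mono) (auto simp: z_def)
qed

text \<open>For \<open>\<rho> = 0\<close> and \<open>t < 0\<close> the condition is that \<open>d\<close> vanishes on the whole domain. As the domain is bounded, it lies in
  the complement of a half-space with nonzero normal.\<close>

lemma exp_dominated_half_space:
  assumes dom: "exp_dominated e d" and zero: "AE x in M. t < x \<bullet> \<rho> \<longrightarrow> d x = 0"
  shows "AE x in M. t < x \<bullet> \<rho> \<longrightarrow> e x = 0"
proof (cases "\<rho> = 0")
  case False
  from exp_dominated_half_space_nonzero[OF dom this zero] show ?thesis .
next
  case True
  show ?thesis
  proof (cases "t < 0")
    case neg: True
    define \<rho>' :: "real^'n" where "\<rho>' = axis undefined 1"
    have n: "norm \<rho>' = 1" by (simp add: \<rho>'_def)
    obtain R where R: "\<And>x. x \<in> \<Omega> \<Longrightarrow> norm x < R"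
      using bounded_domain unfolding bounded_iff by (metis gt_ex order_le_less_trans)
    have inside: "- R < x \<bullet> \<rho>'" if "x \<in> \<Omega>" for x
      using Cauchy_Schwarz_ineq2[of x \<rho>'] R[OF that] n by auto
    have "AE x in M. - R < x \<bullet> \<rho>' \<longrightarrow> e x = 0"
      by (rule exp_dominated_half_space_nonzero[OF dom])
        (use n zero True neg in \<open>auto elim!: eventually_mono\<close>)
    moreover have "AE x in M. x \<in> \<Omega>" by (intro AE_I2) simp
    ultimately show ?thesis by eventually_elim (use inside in auto)
  qed (use True in simp)
qed

text \<open>The Wolff solution for \<open>\<rho> / p\<close> has \<open>|\<nabla>u|\<^sup>p\<close> comparable to a multiple of \<open>exp (x \<bullet> \<rho>)\<close>.\<close>

lemma exp_dominatedI:
  assumes n: "CARD('n) \<ge> 2" and e: "bounded_weight e" and d: "bounded_weight d"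
    and le: "\<And>u. C_k (Suc 0) u \<Longrightarrow> weakly_p_harmonic \<Omega> p u \<Longrightarrow>
      (LINT x|M. e x * norm (gradient u x) powr p) \<le> (LINT x|M. d x * norm (gradient u x) powr p)"
  shows "exp_dominated e d"
proof -
  obtain m K where m: "0 < m" and wolff: "\<And>\<rho> :: real^'n. \<rho> \<noteq> 0 \<Longrightarrow> \<exists>u. C_k (Suc 0) u \<and> weakly_p_harmonic \<Omega> p u \<and>
       (\<forall>x. m * (norm \<rho> * exp (x \<bullet> \<rho>)) \<le> norm (gradient u x) \<and> norm (gradient u x) \<le> K * (norm \<rho> * exp (x \<bullet> \<rho>)))"
    using wolff_solutions[OF n p_gt_1] open_domain by blast
  have bound: "(LINT x|M. e x * exp (x \<bullet> \<rho>)) \<le> (K powr p / m powr p) * (LINT x|M. d x * exp (x \<bullet> \<rho>))"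
    if \<rho>: "\<rho> \<noteq> 0" for \<rho>
  proof -
    \<comment> \<open>the p-th power of the gradient then grows like \<open>exp (x \<bullet> \<rho>)\<close>\<close>
    define \<rho>' where "\<rho>' = (1 / p) *\<^sub>R \<rho>"
    have "\<rho>' \<noteq> 0" using \<rho> p_gt_1 by (simp add: \<rho>'_def)
    then obtain u where u: "C_k (Suc 0) u" "weakly_p_harmonic \<Omega> p u"
      and lo: "\<And>x. m * (norm \<rho>' * exp (x \<bullet> \<rho>')) \<le> norm (gradient u x)"
      and hi: "\<And>x. norm (gradient u x) \<le> K * (norm \<rho>' * exp (x \<bullet> \<rho>'))"
      using wolff by blast
    have K: "0 \<le> K"
    proof -
      have "0 \<le> K * (norm \<rho>' * exp (0 \<bullet> \<rho>'))" using hi[of 0] norm_ge_zero order_trans by blast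
      then show ?thesis using \<open>\<rho>' \<noteq> 0\<close> by (simp add: zero_le_mult_iff)
    qed
    have power: "(q * (norm \<rho>' * exp (x \<bullet> \<rho>'))) powr p = q powr p * norm \<rho>' powr p * exp (x \<bullet> \<rho>)" if "0 \<le> q" for q x
    proof -
      have "exp (x \<bullet> \<rho>') powr p = exp (x \<bullet> \<rho>)" using p_gt_1 by (simp add: exp_powr_real \<rho>'_def)
      then show ?thesis using that by (simp add: powr_mult mult.assoc)
    qed
    have lo': "m powr p * norm \<rho>' powr p * exp (x \<bullet> \<rho>) \<le> norm (gradient u x) powr p" for x
      using powr_mono2[OF _ _ lo, of p x] m p_gt_1 power[of m x] by simp
    have hi': "norm (gradient u x) powr p \<le> K powr p * norm \<rho>' powr p * exp (x \<bullet> \<rho>)" for x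
      using powr_mono2[OF _ _ hi, of p x] p_gt_1 power[OF K, of x] by simp
    have contexp: "continuous_on UNIV (\<lambda>x::real^'n. exp (x \<bullet> \<rho>))" by (intro continuous_intros)
    have contgrad: "continuous_on UNIV (\<lambda>x. norm (gradient u x) powr p)"
      using p_gt_1 by (intro continuous_on_powr' continuous_on_norm continuous_gradient[OF u(1)] continuous_on_const) auto
    have "(m powr p * norm \<rho>' powr p) * (LINT x|M. e x * exp (x \<bullet> \<rho>))
        = (LINT x|M. (m powr p * norm \<rho>' powr p) * (e x * exp (x \<bullet> \<rho>)))" by simp
    also have "\<dots> \<le> (LINT x|M. e x * norm (gradient u x) powr p)"
    proof (intro integral_mono_AE integrable_mult_right bounded_weight_integrable[OF e] contexp contgrad)
      show "AE x in M. (m powr p * norm \<rho>' powr p) * (e x * exp (x \<bullet> \<rho>)) \<le> e x * norm (gradient u x) powr p"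
        using bounded_weight_AE_nonneg[OF e]
      proof (rule eventually_mono)
        fix x assume "0 \<le> e x"
        from mult_left_mono[OF lo'[of x] this]
        show "(m powr p * norm \<rho>' powr p) * (e x * exp (x \<bullet> \<rho>)) \<le> e x * norm (gradient u x) powr p"
          by (simp add: mult_ac)
      qed
    qed
    also have "\<dots> \<le> (LINT x|M. d x * norm (gradient u x) powr p)" by (rule le[OF u])
    also have "\<dots> \<le> (LINT x|M. (K powr p * norm \<rho>' powr p) * (d x * exp (x \<bullet> \<rho>)))"
    proof (intro integral_mono_AE integrable_mult_right bounded_weight_integrable[OF d] contexp contgrad)
      show "AE x in M. d x * norm (gradient u x) powr p \<le> (K powr p * norm \<rho>' powr p) * (d x * exp (x \<bullet> \<rho>))"
        using bounded_weight_AE_nonneg[OF d]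
      proof (rule eventually_mono)
        fix x assume "0 \<le> d x"
        from mult_left_mono[OF hi'[of x] this]
        show "d x * norm (gradient u x) powr p \<le> (K powr p * norm \<rho>' powr p) * (d x * exp (x \<bullet> \<rho>))"
          by (simp add: mult_ac)
      qed
    qed
    also have "\<dots> = (K powr p * norm \<rho>' powr p) * (LINT x|M. d x * exp (x \<bullet> \<rho>))" by simp
    finally have "norm \<rho>' powr p * (m powr p * (LINT x|M. e x * exp (x \<bullet> \<rho>)))
        \<le> norm \<rho>' powr p * (K powr p * (LINT x|M. d x * exp (x \<bullet> \<rho>)))" by (simp only: mult_ac)
    then have "m powr p * (LINT x|M. e x * exp (x \<bullet> \<rho>)) \<le> K powr p * (LINT x|M. d x * exp (x \<bullet> \<rho>))"
      using \<open>\<rho>' \<noteq> 0\<close> by simp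
    then show ?thesis using m by (simp add: pos_le_divide_eq mult.commute)
  qed
  show ?thesis unfolding exp_dominated_def
    by (intro conjI e d exI[of _ "K powr p / m powr p"] allI impI bound) auto
qed

section \<open>Essential support and half-spaces\<close>

text \<open>By the Lindelof property \<open>f\<close> vanishes almost everywhere outside its essential support. Conversely, the part of the
  domain outside the closed half-space is open, so if \<open>f\<close> vanishes there almost everywhere, then the essential support
  does not meet it at all.\<close>

lemma ess_supp_outside_half_space_null_iff:
  "ess_supp \<Omega> f - half_space \<rho> t \<in> null_sets lebesgue \<longleftrightarrow> (AE x in M. t < x \<bullet> \<rho> \<longrightarrow> f x = 0)"
proof
  define \<F> where "\<F> = {U. open U \<and> U \<subseteq> \<Omega> \<and> (AE x in lebesgue_on U. f x = 0)}"
  have supp: "ess_supp \<Omega> f = \<Omega> - \<Union>\<F>" by (simp add: ess_supp_def \<F>_def)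
  {
    assume null: "ess_supp \<Omega> f - half_space \<rho> t \<in> null_sets lebesgue"
    obtain \<F>' where \<F>': "\<F>' \<subseteq> \<F>" "countable \<F>'" "\<Union>\<F>' = \<Union>\<F>"
      using Lindelof[of \<F>] by (auto simp: \<F>_def)
    have "AE x in lebesgue. \<forall>U\<in>\<F>'. x \<in> U \<longrightarrow> f x = 0"
      unfolding AE_ball_countable[OF \<F>'(2)]
    proof
      fix U assume "U \<in> \<F>'"
      then have "open U" "AE x in lebesgue_on U. f x = 0" using \<F>'(1) by (auto simp: \<F>_def)
      then show "AE x in lebesgue. x \<in> U \<longrightarrow> f x = 0" by (simp add: AE_restrict_space_iff)
    qed
    moreover have "AE x in lebesgue. x \<notin> ess_supp \<Omega> f - half_space \<rho> t" using null by (rule AE_not_in)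
    ultimately have "AE x in lebesgue. x \<in> \<Omega> \<longrightarrow> t < x \<bullet> \<rho> \<longrightarrow> f x = 0"
    proof eventually_elim
      case (elim x)
      then show ?case using \<F>'(3) unfolding supp half_space_def by (auto simp: not_le)
    qed
    then show "AE x in M. t < x \<bullet> \<rho> \<longrightarrow> f x = 0" by (simp add: AE_restrict_space_iff)
  }
  {
    assume zero: "AE x in M. t < x \<bullet> \<rho> \<longrightarrow> f x = 0"
    define U where "U = \<Omega> \<inter> {x. t < x \<bullet> \<rho>}"
    have "open U" unfolding U_def by (intro open_Int open_domain open_Collect_less continuous_intros)
    moreover have "AE x in lebesgue_on U. f x = 0"
    proof -
      have "AE x in lebesgue. x \<in> U \<longrightarrow> f x = 0"
        using zero by (simp add: AE_restrict_space_iff) (auto simp: U_def elim!: eventually_mono)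
      then show ?thesis using \<open>open U\<close> by (simp add: AE_restrict_space_iff)
    qed
    moreover have "U \<subseteq> \<Omega>" by (simp add: U_def)
    ultimately have "U \<in> \<F>" by (simp add: \<F>_def)
    then have "ess_supp \<Omega> f - half_space \<rho> t = {}"
      unfolding supp half_space_def U_def by (auto simp: not_le)
    then show "ess_supp \<Omega> f - half_space \<rho> t \<in> null_sets lebesgue" by (simp only: null_sets.empty_sets)
  }
qed

lemma ess_conv_ess_supp_cong:
  assumes "\<And>\<rho> t. (AE x in M. t < x \<bullet> \<rho> \<longrightarrow> f x = 0) \<longleftrightarrow> (AE x in M. t < x \<bullet> \<rho> \<longrightarrow> g x = 0)"
  shows "ess_conv (ess_supp \<Omega> f) = ess_conv (ess_supp \<Omega> g)"
  unfolding ess_conv_def ess_supp_outside_half_space_null_iff assms ..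

section \<open>Contrasts of a conductivity\<close>

lemma Linf_plus_bounds:
  assumes "\<sigma> \<in> Linf_plus \<Omega>"
  obtains c C where "conducting_domain \<Omega> p \<sigma> c C"
proof -
  from assms have m: "\<sigma> \<in> borel_measurable M"
    and up: "esssup M (\<lambda>x. ereal \<bar>\<sigma> x\<bar>) < \<infinity>" and low: "0 < - esssup M (\<lambda>x. - ereal (\<sigma> x))"
    by (auto simp: Linf_plus_def)
  obtain C where C: "esssup M (\<lambda>x. ereal \<bar>\<sigma> x\<bar>) < ereal C" using ereal_dense2[OF up] by auto
  obtain c where c: "0 < ereal c" "ereal c < - esssup M (\<lambda>x. - ereal (\<sigma> x))" using ereal_dense2[OF low] by auto
  have "AE x in M. c \<le> \<sigma> x \<and> \<sigma> x \<le> C"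
    using esssup_AE[of "\<lambda>x. ereal \<bar>\<sigma> x\<bar>" M] esssup_AE[of "\<lambda>x. - ereal (\<sigma> x)" M]
  proof eventually_elim
    case (elim x)
    have "ereal \<bar>\<sigma> x\<bar> < ereal C" using elim(1) C by (rule order_le_less_trans)
    moreover have "ereal c < ereal (\<sigma> x)"
      using c(2) elim(2) by (metis ereal_minus_le_minus ereal_uminus_uminus order_less_le_trans)
    ultimately show ?case by simp
  qed
  moreover have "0 < c" using c(1) by simp
  ultimately show ?thesis using m that[of c C] bounded_domain_axioms
    by (simp add: conducting_domain_def conducting_domain_axioms_def)
qed

end

context conducting_domain
begin

lemma lower_contrast_nonneg: "1 \<le> \<sigma> x \<Longrightarrow> 0 \<le> lower_contrast x"
proof -
  assume "1 \<le> \<sigma> x"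
  then have "\<sigma> x powr (- 1 / (p - 1)) \<le> 1 powr (- 1 / (p - 1))"
    using p_gt_1 by (intro powr_mono2') auto
  then show ?thesis using p_gt_1 by simp
qed

lemma lower_contrast_nonpos: "0 < \<sigma> x \<Longrightarrow> \<sigma> x \<le> 1 \<Longrightarrow> lower_contrast x \<le> 0"
proof -
  assume "0 < \<sigma> x" "\<sigma> x \<le> 1"
  then have "1 powr (- 1 / (p - 1)) \<le> \<sigma> x powr (- 1 / (p - 1))"
    using p_gt_1 by (intro powr_mono2') auto
  then show ?thesis using p_gt_1 by (simp add: mult_nonneg_nonpos)
qed

lemma lower_contrast_eq_0_iff: "0 < \<sigma> x \<Longrightarrow> lower_contrast x = 0 \<longleftrightarrow> \<sigma> x = 1"
  using p_gt_1 powr_eq_one_iff_gen[of "\<sigma> x" "- 1 / (p - 1)"] by (cases "\<sigma> x = 1") auto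

lemma bounded_weight_contrast:
  shows "AE x in M. 1 \<le> \<sigma> x \<Longrightarrow> bounded_weight lower_contrast"
    and "AE x in M. 1 \<le> \<sigma> x \<Longrightarrow> bounded_weight upper_contrast"
    and "AE x in M. \<sigma> x \<le> 1 \<Longrightarrow> bounded_weight (\<lambda>x. - lower_contrast x)"
    and "AE x in M. \<sigma> x \<le> 1 \<Longrightarrow> bounded_weight (\<lambda>x. - upper_contrast x)"
proof -
  note [measurable] = \<sigma>_measurable
  {
    assume ge: "AE x in M. 1 \<le> \<sigma> x"
    have "AE x in M. 0 \<le> lower_contrast x \<and> lower_contrast x \<le> p - 1"
      using ge
    proof (rule eventually_mono)
      fix x assume "1 \<le> \<sigma> x"
      moreover have "lower_contrast x \<le> (p - 1) * 1" using p_gt_1 by (intro mult_left_mono) auto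
      ultimately show "0 \<le> lower_contrast x \<and> lower_contrast x \<le> p - 1"
        using lower_contrast_nonneg by simp
    qed
    moreover have "lower_contrast \<in> borel_measurable M" by measurable
    ultimately show "bounded_weight lower_contrast" unfolding bounded_weight_def by blast
    have "AE x in M. 0 \<le> upper_contrast x \<and> upper_contrast x \<le> C - 1"
      using ge \<sigma>_bounds by eventually_elim auto
    moreover have "upper_contrast \<in> borel_measurable M" by measurable
    ultimately show "bounded_weight upper_contrast" unfolding bounded_weight_def by blast
  }
  {
    assume le: "AE x in M. \<sigma> x \<le> 1"
    have "AE x in M. 0 \<le> - lower_contrast x \<and> - lower_contrast x \<le> (p - 1) * c powr (- 1 / (p - 1))"
      using le \<sigma>_bounds
    proof eventually_elim
      case (elim x)
      then have "\<sigma> x powr (- 1 / (p - 1)) \<le> c powr (- 1 / (p - 1))"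
        using c_pos p_gt_1 by (intro powr_mono2') auto
      then have "(p - 1) * (\<sigma> x powr (- 1 / (p - 1)) - 1) \<le> (p - 1) * c powr (- 1 / (p - 1))"
        using p_gt_1 by (intro mult_left_mono) auto
      moreover have "- lower_contrast x = (p - 1) * (\<sigma> x powr (- 1 / (p - 1)) - 1)"
        by (simp add: algebra_simps)
      ultimately show ?case using lower_contrast_nonpos[of x] elim c_pos by simp
    qed
    moreover have "(\<lambda>x. - lower_contrast x) \<in> borel_measurable M" by measurable
    ultimately show "bounded_weight (\<lambda>x. - lower_contrast x)" unfolding bounded_weight_def by blast
    have "AE x in M. 0 \<le> - upper_contrast x \<and> - upper_contrast x \<le> 1"
      using le AE_\<sigma>_pos by eventually_elim auto
    moreover have "(\<lambda>x. - upper_contrast x) \<in> borel_measurable M" by measurable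
    ultimately show "bounded_weight (\<lambda>x. - upper_contrast x)" unfolding bounded_weight_def by blast
  }
qed

lemma AE_lower_contrast_eq_0_iff:
  "(AE x in M. P x \<longrightarrow> lower_contrast x = 0) \<longleftrightarrow> (AE x in M. P x \<longrightarrow> \<sigma> x - 1 = 0)"
proof -
  have "AE x in M. (P x \<longrightarrow> lower_contrast x = 0) = (P x \<longrightarrow> \<sigma> x - 1 = 0)"
    using AE_\<sigma>_pos by (rule eventually_mono) (use lower_contrast_eq_0_iff in auto)
  then show ?thesis by (rule eventually_subst)
qed

end

section \<open>Recovery of the convex hull\<close>

lemma DN_map_eq_imp_contrast_le:
  fixes \<Omega> :: "(real^'n::finite) set"
  assumes D1: "conducting_domain \<Omega> p \<sigma>\<^sub>1 c\<^sub>1 C\<^sub>1" and D2: "conducting_domain \<Omega> p \<sigma>\<^sub>2 c\<^sub>2 C\<^sub>2"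
    and DN: "DN_map \<Omega> p \<sigma>\<^sub>1 = DN_map \<Omega> p \<sigma>\<^sub>2"
    and u: "C_k (Suc 0) u" "weakly_p_harmonic \<Omega> p u"
  shows "(LINT x|lebesgue_on \<Omega>. (p - 1) * (1 - \<sigma>\<^sub>1 x powr (- 1 / (p - 1))) * norm (gradient u x) powr p)
      \<le> (LINT x|lebesgue_on \<Omega>. (\<sigma>\<^sub>2 x - 1) * norm (gradient u x) powr p)"
  using conducting_domain.DN_map_gap(1)[OF D1 u] conducting_domain.DN_map_gap(2)[OF D2 u]
  unfolding DN by linarith

text \<open>The lower bound for \<open>\<sigma>\<^sub>1\<close> is nonnegative, the upper bound for \<open>\<sigma>\<^sub>2\<close> is nonpositive, and the first is at most the
  second. So the integrals of both contrasts are dominated by 0.\<close>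

lemma opposite_sides_imp_trivial:
  fixes \<Omega> :: "(real^'n::finite) set"
  assumes n: "CARD('n) \<ge> 2" and D1: "conducting_domain \<Omega> p \<sigma>\<^sub>1 c\<^sub>1 C\<^sub>1" and D2: "conducting_domain \<Omega> p \<sigma>\<^sub>2 c\<^sub>2 C\<^sub>2"
    and DN: "DN_map \<Omega> p \<sigma>\<^sub>1 = DN_map \<Omega> p \<sigma>\<^sub>2"
    and ge: "AE x in lebesgue_on \<Omega>. \<sigma>\<^sub>1 x \<ge> 1" and le: "AE x in lebesgue_on \<Omega>. \<sigma>\<^sub>2 x \<le> 1"
  shows "AE x in lebesgue_on \<Omega>. \<sigma>\<^sub>1 x = 1" and "AE x in lebesgue_on \<Omega>. \<sigma>\<^sub>2 x = 1"
proof -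
  interpret D1: conducting_domain \<Omega> p \<sigma>\<^sub>1 c\<^sub>1 C\<^sub>1 by (rule D1)
  interpret D2: conducting_domain \<Omega> p \<sigma>\<^sub>2 c\<^sub>2 C\<^sub>2 by (rule D2)
  note lower = D1.bounded_weight_contrast(1)[OF ge] and upper = D2.bounded_weight_contrast(4)[OF le]
  have zero_weight: "D1.bounded_weight (\<lambda>x. 0)" by (auto simp: D1.bounded_weight_def)
  define f where "f = (\<lambda>u. LINT x|lebesgue_on \<Omega>. D1.lower_contrast x * norm (gradient u x) powr p)"
  define g where "g = (\<lambda>u. LINT x|lebesgue_on \<Omega>. - D2.upper_contrast x * norm (gradient u x) powr p)"
  have nonneg: "0 \<le> (LINT x|lebesgue_on \<Omega>. d x * norm (gradient u x) powr p)"
    if "D1.bounded_weight d" for d u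
    using D1.bounded_weight_AE_nonneg[OF that] by (intro integral_nonneg_AE) (auto elim!: eventually_mono)
  have "0 \<le> f u" "0 \<le> g u" for u
    using nonneg[OF lower] nonneg[OF upper] by (auto simp only: f_def g_def)
  moreover have "f u \<le> - g u" if "C_k (Suc 0) u" "weakly_p_harmonic \<Omega> p u" for u
    using DN_map_eq_imp_contrast_le[OF D1 D2 DN that]
    unfolding f_def g_def mult_minus_left integral_minus minus_minus .
  ultimately have le0: "f u \<le> 0" "g u \<le> 0" if "C_k (Suc 0) u" "weakly_p_harmonic \<Omega> p u" for u
    using that by (smt (verit))+
  have "D1.exp_dominated D1.lower_contrast (\<lambda>x. 0)"
    by (rule D1.exp_dominatedI[OF n lower zero_weight]) (use le0(1) in \<open>simp only: f_def mult_zero_left integral_zero\<close>)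
  \<comment> \<open>with \<open>t = -1\<close> and \<open>\<rho> = 0\<close> the half-space is empty\<close>
  then have "AE x in lebesgue_on \<Omega>. - 1 < x \<bullet> 0 \<longrightarrow> D1.lower_contrast x = 0"
    by (rule D1.exp_dominated_half_space) simp
  then show "AE x in lebesgue_on \<Omega>. \<sigma>\<^sub>1 x = 1"
    unfolding D1.AE_lower_contrast_eq_0_iff by (rule eventually_mono) simp
  have "D1.exp_dominated (\<lambda>x. - D2.upper_contrast x) (\<lambda>x. 0)"
    by (rule D1.exp_dominatedI[OF n upper zero_weight]) (use le0(2) in \<open>simp only: g_def mult_zero_left integral_zero\<close>)
  then have "AE x in lebesgue_on \<Omega>. - 1 < x \<bullet> 0 \<longrightarrow> - D2.upper_contrast x = 0"
    by (rule D1.exp_dominated_half_space) simp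
  then show "AE x in lebesgue_on \<Omega>. \<sigma>\<^sub>2 x = 1" by (rule eventually_mono) simp
qed

text \<open>On the same side of 1 one contrast of \<open>\<sigma>\<^sub>1\<close> is dominated by a contrast of \<open>\<sigma>\<^sub>2\<close>: the lower by the upper one if both
  are at least 1, and with the roles exchanged if both are at most 1.\<close>

lemma contrast_vanishing_transfer:
  fixes \<Omega> :: "(real^'n::finite) set"
  assumes n: "CARD('n) \<ge> 2" and D1: "conducting_domain \<Omega> p \<sigma>\<^sub>1 c\<^sub>1 C\<^sub>1" and D2: "conducting_domain \<Omega> p \<sigma>\<^sub>2 c\<^sub>2 C\<^sub>2"
    and side1: "(AE x in lebesgue_on \<Omega>. \<sigma>\<^sub>1 x \<ge> 1) \<or> (AE x in lebesgue_on \<Omega>. \<sigma>\<^sub>1 x \<le> 1)"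
    and side2: "(AE x in lebesgue_on \<Omega>. \<sigma>\<^sub>2 x \<ge> 1) \<or> (AE x in lebesgue_on \<Omega>. \<sigma>\<^sub>2 x \<le> 1)"
    and DN: "DN_map \<Omega> p \<sigma>\<^sub>1 = DN_map \<Omega> p \<sigma>\<^sub>2"
    and zero: "AE x in lebesgue_on \<Omega>. t < x \<bullet> \<rho> \<longrightarrow> \<sigma>\<^sub>2 x - 1 = 0"
  shows "AE x in lebesgue_on \<Omega>. t < x \<bullet> \<rho> \<longrightarrow> \<sigma>\<^sub>1 x - 1 = 0"
proof -
  interpret D1: conducting_domain \<Omega> p \<sigma>\<^sub>1 c\<^sub>1 C\<^sub>1 by (rule D1)
  interpret D2: conducting_domain \<Omega> p \<sigma>\<^sub>2 c\<^sub>2 C\<^sub>2 by (rule D2)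
  consider (ge) "AE x in lebesgue_on \<Omega>. \<sigma>\<^sub>1 x \<ge> 1" "AE x in lebesgue_on \<Omega>. \<sigma>\<^sub>2 x \<ge> 1"
    | (le) "AE x in lebesgue_on \<Omega>. \<sigma>\<^sub>1 x \<le> 1" "AE x in lebesgue_on \<Omega>. \<sigma>\<^sub>2 x \<le> 1"
    | (opposite) "AE x in lebesgue_on \<Omega>. \<sigma>\<^sub>1 x = 1"
    using side1 side2 opposite_sides_imp_trivial(1)[OF n D1 D2 DN] opposite_sides_imp_trivial(2)[OF n D2 D1 DN[symmetric]]
    by blast
  then show ?thesis
  proof cases
    case ge
    have "D1.exp_dominated D1.lower_contrast D2.upper_contrast"
      by (rule D1.exp_dominatedI[OF n D1.bounded_weight_contrast(1)[OF ge(1)] D2.bounded_weight_contrast(2)[OF ge(2)]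
            DN_map_eq_imp_contrast_le[OF D1 D2 DN]])
    from D1.exp_dominated_half_space[OF this zero] show ?thesis
      unfolding D1.AE_lower_contrast_eq_0_iff .
  next
    case le
    have "D1.exp_dominated (\<lambda>x. - D1.upper_contrast x) (\<lambda>x. - D2.lower_contrast x)"
    proof (rule D1.exp_dominatedI[OF n D1.bounded_weight_contrast(4)[OF le(1)] D2.bounded_weight_contrast(3)[OF le(2)]])
      fix u assume u: "C_k (Suc 0) u" "weakly_p_harmonic \<Omega> p u"
      show "(LINT x|lebesgue_on \<Omega>. - D1.upper_contrast x * norm (gradient u x) powr p)
          \<le> (LINT x|lebesgue_on \<Omega>. - D2.lower_contrast x * norm (gradient u x) powr p)"
        using DN_map_eq_imp_contrast_le[OF D2 D1 DN[symmetric] u]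
        by (simp only: mult_minus_left integral_minus neg_le_iff_le)
    qed
    moreover have "AE x in lebesgue_on \<Omega>. t < x \<bullet> \<rho> \<longrightarrow> - D2.lower_contrast x = 0"
      using zero unfolding neg_equal_0_iff_equal D2.AE_lower_contrast_eq_0_iff .
    ultimately have "AE x in lebesgue_on \<Omega>. t < x \<bullet> \<rho> \<longrightarrow> - D1.upper_contrast x = 0"
      by (rule D1.exp_dominated_half_space)
    then show ?thesis unfolding neg_equal_0_iff_equal .
  next
    case opposite
    then show ?thesis by (rule eventually_mono) simp
  qed
qed

theorem theorem1p1:
  fixes \<Omega> :: "(real^'n::finite) set" and p :: real and \<sigma>\<^sub>1 \<sigma>\<^sub>2 :: "real^'n \<Rightarrow> real"
  assumes "CARD('n) \<ge> 2"
    and "open \<Omega>" and "bounded \<Omega>"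
    and "1 < p"
    and "\<sigma>\<^sub>1 \<in> Linf_plus \<Omega>" and "\<sigma>\<^sub>2 \<in> Linf_plus \<Omega>"
    and "(AE x in lebesgue_on \<Omega>. \<sigma>\<^sub>1 x \<ge> 1) \<or> (AE x in lebesgue_on \<Omega>. \<sigma>\<^sub>1 x \<le> 1)"
    and "(AE x in lebesgue_on \<Omega>. \<sigma>\<^sub>2 x \<ge> 1) \<or> (AE x in lebesgue_on \<Omega>. \<sigma>\<^sub>2 x \<le> 1)"
    and "DN_map \<Omega> p \<sigma>\<^sub>1 = DN_map \<Omega> p \<sigma>\<^sub>2"
  shows "ess_conv (ess_supp \<Omega> (\<lambda>x. \<sigma>\<^sub>1 x - 1)) = ess_conv (ess_supp \<Omega> (\<lambda>x. \<sigma>\<^sub>2 x - 1)) \<and>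
    ((AE x in lebesgue_on \<Omega>. \<sigma>\<^sub>1 x \<ge> 1) \<longleftrightarrow> (AE x in lebesgue_on \<Omega>. \<sigma>\<^sub>2 x \<ge> 1)) \<and>
    ((AE x in lebesgue_on \<Omega>. \<sigma>\<^sub>1 x \<le> 1) \<longleftrightarrow> (AE x in lebesgue_on \<Omega>. \<sigma>\<^sub>2 x \<le> 1))"
proof -
  interpret bounded_domain \<Omega> p using assms(2-4) by unfold_locales
  obtain c\<^sub>1 C\<^sub>1 where D1: "conducting_domain \<Omega> p \<sigma>\<^sub>1 c\<^sub>1 C\<^sub>1" using Linf_plus_bounds[OF assms(5)] .
  obtain c\<^sub>2 C\<^sub>2 where D2: "conducting_domain \<Omega> p \<sigma>\<^sub>2 c\<^sub>2 C\<^sub>2" using Linf_plus_bounds[OF assms(6)] .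
  have iff: "(AE x in M. t < x \<bullet> \<rho> \<longrightarrow> \<sigma>\<^sub>1 x - 1 = 0) \<longleftrightarrow> (AE x in M. t < x \<bullet> \<rho> \<longrightarrow> \<sigma>\<^sub>2 x - 1 = 0)" for \<rho> t
    using contrast_vanishing_transfer[OF assms(1) D1 D2 assms(7-9)]
      contrast_vanishing_transfer[OF assms(1) D2 D1 assms(8,7) assms(9)[symmetric]] by blast
  \<comment> \<open>the complement of the empty half-space with \<open>t = -1\<close>, \<open>\<rho> = 0\<close> is the whole space, so \<open>iff\<close> covers \<open>\<sigma> = 1\<close>\<close>
  have sides: "(AE x in M. 1 \<le> \<sigma> x) \<and> (AE x in M. \<sigma> x \<le> 1) \<longleftrightarrow> (AE x in M. - 1 < x \<bullet> 0 \<longrightarrow> \<sigma> x - 1 = 0)"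
    for \<sigma> :: "real^'n \<Rightarrow> real"
    unfolding AE_conj_iff[symmetric] by (intro arg_cong[where f = "almost_everywhere M"] ext) auto
  have trivial: "(AE x in M. 1 \<le> \<sigma>\<^sub>1 x) \<and> (AE x in M. \<sigma>\<^sub>1 x \<le> 1) \<longleftrightarrow> (AE x in M. 1 \<le> \<sigma>\<^sub>2 x) \<and> (AE x in M. \<sigma>\<^sub>2 x \<le> 1)"
    unfolding sides by (rule iff)
  have one: "(AE x in M. 1 \<le> \<sigma> x) \<and> (AE x in M. \<sigma> x \<le> 1)" if "AE x in M. \<sigma> x = 1" for \<sigma> :: "real^'n \<Rightarrow> real"
    using that by (auto elim!: eventually_mono)
  have opposite: "(AE x in M. \<sigma>\<^sub>1 x \<le> 1) \<and> (AE x in M. 1 \<le> \<sigma>\<^sub>2 x)" if "(AE x in M. 1 \<le> \<sigma>\<^sub>1 x) \<and> (AE x in M. \<sigma>\<^sub>2 x \<le> 1)"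
    using opposite_sides_imp_trivial[OF assms(1) D1 D2 assms(9)] that one by blast
  have opposite': "(AE x in M. \<sigma>\<^sub>2 x \<le> 1) \<and> (AE x in M. 1 \<le> \<sigma>\<^sub>1 x)" if "(AE x in M. 1 \<le> \<sigma>\<^sub>2 x) \<and> (AE x in M. \<sigma>\<^sub>1 x \<le> 1)"
    using opposite_sides_imp_trivial[OF assms(1) D2 D1 assms(9)[symmetric]] that one by blast
  show ?thesis
    using ess_conv_ess_supp_cong[OF iff] assms(7,8) trivial opposite opposite' by blast
qed

end
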